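(* Let $\mathcal{C}$ be a category with pullbacks of split epimorphisms along split epimorphisms, and let $\mathcal{M}$ be a class of spans in $\mathcal{C}$ that is closed under the kernel pair construction and contains the span part of every local product. Then the following conditions are equivalent: (1) The Lawvere condition holds in $\mathcal{C}$ with respect to $\mathcal{M}$, i.e. the forgetful functor $\mathbf{Grpd}(\mathcal{C},\mathcal{M})\to\mathbf{RG}(\mathcal{C},\mathcal{M})$ is an isomorphism of categories. (2) The forgetful functor $\mathbf{Grpd}(\mathcal{C},\mathcal{M})\to\mathbf{RG}(\mathcal{C},\mathcal{M})$ has a section. (3) The forgetful functor $\mathbf{Cat}(\mathcal{C},\mathcal{M})\to\mathbf{RG}(\mathcal{C},\mathcal{M})$ has a section. (4) For all morphisms $p_1\colon E\to A$, $e_1\colon A\to E$, $p_2\colon E\to C$, $e_2\colon C\to E$, $\alpha\colon A\to D$, $\gamma\colon C\to D$, $d\colon D\to D_0$, $c\colon D\to D_1$ in $\mathcal{C}$, if (a) the pair $(p_1,p_2)$ is jointly monic; (b) the spans $(D,d,c)$ and $(E,p_1,p_2)$ belong to $\mathcal{M}$; and (c) the identities $$p_1e_1=1_A,\quad p_2e_2=1_C,\quad (e_1p_1)(e_2p_2)=(e_2p_2)(e_1p_1),\quad \alpha p_1(e_2p_2)=\gamma p_2(e_1p_1),$$ $$d\alpha p_1=d\alpha p_1(e_2p_2),\quad c\gamma p_2=c\gamma p_2(e_1p_1)$$ hold, then there exists a unique morphism $m\colon E\to D$ such that $me_1=\alpha$, $me_2=\gamma$, $dm=d\gamma p_2$,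 $cm=c\alpha p_1$. (5) For all morphisms $f\colon A\to B$, $r\colon B\to A$, $g\colon C\to B$, $s\colon B\to C$, $\alpha\colon A\to D$, $\beta\colon B\to D$, $\gamma\colon C\to D$, $d\colon D\to D_0$, $c\colon D\to D_1$ in $\mathcal{C}$, if $fr=1_B=gs$, $\alpha r=\beta=\gamma s$, $d\alpha=d\beta f$, $c\beta g=c\gamma$ and $(D,d,c)\in\mathcal{M}$, then there exists a unique morphism $m\colon A\times_BC\to D$ (where $A\times_B C$ is the pullback of $f$ and $g$, with projections $\pi_1,\pi_2$) such that $m\langle 1_A,sf\rangle=\alpha$, $m\langle rg,1_C\rangle=\gamma$, $dm=d\gamma\pi_2$, $cm=c\alpha\pi_1$. (6) Every span $(D,d,c)\in\mathcal{M}$ is equipped with a unique morphism $p_D\colon D(d,c)\to D$ such that, for any three parallel morphisms $x,y,z\colon Z\to D$ with $dx=dy$ and $cy=cz$, $$dp_D\langle x,y,z\rangle=dz,\quad cp_D\langle x,y,z\rangle=cx,\quad p_D\langle x,y,y\rangle=x,\quad p_D\langle y,y,z\rangle=z,$$ and moreover, for any morphisms $f\colon D\to D'$, $f_0\colon D_0\to D'_0$, $f_1\colon D_1\to D'_1$ with $d'f=f_0d$, $c'f=f_1c$ and $(D',d',c')\in\mathcal{M}$, one has $f\,p_D=p_{D'}\,(f\times_{f_0}f\times_{f_1}f)$. In particular, for every object $Z$ and morphisms $u,v,x,y,z\colon Z\to D$ with $du=dv$, $cv=cx$, $dx=dy$ and $cy=cz$, the associative law holds: $$p_D\langle u,v,p_D\langle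 x,y,z\rangle\rangle=p_D\langle p_D\langle u,v,x\rangle,y,z\rangle.$$
   Context: A span $(D,d,c)$ in $\mathcal{C}$ is a pair of morphisms $d\colon D\to D_0$, $c\colon D\to D_1$ both of which admit kernel pairs: $(d_1,d_2\colon D(d)\to D)$ is the kernel pair of $d$ and $(c_1,c_2\colon D(c)\to D)$ that of $c$. Kernel pair construction: $D(d,c)$ is the pullback of $d_2\colon D(d)\to D$ and $c_1\colon D(c)\to D$ (both split by the diagonals), with projections $p_1\colon D(d,c)\to D(d)$, $p_2\colon D(d,c)\to D(c)$. Morphisms $Z\to D(d,c)$ correspond to triples $\langle x,y,z\rangle$ of morphisms $Z\to D$ with $dx=dy$ and $cy=cz$. Put $\mathrm{dom}=d_1p_1$ and $\mathrm{cod}=c_2p_2$, so $\mathrm{dom}\langle x,y,z\rangle=x$, $\mathrm{cod}\langle x,y,z\rangle=z$. A class $\mathcal{M}$ of spans is closed under the kernel pair construction if $(D(d,c),\mathrm{dom},\mathrm{cod})\in\mathcal{M}$ whenever $(D,d,c)\in\mathcal{M}$. For $f,f_0,f_1$ with $d'f=f_0d$, $c'f=f_1c$, the morphism $f\times_{f_0}f\times_{f_1}f\colon D(d,c)\to D'(d',c')$ sends $\langle x,y,z\rangle$ to $\langle fx,fy,fz\rangle$. Local product: a diagram $p_1\colon E\to A$, $e_1\colon A\to E$, $p_2\colon E\to C$, $e_2\colon C\to E$ for which there are $f\colon A\to B$, $r\colon B\to A$, $g\colon C\to B$, $s\colon B\to C$ with $fr=1_B=gs$ such that $(E,p_1,p_2)$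 is the pullback of $f$ and $g$, $e_1=\langle1_A,sf\rangle$ and $e_2=\langle rg,1_C\rangle$. Its span part is $(E,p_1,p_2)$. Reflexive graph: $(C_1,C_0,d,e,c)$ with $d,c\colon C_1\to C_0$, $e\colon C_0\to C_1$, $de=1_{C_0}=ce$. Internal category: a reflexive graph with $m\colon C_2\to C_1$, where $C_2=C_1\times_{C_0}C_1$ is the pullback with projections satisfying $d\pi_1=c\pi_2$, such that $dm=d\pi_2$, $cm=c\pi_1$, $m\langle1_{C_1},ed\rangle=1_{C_1}=m\langle ec,1_{C_1}\rangle$, and $m$ is associative. Internal groupoid: an internal category with $i\colon C_1\to C_1$ satisfying $m\langle 1_{C_1},i\rangle=ec$ and $m\langle i,1_{C_1}\rangle=ed$ (in particular $di=c$, $ci=d$). $\mathbf{RG}(\mathcal{C},\mathcal{M})$, $\mathbf{Cat}(\mathcal{C},\mathcal{M})$, $\mathbf{Grpd}(\mathcal{C},\mathcal{M})$ are the categories of reflexive graphs, internal categories, internal groupoids whose span part $(C_1,d,c)$ belongs to $\mathcal{M}$, with the usual structure-preserving morphisms. A section of a functor $F$ is a functor $S$ with $FS$ equal to the identity. *)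

theory Defs
  imports Main
begin

section \<open>Categories and functors\<close>

record ('o, 'm) cat =
  Obj :: "'o set"
  Arr :: "'m set"
  Dom :: "'m \<Rightarrow> 'o"
  Cod :: "'m \<Rightarrow> 'o"
  Idn :: "'o \<Rightarrow> 'm" ("\<one>\<index>")
  Cmp :: "'m \<Rightarrow> 'm \<Rightarrow> 'm" (infixl "\<cdot>\<index>" 70)  \<comment> \<open>applicative order: \<open>g \<cdot> f\<close> is \<open>g\<close> after \<open>f\<close>\<close>

definition hom :: "('o, 'm, 'z) cat_scheme \<Rightarrow> 'o \<Rightarrow> 'o \<Rightarrow> 'm set" ("hom\<index>")
  where "hom A B = {f \<in> Arr \<C>. Dom \<C> f = A \<and> Cod \<C> f = B}" for \<C> (structure)

locale category =
  fixes \<C> :: "('o, 'm, 'z) cat_scheme" (structure)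
  assumes Dom_Obj: "f \<in> Arr \<C> \<Longrightarrow> Dom \<C> f \<in> Obj \<C>"
    and Cod_Obj: "f \<in> Arr \<C> \<Longrightarrow> Cod \<C> f \<in> Obj \<C>"
    and Idn_hom: "A \<in> Obj \<C> \<Longrightarrow> \<one> A \<in> hom A A"
    and Cmp_hom: "f \<in> hom A B \<Longrightarrow> g \<in> hom B C \<Longrightarrow> g \<cdot> f \<in> hom A C"
    and Idn_left: "f \<in> hom A B \<Longrightarrow> \<one> B \<cdot> f = f"
    and Idn_right: "f \<in> hom A B \<Longrightarrow> f \<cdot> \<one> A = f"
    and Cmp_assoc: "f \<in> hom A B \<Longrightarrow> g \<in> hom B C \<Longrightarrow> h \<in> hom C D \<Longrightarrow> (h \<cdot> g) \<cdot> f = h \<cdot> (g \<cdot> f)"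

definition is_functor ::
    "('o1, 'm1, 'z1) cat_scheme \<Rightarrow> ('o2, 'm2, 'z2) cat_scheme \<Rightarrow> ('o1 \<Rightarrow> 'o2) \<Rightarrow> ('m1 \<Rightarrow> 'm2) \<Rightarrow> bool"
  where "is_functor \<A> \<B> FO FA \<longleftrightarrow>
    (\<forall>X \<in> Obj \<A>. FO X \<in> Obj \<B> \<and> FA (\<one>\<^bsub>\<A>\<^esub> X) = \<one>\<^bsub>\<B>\<^esub> (FO X)) \<and>
    (\<forall>f \<in> Arr \<A>. FA f \<in> hom\<^bsub>\<B>\<^esub> (FO (Dom \<A> f)) (FO (Cod \<A> f))) \<and>
    (\<forall>f \<in> Arr \<A>. \<forall>g \<in> Arr \<A>. Dom \<A> g = Cod \<A> f \<longrightarrow>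
        FA (g \<cdot>\<^bsub>\<A>\<^esub> f) = FA g \<cdot>\<^bsub>\<B>\<^esub> FA f)"

definition has_section ::
    "('o1, 'm1, 'z1) cat_scheme \<Rightarrow> ('o2, 'm2, 'z2) cat_scheme \<Rightarrow> ('o1 \<Rightarrow> 'o2) \<Rightarrow> ('m1 \<Rightarrow> 'm2) \<Rightarrow> bool"
  where "has_section \<A> \<B> FO FA \<longleftrightarrow> (\<exists>SO SA. is_functor \<B> \<A> SO SA \<and>
    (\<forall>Y \<in> Obj \<B>. FO (SO Y) = Y) \<and> (\<forall>g \<in> Arr \<B>. FA (SA g) = g))"

definition is_iso_of_categories ::
    "('o1, 'm1, 'z1) cat_scheme \<Rightarrow> ('o2, 'm2, 'z2) cat_scheme \<Rightarrow> ('o1 \<Rightarrow> 'o2) \<Rightarrow> ('m1 \<Rightarrow> 'm2) \<Rightarrow> bool"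
  where "is_iso_of_categories \<A> \<B> FO FA \<longleftrightarrow> is_functor \<A> \<B> FO FA \<and>
    (\<exists>GO GA. is_functor \<B> \<A> GO GA \<and>
      (\<forall>X \<in> Obj \<A>. GO (FO X) = X) \<and> (\<forall>f \<in> Arr \<A>. GA (FA f) = f) \<and>
      (\<forall>Y \<in> Obj \<B>. FO (GO Y) = Y) \<and> (\<forall>g \<in> Arr \<B>. FA (GA g) = g))"


section \<open>Pullbacks\<close>

definition is_pullback :: "('o, 'm, 'z) cat_scheme \<Rightarrow> 'm \<Rightarrow> 'm \<Rightarrow> 'm \<Rightarrow> 'm \<Rightarrow> bool"
  where "is_pullback \<C> f g p q \<longleftrightarrow>
    f \<in> Arr \<C> \<and> g \<in> Arr \<C> \<and> Cod \<C> f = Cod \<C> g \<and>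
    p \<in> hom (Dom \<C> p) (Dom \<C> f) \<and> q \<in> hom (Dom \<C> p) (Dom \<C> g) \<and> f \<cdot> p = g \<cdot> q \<and>
    (\<forall>Z x y. x \<in> hom Z (Dom \<C> f) \<and> y \<in> hom Z (Dom \<C> g) \<and> f \<cdot> x = g \<cdot> y \<longrightarrow>
      (\<exists>!u. u \<in> hom Z (Dom \<C> p) \<and> p \<cdot> u = x \<and> q \<cdot> u = y))" for \<C> (structure)

definition has_pullback :: "('o, 'm, 'z) cat_scheme \<Rightarrow> 'm \<Rightarrow> 'm \<Rightarrow> bool"
  where "has_pullback \<C> f g \<longleftrightarrow> (\<exists>p q. is_pullback \<C> f g p q)"

definition admits_kernel_pair :: "('o, 'm, 'z) cat_scheme \<Rightarrow> 'm \<Rightarrow> bool"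
  where "admits_kernel_pair \<C> f \<longleftrightarrow> has_pullback \<C> f f"

definition split_epi :: "('o, 'm, 'z) cat_scheme \<Rightarrow> 'm \<Rightarrow> bool"
  where "split_epi \<C> f \<longleftrightarrow> f \<in> Arr \<C> \<and>
    (\<exists>r \<in> hom (Cod \<C> f) (Dom \<C> f). f \<cdot> r = \<one> (Cod \<C> f))" for \<C> (structure)

definition has_split_epi_pullbacks :: "('o, 'm, 'z) cat_scheme \<Rightarrow> bool"
  where "has_split_epi_pullbacks \<C> \<longleftrightarrow>
    (\<forall>f g. split_epi \<C> f \<and> split_epi \<C> g \<and> Cod \<C> f = Cod \<C> g \<longrightarrow> has_pullback \<C> f g)"

text \<open>
  Phrases such as ``the pullback of \<open>f\<close> and \<open>g\<close>'' or ``the kernel pair of \<open>d\<close>'' refer to a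
  fixed but arbitrary choice of limits, carried along as two further fields. Only the values at
  cospans that do have a pullback are constrained, so such a choice exists on every category.
  (Without a choice, the object \<open>C\<^sub>2\<close> would become part of the data of an internal category,
  and a forgetful functor to reflexive graphs could not be injective on objects.)
\<close>

record ('o, 'm) pcat = "('o, 'm) cat" +
  Pr1 :: "'m \<Rightarrow> 'm \<Rightarrow> 'm" ("\<pi>\<^sub>1\<index>")
  Pr2 :: "'m \<Rightarrow> 'm \<Rightarrow> 'm" ("\<pi>\<^sub>2\<index>")

definition pullback_choice :: "('o, 'm, 'z) pcat_scheme \<Rightarrow> bool"
  where "pullback_choice \<C> \<longleftrightarrow>
    (\<forall>f g. has_pullback \<C> f g \<longrightarrow> is_pullback \<C> f g (\<pi>\<^sub>1 f g) (\<pi>\<^sub>2 f g))" for \<C> (structure)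

definition PB :: "('o, 'm, 'z) pcat_scheme \<Rightarrow> 'm \<Rightarrow> 'm \<Rightarrow> 'o" ("PB\<index>")
  where "PB f g = Dom \<C> (\<pi>\<^sub>1 f g)" for \<C> (structure)

text \<open>\<open>pair f g x y\<close> is \<open>\<langle>x, y\<rangle>\<close>, the induced morphism into the chosen pullback of \<open>f\<close> and \<open>g\<close>.\<close>

definition pair :: "('o, 'm, 'z) pcat_scheme \<Rightarrow> 'm \<Rightarrow> 'm \<Rightarrow> 'm \<Rightarrow> 'm \<Rightarrow> 'm" ("pair\<index>")
  where "pair f g x y = (THE u. u \<in> hom (Dom \<C> x) (PB f g) \<and> \<pi>\<^sub>1 f g \<cdot> u = x \<and> \<pi>\<^sub>2 f g \<cdot> u = y)"
    for \<C> (structure)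


section \<open>Spans, the kernel pair construction, and local products\<close>

text \<open>A span \<open>(D, d, c)\<close> is encoded as the pair \<open>(d, c)\<close>, since \<open>D = Dom d = Dom c\<close>.\<close>

definition spans :: "('o, 'm, 'z) cat_scheme \<Rightarrow> ('m \<times> 'm) set"
  where "spans \<C> = {(d, c). d \<in> Arr \<C> \<and> c \<in> Arr \<C> \<and> Dom \<C> d = Dom \<C> c \<and>
    admits_kernel_pair \<C> d \<and> admits_kernel_pair \<C> c}"

text \<open>\<open>kpc d c\<close> is \<open>D(d,c)\<close>, with projections \<open>kp\<^sub>1 d c\<close> and \<open>kp\<^sub>2 d c\<close> to \<open>D(d)\<close> and \<open>D(c)\<close>;
  the kernel pairs are \<open>(\<pi>\<^sub>1 d d, \<pi>\<^sub>2 d d)\<close> and \<open>(\<pi>\<^sub>1 c c, \<pi>\<^sub>2 c c)\<close>.\<close>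

definition kpc :: "('o, 'm, 'z) pcat_scheme \<Rightarrow> 'm \<Rightarrow> 'm \<Rightarrow> 'o" ("kpc\<index>")
  where "kpc d c = PB (\<pi>\<^sub>2 d d) (\<pi>\<^sub>1 c c)" for \<C> (structure)

definition kp1 :: "('o, 'm, 'z) pcat_scheme \<Rightarrow> 'm \<Rightarrow> 'm \<Rightarrow> 'm" ("kp\<^sub>1\<index>")
  where "kp\<^sub>1 d c = \<pi>\<^sub>1 (\<pi>\<^sub>2 d d) (\<pi>\<^sub>1 c c)" for \<C> (structure)

definition kp2 :: "('o, 'm, 'z) pcat_scheme \<Rightarrow> 'm \<Rightarrow> 'm \<Rightarrow> 'm" ("kp\<^sub>2\<index>")
  where "kp\<^sub>2 d c = \<pi>\<^sub>2 (\<pi>\<^sub>2 d d) (\<pi>\<^sub>1 c c)" for \<C> (structure)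

definition kpc_dom :: "('o, 'm, 'z) pcat_scheme \<Rightarrow> 'm \<Rightarrow> 'm \<Rightarrow> 'm" ("kpc'_dom\<index>")
  where "kpc_dom d c = \<pi>\<^sub>1 d d \<cdot> kp\<^sub>1 d c" for \<C> (structure)

definition kpc_cod :: "('o, 'm, 'z) pcat_scheme \<Rightarrow> 'm \<Rightarrow> 'm \<Rightarrow> 'm" ("kpc'_cod\<index>")
  where "kpc_cod d c = \<pi>\<^sub>2 c c \<cdot> kp\<^sub>2 d c" for \<C> (structure)

text \<open>\<open>triple d c x y z\<close> is \<open>\<langle>x, y, z\<rangle> : Z \<rightarrow> D(d,c)\<close>.\<close>

definition triple :: "('o, 'm, 'z) pcat_scheme \<Rightarrow> 'm \<Rightarrow> 'm \<Rightarrow> 'm \<Rightarrow> 'm \<Rightarrow> 'm \<Rightarrow> 'm" ("triple\<index>")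
  where "triple d c x y z = pair (\<pi>\<^sub>2 d d) (\<pi>\<^sub>1 c c) (pair d d x y) (pair c c y z)" for \<C> (structure)

text \<open>\<open>kpc_map d c d' c' f\<close> is \<open>f \<times> f \<times> f : D(d,c) \<rightarrow> D'(d',c')\<close>, obtained by applying \<open>f\<close> to
  the three components of the generic triple.\<close>

definition kpc_map :: "('o, 'm, 'z) pcat_scheme \<Rightarrow> 'm \<Rightarrow> 'm \<Rightarrow> 'm \<Rightarrow> 'm \<Rightarrow> 'm \<Rightarrow> 'm" ("kpc'_map\<index>")
  where "kpc_map d c d' c' f =
    triple d' c' (f \<cdot> kpc_dom d c) (f \<cdot> (\<pi>\<^sub>2 d d \<cdot> kp\<^sub>1 d c)) (f \<cdot> kpc_cod d c)" for \<C> (structure)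

definition closed_under_kpc :: "('o, 'm, 'z) pcat_scheme \<Rightarrow> ('m \<times> 'm) set \<Rightarrow> bool"
  where "closed_under_kpc \<C> \<M> \<longleftrightarrow>
    (\<forall>d c. (d, c) \<in> \<M> \<longrightarrow> (kpc_dom d c, kpc_cod d c) \<in> \<M>)" for \<C> (structure)

text \<open>The pullback in a local product is an arbitrary one, so \<open>e\<^sub>1 = \<langle>1, s f\<rangle>\<close> and
  \<open>e\<^sub>2 = \<langle>r g, 1\<rangle>\<close> are expressed by their components.\<close>

definition local_product :: "('o, 'm, 'z) cat_scheme \<Rightarrow> 'm \<Rightarrow> 'm \<Rightarrow> 'm \<Rightarrow> 'm \<Rightarrow> bool"
  where "local_product \<C> p\<^sub>1 e\<^sub>1 p\<^sub>2 e\<^sub>2 \<longleftrightarrow> (\<exists>A B C E f r g s.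
    f \<in> hom A B \<and> r \<in> hom B A \<and> g \<in> hom C B \<and> s \<in> hom B C \<and> f \<cdot> r = \<one> B \<and> g \<cdot> s = \<one> B \<and>
    p\<^sub>1 \<in> hom E A \<and> p\<^sub>2 \<in> hom E C \<and> is_pullback \<C> f g p\<^sub>1 p\<^sub>2 \<and>
    e\<^sub>1 \<in> hom A E \<and> p\<^sub>1 \<cdot> e\<^sub>1 = \<one> A \<and> p\<^sub>2 \<cdot> e\<^sub>1 = s \<cdot> f \<and>
    e\<^sub>2 \<in> hom C E \<and> p\<^sub>1 \<cdot> e\<^sub>2 = r \<cdot> g \<and> p\<^sub>2 \<cdot> e\<^sub>2 = \<one> C)" for \<C> (structure)

definition contains_local_products :: "('o, 'm, 'z) cat_scheme \<Rightarrow> ('m \<times> 'm) set \<Rightarrow> bool"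
  where "contains_local_products \<C> \<M> \<longleftrightarrow>
    (\<forall>p\<^sub>1 e\<^sub>1 p\<^sub>2 e\<^sub>2. local_product \<C> p\<^sub>1 e\<^sub>1 p\<^sub>2 e\<^sub>2 \<longrightarrow> (p\<^sub>1, p\<^sub>2) \<in> \<M>)"

definition jointly_monic :: "('o, 'm, 'z) cat_scheme \<Rightarrow> 'm \<Rightarrow> 'm \<Rightarrow> bool"
  where "jointly_monic \<C> p q \<longleftrightarrow> (\<forall>Z. \<forall>u \<in> hom Z (Dom \<C> p). \<forall>v \<in> hom Z (Dom \<C> p).
    p \<cdot> u = p \<cdot> v \<and> q \<cdot> u = q \<cdot> v \<longrightarrow> u = v)" for \<C> (structure)


section \<open>Reflexive graphs, internal categories and internal groupoids\<close>

record ('o, 'm) rgraph =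
  C1 :: 'o
  C0 :: 'o
  gd :: 'm
  ge :: 'm
  gc :: 'm

record ('o, 'm) icat = "('o, 'm) rgraph" +
  gm :: 'm

record ('o, 'm) igrpd = "('o, 'm) icat" +
  gi :: 'm

definition reflexive_graph :: "('o, 'm, 'z) cat_scheme \<Rightarrow> ('o, 'm, 'y) rgraph_scheme \<Rightarrow> bool"
  where "reflexive_graph \<C> G \<longleftrightarrow>
    gd G \<in> hom (C1 G) (C0 G) \<and> gc G \<in> hom (C1 G) (C0 G) \<and> ge G \<in> hom (C0 G) (C1 G) \<and>
    gd G \<cdot> ge G = \<one> (C0 G) \<and> gc G \<cdot> ge G = \<one> (C0 G)" for \<C> (structure)

text \<open>\<open>C\<^sub>2\<close> is the chosen pullback of \<open>d\<close> and \<open>c\<close>; associativity is stated for generalized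
  elements \<open>x, y, z : Z \<rightarrow> C\<^sub>1\<close> of the object of composable triples.\<close>

definition internal_category :: "('o, 'm, 'z) pcat_scheme \<Rightarrow> ('o, 'm, 'y) icat_scheme \<Rightarrow> bool"
  where "internal_category \<C> G \<longleftrightarrow> reflexive_graph \<C> G \<and>
    (let d = gd G; e = ge G; c = gc G; m = gm G in
      m \<in> hom (PB d c) (C1 G) \<and>
      d \<cdot> m = d \<cdot> \<pi>\<^sub>2 d c \<and> c \<cdot> m = c \<cdot> \<pi>\<^sub>1 d c \<and>
      m \<cdot> pair d c (\<one> (C1 G)) (e \<cdot> d) = \<one> (C1 G) \<and>
      m \<cdot> pair d c (e \<cdot> c) (\<one> (C1 G)) = \<one> (C1 G) \<and>
      (\<forall>Z. \<forall>x \<in> hom Z (C1 G). \<forall>y \<in> hom Z (C1 G). \<forall>z \<in> hom Z (C1 G).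
        d \<cdot> x = c \<cdot> y \<and> d \<cdot> y = c \<cdot> z \<longrightarrow>
        m \<cdot> pair d c (m \<cdot> pair d c x y) z = m \<cdot> pair d c x (m \<cdot> pair d c y z)))" for \<C> (structure)

definition internal_groupoid :: "('o, 'm, 'z) pcat_scheme \<Rightarrow> ('o, 'm, 'y) igrpd_scheme \<Rightarrow> bool"
  where "internal_groupoid \<C> G \<longleftrightarrow> internal_category \<C> G \<and>
    (let d = gd G; e = ge G; c = gc G; m = gm G; i = gi G in
      i \<in> hom (C1 G) (C1 G) \<and> d \<cdot> i = c \<and> c \<cdot> i = d \<and>
      m \<cdot> pair d c (\<one> (C1 G)) i = e \<cdot> c \<and> m \<cdot> pair d c i (\<one> (C1 G)) = e \<cdot> d)" for \<C> (structure)

definition rgraph_morphism :: "('o, 'm, 'z) cat_scheme \<Rightarrow>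
    ('o, 'm, 'y) rgraph_scheme \<Rightarrow> ('o, 'm, 'y) rgraph_scheme \<Rightarrow> 'm \<Rightarrow> 'm \<Rightarrow> bool"
  where "rgraph_morphism \<C> G H f\<^sub>1 f\<^sub>0 \<longleftrightarrow>
    f\<^sub>1 \<in> hom (C1 G) (C1 H) \<and> f\<^sub>0 \<in> hom (C0 G) (C0 H) \<and>
    gd H \<cdot> f\<^sub>1 = f\<^sub>0 \<cdot> gd G \<and> gc H \<cdot> f\<^sub>1 = f\<^sub>0 \<cdot> gc G \<and> f\<^sub>1 \<cdot> ge G = ge H \<cdot> f\<^sub>0" for \<C> (structure)

definition internal_functor :: "('o, 'm, 'z) pcat_scheme \<Rightarrow>
    ('o, 'm, 'y) icat_scheme \<Rightarrow> ('o, 'm, 'y) icat_scheme \<Rightarrow> 'm \<Rightarrow> 'm \<Rightarrow> bool"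
  where "internal_functor \<C> G H f\<^sub>1 f\<^sub>0 \<longleftrightarrow> rgraph_morphism \<C> G H f\<^sub>1 f\<^sub>0 \<and>
    f\<^sub>1 \<cdot> gm G = gm H \<cdot>
      pair (gd H) (gc H) (f\<^sub>1 \<cdot> \<pi>\<^sub>1 (gd G) (gc G)) (f\<^sub>1 \<cdot> \<pi>\<^sub>2 (gd G) (gc G))" for \<C> (structure)

definition groupoid_morphism :: "('o, 'm, 'z) pcat_scheme \<Rightarrow>
    ('o, 'm, 'y) igrpd_scheme \<Rightarrow> ('o, 'm, 'y) igrpd_scheme \<Rightarrow> 'm \<Rightarrow> 'm \<Rightarrow> bool"
  where "groupoid_morphism \<C> G H f\<^sub>1 f\<^sub>0 \<longleftrightarrow>
    internal_functor \<C> G H f\<^sub>1 f\<^sub>0 \<and> f\<^sub>1 \<cdot> gi G = gi H \<cdot> f\<^sub>1" for \<C> (structure)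

text \<open>Morphisms carry their source and target, so that \<open>Dom\<close> and \<open>Cod\<close> are functions.\<close>

record ('g, 'm) gmor =
  src :: 'g
  tgt :: 'g
  mor1 :: 'm
  mor0 :: 'm

definition graph_cat :: "('o, 'm, 'z) cat_scheme \<Rightarrow> ('o, 'm, 'y) rgraph_scheme set \<Rightarrow>
    (('o, 'm, 'y) rgraph_scheme \<Rightarrow> ('o, 'm, 'y) rgraph_scheme \<Rightarrow> 'm \<Rightarrow> 'm \<Rightarrow> bool) \<Rightarrow>
    (('o, 'm, 'y) rgraph_scheme, (('o, 'm, 'y) rgraph_scheme, 'm) gmor) cat"
  where "graph_cat \<C> Gs P = \<lparr>
    Obj = Gs,
    Arr = {\<phi>. src \<phi> \<in> Gs \<and> tgt \<phi> \<in> Gs \<and> P (src \<phi>) (tgt \<phi>) (mor1 \<phi>) (mor0 \<phi>)},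
    Dom = src,
    Cod = tgt,
    Idn = (\<lambda>G. \<lparr>src = G, tgt = G, mor1 = \<one> (C1 G), mor0 = \<one> (C0 G)\<rparr>),
    Cmp = (\<lambda>\<psi> \<phi>. \<lparr>src = src \<phi>, tgt = tgt \<psi>, mor1 = mor1 \<psi> \<cdot> mor1 \<phi>, mor0 = mor0 \<psi> \<cdot> mor0 \<phi>\<rparr>)\<rparr>"
  for \<C> (structure)

definition RG :: "('o, 'm, 'z) cat_scheme \<Rightarrow> ('m \<times> 'm) set \<Rightarrow>
    (('o, 'm) rgraph, (('o, 'm) rgraph, 'm) gmor) cat"
  where "RG \<C> \<M> = graph_cat \<C> {G. reflexive_graph \<C> G \<and> (gd G, gc G) \<in> \<M>} (rgraph_morphism \<C>)"

definition Cat :: "('o, 'm, 'z) pcat_scheme \<Rightarrow> ('m \<times> 'm) set \<Rightarrow>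
    (('o, 'm) icat, (('o, 'm) icat, 'm) gmor) cat"
  where "Cat \<C> \<M> = graph_cat \<C> {G. internal_category \<C> G \<and> (gd G, gc G) \<in> \<M>} (internal_functor \<C>)"

definition Grpd :: "('o, 'm, 'z) pcat_scheme \<Rightarrow> ('m \<times> 'm) set \<Rightarrow>
    (('o, 'm) igrpd, (('o, 'm) igrpd, 'm) gmor) cat"
  where "Grpd \<C> \<M> = graph_cat \<C> {G. internal_groupoid \<C> G \<and> (gd G, gc G) \<in> \<M>} (groupoid_morphism \<C>)"

text \<open>The forgetful functors to reflexive graphs drop the record fields beyond those of
  \<open>rgraph\<close>; on morphisms they only change the recorded source and target.\<close>

definition forget_obj :: "('o, 'm, 'y) rgraph_scheme \<Rightarrow> ('o, 'm) rgraph"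
  where "forget_obj = rgraph.truncate"

definition forget_mor :: "(('o, 'm, 'y) rgraph_scheme, 'm) gmor \<Rightarrow> (('o, 'm) rgraph, 'm) gmor"
  where "forget_mor \<phi> =
    \<lparr>src = forget_obj (src \<phi>), tgt = forget_obj (tgt \<phi>), mor1 = mor1 \<phi>, mor0 = mor0 \<phi>\<rparr>"

definition Lawvere_condition :: "('o, 'm, 'z) pcat_scheme \<Rightarrow> ('m \<times> 'm) set \<Rightarrow> bool"
  where "Lawvere_condition \<C> \<M> \<longleftrightarrow>
    is_iso_of_categories (Grpd \<C> \<M>) (RG \<C> \<M>) forget_obj forget_mor"


section \<open>The diagrammatic conditions\<close>

definition joint_mono_condition :: "('o, 'm, 'z) cat_scheme \<Rightarrow> ('m \<times> 'm) set \<Rightarrow> bool"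
  where "joint_mono_condition \<C> \<M> \<longleftrightarrow> (\<forall>A C D D\<^sub>0 D\<^sub>1 E p\<^sub>1 e\<^sub>1 p\<^sub>2 e\<^sub>2 \<alpha> \<gamma> d c.
    p\<^sub>1 \<in> hom E A \<and> e\<^sub>1 \<in> hom A E \<and> p\<^sub>2 \<in> hom E C \<and> e\<^sub>2 \<in> hom C E \<and>
    \<alpha> \<in> hom A D \<and> \<gamma> \<in> hom C D \<and> d \<in> hom D D\<^sub>0 \<and> c \<in> hom D D\<^sub>1 \<and>
    jointly_monic \<C> p\<^sub>1 p\<^sub>2 \<and> (d, c) \<in> \<M> \<and> (p\<^sub>1, p\<^sub>2) \<in> \<M> \<and>
    p\<^sub>1 \<cdot> e\<^sub>1 = \<one> A \<and> p\<^sub>2 \<cdot> e\<^sub>2 = \<one> C \<and>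
    (e\<^sub>1 \<cdot> p\<^sub>1) \<cdot> (e\<^sub>2 \<cdot> p\<^sub>2) = (e\<^sub>2 \<cdot> p\<^sub>2) \<cdot> (e\<^sub>1 \<cdot> p\<^sub>1) \<and>
    \<alpha> \<cdot> p\<^sub>1 \<cdot> (e\<^sub>2 \<cdot> p\<^sub>2) = \<gamma> \<cdot> p\<^sub>2 \<cdot> (e\<^sub>1 \<cdot> p\<^sub>1) \<and>
    d \<cdot> \<alpha> \<cdot> p\<^sub>1 = d \<cdot> \<alpha> \<cdot> p\<^sub>1 \<cdot> (e\<^sub>2 \<cdot> p\<^sub>2) \<and>
    c \<cdot> \<gamma> \<cdot> p\<^sub>2 = c \<cdot> \<gamma> \<cdot> p\<^sub>2 \<cdot> (e\<^sub>1 \<cdot> p\<^sub>1) \<longrightarrow>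
    (\<exists>!m. m \<in> hom E D \<and> m \<cdot> e\<^sub>1 = \<alpha> \<and> m \<cdot> e\<^sub>2 = \<gamma> \<and>
      d \<cdot> m = d \<cdot> \<gamma> \<cdot> p\<^sub>2 \<and> c \<cdot> m = c \<cdot> \<alpha> \<cdot> p\<^sub>1))" for \<C> (structure)

definition split_pullback_condition :: "('o, 'm, 'z) pcat_scheme \<Rightarrow> ('m \<times> 'm) set \<Rightarrow> bool"
  where "split_pullback_condition \<C> \<M> \<longleftrightarrow> (\<forall>A B C D D\<^sub>0 D\<^sub>1 f r g s \<alpha> \<beta> \<gamma> d c.
    f \<in> hom A B \<and> r \<in> hom B A \<and> g \<in> hom C B \<and> s \<in> hom B C \<and>
    \<alpha> \<in> hom A D \<and> \<beta> \<in> hom B D \<and> \<gamma> \<in> hom C D \<and> d \<in> hom D D\<^sub>0 \<and> c \<in> hom D D\<^sub>1 \<and>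
    f \<cdot> r = \<one> B \<and> g \<cdot> s = \<one> B \<and> \<alpha> \<cdot> r = \<beta> \<and> \<gamma> \<cdot> s = \<beta> \<and>
    d \<cdot> \<alpha> = d \<cdot> \<beta> \<cdot> f \<and> c \<cdot> \<beta> \<cdot> g = c \<cdot> \<gamma> \<and> (d, c) \<in> \<M> \<longrightarrow>
    (\<exists>!m. m \<in> hom (PB f g) D \<and>
      m \<cdot> pair f g (\<one> A) (s \<cdot> f) = \<alpha> \<and> m \<cdot> pair f g (r \<cdot> g) (\<one> C) = \<gamma> \<and>
      d \<cdot> m = d \<cdot> \<gamma> \<cdot> \<pi>\<^sub>2 f g \<and> c \<cdot> m = c \<cdot> \<alpha> \<cdot> \<pi>\<^sub>1 f g))" for \<C> (structure)

definition is_kpc_operation :: "('o, 'm, 'z) pcat_scheme \<Rightarrow> 'm \<Rightarrow> 'm \<Rightarrow> 'm \<Rightarrow> bool"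
  where "is_kpc_operation \<C> d c p \<longleftrightarrow> p \<in> hom (kpc d c) (Dom \<C> d) \<and>
    (\<forall>Z. \<forall>x \<in> hom Z (Dom \<C> d). \<forall>y \<in> hom Z (Dom \<C> d). \<forall>z \<in> hom Z (Dom \<C> d).
      d \<cdot> x = d \<cdot> y \<and> c \<cdot> y = c \<cdot> z \<longrightarrow>
      d \<cdot> (p \<cdot> triple d c x y z) = d \<cdot> z \<and> c \<cdot> (p \<cdot> triple d c x y z) = c \<cdot> x \<and>
      p \<cdot> triple d c x y y = x \<and> p \<cdot> triple d c y y z = z)" for \<C> (structure)

definition kpc_operations_condition :: "('o, 'm, 'z) pcat_scheme \<Rightarrow> ('m \<times> 'm) set \<Rightarrow> bool"
  where "kpc_operations_condition \<C> \<M> \<longleftrightarrow> (\<exists>p :: 'm \<Rightarrow> 'm \<Rightarrow> 'm.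
    (\<forall>d c. (d, c) \<in> \<M> \<longrightarrow>
      is_kpc_operation \<C> d c (p d c) \<and> (\<forall>q. is_kpc_operation \<C> d c q \<longrightarrow> q = p d c)) \<and>
    (\<forall>d c d' c' f f\<^sub>0 f\<^sub>1. (d, c) \<in> \<M> \<and> (d', c') \<in> \<M> \<and>
      f \<in> hom (Dom \<C> d) (Dom \<C> d') \<and>
      f\<^sub>0 \<in> hom (Cod \<C> d) (Cod \<C> d') \<and> f\<^sub>1 \<in> hom (Cod \<C> c) (Cod \<C> c') \<and>
      d' \<cdot> f = f\<^sub>0 \<cdot> d \<and> c' \<cdot> f = f\<^sub>1 \<cdot> c \<longrightarrow>
      f \<cdot> p d c = p d' c' \<cdot> kpc_map d c d' c' f) \<and>
    (\<forall>d c Z. (d, c) \<in> \<M> \<longrightarrow>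
      (\<forall>u \<in> hom Z (Dom \<C> d). \<forall>v \<in> hom Z (Dom \<C> d).
       \<forall>x \<in> hom Z (Dom \<C> d). \<forall>y \<in> hom Z (Dom \<C> d). \<forall>z \<in> hom Z (Dom \<C> d).
        d \<cdot> u = d \<cdot> v \<and> c \<cdot> v = c \<cdot> x \<and> d \<cdot> x = d \<cdot> y \<and> c \<cdot> y = c \<cdot> z \<longrightarrow>
        p d c \<cdot> triple d c u v (p d c \<cdot> triple d c x y z) =
        p d c \<cdot> triple d c (p d c \<cdot> triple d c u v x) y z)))" for \<C> (structure)

end

theory Submission
  imports Defs
begin

text \<open>
  All conditions say that every span in \<open>\<M>\<close> carries, in a natural way, a partial Mal'tsev operation:
  for \<open>x, y, z\<close> with \<open>d x = d y\<close> and \<open>c y = c z\<close> an element \<open>p(x,y,z)\<close> with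
  \<open>d p(x,y,z) = d z\<close>, \<open>c p(x,y,z) = c x\<close>, \<open>p(x,y,y) = x\<close> and \<open>p(y,y,z) = z\<close>. Existence of such a
  family, natural in the span (\<open>natural_operations\<close>), is the hub of the proof. Associativity and
  uniqueness are not part of it; they follow.

  The operation interpolates. Given compatible \<open>\<alpha>\<close>, \<open>\<beta>\<close>, \<open>\<gamma>\<close> on a pullback \<open>A \<times>\<^sub>B C\<close> of split
  epimorphisms, \<open>m(a,b) = p(\<alpha> a, \<beta> f a, \<gamma> b)\<close> is a morphism with the prescribed restrictions.
  Uniqueness of \<open>m\<close> is where naturality and local products meet: \<open>m\<close> is a morphism of spans from
  \<open>(\<pi>\<^sub>2, \<pi>\<^sub>1)\<close>, which is a local product with its legs exchanged and hence again a local product;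
  the operation of this span writes every element of the pullback in terms of elements on which \<open>m\<close>
  is known, and \<open>m\<close> preserves the operation
  (\<open>split_pullback_condition_if_natural_operations\<close>). Conversely \<open>D(d,c)\<close> is itself a pullback of
  split epimorphisms, so the condition on split pullbacks produces the operation, and its uniqueness
  part proves every identity between morphisms that are pinned down by their restrictions:
  uniqueness, naturality and associativity of \<open>p\<close> (\<open>kpc_morphism_unique\<close>, \<open>kpc_operation_assoc\<close>).

  The condition on jointly monic spans contains the one on split pullbacks, because local products
  are jointly monic. In the other direction \<open>p\<close> again provides the morphism, and its uniqueness uses
  the operation that the jointly monic span possesses as a member of \<open>\<M>\<close>
  (\<open>joint_mono_if_split_pullback\<close>).

  For the conditions on internal structures, a reflexive graph in \<open>\<M>\<close> becomes a groupoid by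
  \<open>x \<circ> y = p(x, e d x, y)\<close> and \<open>x\<^sup>-\<^sup>1 = p(e d x, x, e c x)\<close>, functorially since \<open>p\<close> is natural, and in
  only one way by the uniqueness on split pullbacks (\<open>Lawvere_if_split_pullback\<close>). In return, let all
  graphs in \<open>\<M>\<close> carry functorial category structures. The graph \<open>D(d,c) \<rightrightarrows> D\<close> is in \<open>\<M>\<close>; reading
  \<open>\<langle>x,y,z\<rangle>\<close> as an arrow \<open>x \<rightarrow> z\<close>, the composite of \<open>\<langle>z,z,y\<rangle> : z \<rightarrow> y\<close> with \<open>\<langle>y,x,x\<rangle> : y \<rightarrow> x\<close> has
  the form \<open>\<langle>z,q,x\<rangle>\<close>, and \<open>p(x,y,z) = q\<close> is a natural operation
  (\<open>natural_operations_if_Cat_section\<close>).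
\<close>

section \<open>Composites and chosen pullbacks\<close>

locale pullback_category = category \<C> for \<C> :: "('o, 'm, 'z) pcat_scheme" (structure) +
  assumes split_epi_pullbacks: "has_split_epi_pullbacks \<C>"
    and pullbacks_chosen: "pullback_choice \<C>"
begin

lemma in_hom_iff [simp]: "f \<in> hom A B \<longleftrightarrow> f \<in> Arr \<C> \<and> Dom \<C> f = A \<and> Cod \<C> f = B"
  by (simp add: hom_def)

lemma Obj_simps [simp]:
  assumes "f \<in> Arr \<C>" shows "Dom \<C> f \<in> Obj \<C>" "Cod \<C> f \<in> Obj \<C>"
  using assms by (auto intro: Dom_Obj Cod_Obj)

lemma Idn_simps [simp]:
  assumes "A \<in> Obj \<C>"
  shows "\<one> A \<in> Arr \<C>" "Dom \<C> (\<one> A) = A" "Cod \<C> (\<one> A) = A"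
  using Idn_hom[OF assms] by auto

lemma Cmp_simps [simp]:
  assumes "f \<in> Arr \<C>" "g \<in> Arr \<C>" "Dom \<C> g = Cod \<C> f"
  shows "g \<cdot> f \<in> Arr \<C>" "Dom \<C> (g \<cdot> f) = Dom \<C> f" "Cod \<C> (g \<cdot> f) = Cod \<C> g"
  using Cmp_hom[of f "Dom \<C> f" "Cod \<C> f" g "Cod \<C> g"] assms by auto

lemma Cmp_assoc_simp [simp]:
  assumes "f \<in> Arr \<C>" "g \<in> Arr \<C>" "h \<in> Arr \<C>" "Dom \<C> g = Cod \<C> f" "Dom \<C> h = Cod \<C> g"
  shows "h \<cdot> g \<cdot> f = h \<cdot> (g \<cdot> f)"
  using Cmp_assoc[of f "Dom \<C> f" "Cod \<C> f" g "Cod \<C> g" h "Cod \<C> h"] assms by auto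

lemma Idn_Cmp [simp]:
  "f \<in> Arr \<C> \<Longrightarrow> Cod \<C> f = B \<Longrightarrow> \<one> B \<cdot> f = f"
  "f \<in> Arr \<C> \<Longrightarrow> Dom \<C> f = A \<Longrightarrow> f \<cdot> \<one> A = f"
  using Idn_left[of f "Dom \<C> f" B] Idn_right[of f A "Cod \<C> f"] by auto

text \<open>Composites are kept bracketed to the right, so an equation \<open>g \<cdot> f = k\<close> rewrites the beginning
  of a longer composite only in this form.\<close>
lemma Cmp_eq_extend:
  assumes "g \<cdot> f = k" "f \<in> Arr \<C>" "g \<in> Arr \<C>" "Dom \<C> g = Cod \<C> f" "x \<in> Arr \<C>" "Cod \<C> x = Dom \<C> f"
  shows "g \<cdot> (f \<cdot> x) = k \<cdot> x"
  using assms by auto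

lemma is_pullback_chosen:
  "has_pullback \<C> f g \<Longrightarrow> is_pullback \<C> f g (\<pi>\<^sub>1 f g) (\<pi>\<^sub>2 f g)"
  using pullbacks_chosen by (simp add: pullback_choice_def)

lemma projections [simp]:
  assumes "has_pullback \<C> f g"
  shows "\<pi>\<^sub>1 f g \<in> Arr \<C>" "\<pi>\<^sub>2 f g \<in> Arr \<C>"
    "Dom \<C> (\<pi>\<^sub>1 f g) = PB f g" "Dom \<C> (\<pi>\<^sub>2 f g) = PB f g"
    "Cod \<C> (\<pi>\<^sub>1 f g) = Dom \<C> f" "Cod \<C> (\<pi>\<^sub>2 f g) = Dom \<C> g"
  using is_pullback_chosen[OF assms] by (auto simp: is_pullback_def PB_def)

lemma has_pullback_arr:
  assumes "has_pullback \<C> f g"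
  shows "f \<in> Arr \<C>" "g \<in> Arr \<C>" "Cod \<C> f = Cod \<C> g"
  using is_pullback_chosen[OF assms] by (auto simp: is_pullback_def)

lemma PB_Obj [simp]: "has_pullback \<C> f g \<Longrightarrow> PB f g \<in> Obj \<C>"
  by (metis projections(1,3) Obj_simps(1))

lemma pullback_square:
  "has_pullback \<C> f g \<Longrightarrow> f \<cdot> \<pi>\<^sub>1 f g = g \<cdot> \<pi>\<^sub>2 f g"
  using is_pullback_chosen by (auto simp: is_pullback_def)

lemma pair_props:
  assumes pb: "has_pullback \<C> f g"
    and x: "x \<in> Arr \<C>" "Cod \<C> x = Dom \<C> f" and y: "y \<in> Arr \<C>" "Cod \<C> y = Dom \<C> g"
    and xy: "Dom \<C> y = Dom \<C> x" "f \<cdot> x = g \<cdot> y"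
  shows pair_arr: "pair f g x y \<in> Arr \<C>" and Dom_pair: "Dom \<C> (pair f g x y) = Dom \<C> x"
    and Cod_pair: "Cod \<C> (pair f g x y) = PB f g"
    and proj1_pair: "\<pi>\<^sub>1 f g \<cdot> pair f g x y = x" and proj2_pair: "\<pi>\<^sub>2 f g \<cdot> pair f g x y = y"
proof -
  have "\<exists>!u. u \<in> hom (Dom \<C> x) (PB f g) \<and> \<pi>\<^sub>1 f g \<cdot> u = x \<and> \<pi>\<^sub>2 f g \<cdot> u = y"
    using is_pullback_chosen[OF pb] x y xy unfolding is_pullback_def PB_def by simp
  from theI'[OF this] have
    "pair f g x y \<in> hom (Dom \<C> x) (PB f g) \<and> \<pi>\<^sub>1 f g \<cdot> pair f g x y = x \<and> \<pi>\<^sub>2 f g \<cdot> pair f g x y = y"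
    unfolding pair_def .
  then show "pair f g x y \<in> Arr \<C>" "Dom \<C> (pair f g x y) = Dom \<C> x"
    "Cod \<C> (pair f g x y) = PB f g" "\<pi>\<^sub>1 f g \<cdot> pair f g x y = x" "\<pi>\<^sub>2 f g \<cdot> pair f g x y = y"
    by auto
qed

lemma PB_ext:
  assumes pb: "has_pullback \<C> f g" and u: "u \<in> hom Z (PB f g)" and v: "v \<in> hom Z (PB f g)"
    and eq: "\<pi>\<^sub>1 f g \<cdot> u = \<pi>\<^sub>1 f g \<cdot> v" "\<pi>\<^sub>2 f g \<cdot> u = \<pi>\<^sub>2 f g \<cdot> v"
  shows "u = v"
proof -
  have fg: "f \<in> Arr \<C>" "g \<in> Arr \<C>" using has_pullback_arr[OF pb] by auto
  have "f \<cdot> (\<pi>\<^sub>1 f g \<cdot> v) = g \<cdot> (\<pi>\<^sub>2 f g \<cdot> v)"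
    using Cmp_eq_extend[OF pullback_square[OF pb]] fg v pb by simp
  moreover have "\<pi>\<^sub>1 f g \<cdot> v \<in> hom Z (Dom \<C> f)" "\<pi>\<^sub>2 f g \<cdot> v \<in> hom Z (Dom \<C> g)"
    using pb v by auto
  ultimately have "\<exists>!u. u \<in> hom Z (PB f g) \<and> \<pi>\<^sub>1 f g \<cdot> u = \<pi>\<^sub>1 f g \<cdot> v \<and> \<pi>\<^sub>2 f g \<cdot> u = \<pi>\<^sub>2 f g \<cdot> v"
    using is_pullback_chosen[OF pb] unfolding is_pullback_def PB_def by blast
  then show ?thesis
    using u v eq by blast
qed

lemma pair_Cmp:
  assumes pb: "has_pullback \<C> f g"
    and x: "x \<in> Arr \<C>" "Cod \<C> x = Dom \<C> f" and y: "y \<in> Arr \<C>" "Cod \<C> y = Dom \<C> g"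
    and xy: "Dom \<C> y = Dom \<C> x" "f \<cdot> x = g \<cdot> y"
    and h: "h \<in> Arr \<C>" "Cod \<C> h = Dom \<C> x"
  shows "pair f g x y \<cdot> h = pair f g (x \<cdot> h) (y \<cdot> h)"
proof -
  note P = pair_props[OF pb x y xy]
  have fg: "f \<in> Arr \<C>" "g \<in> Arr \<C>" "Cod \<C> f = Cod \<C> g" using has_pullback_arr[OF pb] .
  have "f \<cdot> (x \<cdot> h) = g \<cdot> (y \<cdot> h)"
    using Cmp_eq_extend[OF xy(2)] x y xy(1) h fg by simp
  then have Q: "pair f g (x \<cdot> h) (y \<cdot> h) \<in> Arr \<C>" "Dom \<C> (pair f g (x \<cdot> h) (y \<cdot> h)) = Dom \<C> h"
    "Cod \<C> (pair f g (x \<cdot> h) (y \<cdot> h)) = PB f g"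
    "\<pi>\<^sub>1 f g \<cdot> pair f g (x \<cdot> h) (y \<cdot> h) = x \<cdot> h" "\<pi>\<^sub>2 f g \<cdot> pair f g (x \<cdot> h) (y \<cdot> h) = y \<cdot> h"
    using pair_props[OF pb, of "x \<cdot> h" "y \<cdot> h"] x y xy h by auto
  show ?thesis
    by (rule PB_ext[OF pb, of _ "Dom \<C> h"])
      (use P Q h x y xy pb Cmp_eq_extend[OF P(4)] Cmp_eq_extend[OF P(5)] in auto)
qed

lemma has_pullback_split:
  assumes "f \<in> hom A B" "r \<in> hom B A" "f \<cdot> r = \<one> B" "g \<in> hom C B" "s \<in> hom B C" "g \<cdot> s = \<one> B"
  shows "has_pullback \<C> f g"
proof -
  have "split_epi \<C> f" "split_epi \<C> g"
    using assms unfolding split_epi_def by auto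
  then show ?thesis
    using split_epi_pullbacks assms unfolding has_split_epi_pullbacks_def by auto
qed

section \<open>Triples as elements of the object of the kernel pair construction\<close>

lemma spansD:
  assumes "(d, c) \<in> spans \<C>"
  shows "d \<in> Arr \<C>" "c \<in> Arr \<C>" "Dom \<C> c = Dom \<C> d" "has_pullback \<C> d d" "has_pullback \<C> c c"
  using assms by (auto simp: spans_def admits_kernel_pair_def)

text \<open>The component \<open>\<langle>x,y,z\<rangle> \<mapsto> y\<close>, which completes \<open>kpc_dom\<close> and \<open>kpc_cod\<close> to the generic triple.\<close>
definition kpc_mid :: "'m \<Rightarrow> 'm \<Rightarrow> 'm"
  where "kpc_mid d c = \<pi>\<^sub>2 d d \<cdot> kp\<^sub>1 d c"

text \<open>Kernel pair projections are split by the diagonal, so \<open>D(d,c)\<close> exists whenever the two kernel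
  pairs do.\<close>
lemma diagonal_split:
  assumes pb: "has_pullback \<C> d d"
  shows "pair d d (\<one> (Dom \<C> d)) (\<one> (Dom \<C> d)) \<in> hom (Dom \<C> d) (PB d d)"
    "\<pi>\<^sub>1 d d \<cdot> pair d d (\<one> (Dom \<C> d)) (\<one> (Dom \<C> d)) = \<one> (Dom \<C> d)"
    "\<pi>\<^sub>2 d d \<cdot> pair d d (\<one> (Dom \<C> d)) (\<one> (Dom \<C> d)) = \<one> (Dom \<C> d)"
  using pair_props[OF pb, of "\<one> (Dom \<C> d)" "\<one> (Dom \<C> d)"] has_pullback_arr[OF pb] by auto

lemma has_pullback_kpc:
  assumes "(d, c) \<in> spans \<C>"
  shows "has_pullback \<C> (\<pi>\<^sub>2 d d) (\<pi>\<^sub>1 c c)"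
proof -
  note S = spansD[OF assms]
  show ?thesis
    by (rule has_pullback_split[of _ "PB d d" "Dom \<C> d" "pair d d (\<one> (Dom \<C> d)) (\<one> (Dom \<C> d))" _
          "PB c c" "pair c c (\<one> (Dom \<C> c)) (\<one> (Dom \<C> c))"])
      (use S diagonal_split[OF S(4)] diagonal_split[OF S(5)] in auto)
qed

lemma kpc_mid_alt: "(d, c) \<in> spans \<C> \<Longrightarrow> kpc_mid d c = \<pi>\<^sub>1 c c \<cdot> kp\<^sub>2 d c"
  using pullback_square[OF has_pullback_kpc] by (simp add: kpc_mid_def kp1_def kp2_def)

lemma kpc_components:
  assumes "(d, c) \<in> spans \<C>"
  shows "kpc_dom d c \<in> hom (kpc d c) (Dom \<C> d)" "kpc_mid d c \<in> hom (kpc d c) (Dom \<C> d)"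
    "kpc_cod d c \<in> hom (kpc d c) (Dom \<C> d)"
    "d \<cdot> kpc_dom d c = d \<cdot> kpc_mid d c" "c \<cdot> kpc_mid d c = c \<cdot> kpc_cod d c"
proof -
  note S = spansD[OF assms] and pb = has_pullback_kpc[OF assms] and mid = kpc_mid_alt[OF assms]
  show "kpc_dom d c \<in> hom (kpc d c) (Dom \<C> d)" "kpc_mid d c \<in> hom (kpc d c) (Dom \<C> d)"
    "kpc_cod d c \<in> hom (kpc d c) (Dom \<C> d)"
    using S pb by (simp_all add: kpc_dom_def kpc_mid_def kpc_cod_def kpc_def kp1_def kp2_def)
  show "d \<cdot> kpc_dom d c = d \<cdot> kpc_mid d c"
    using S pb Cmp_eq_extend[OF pullback_square[OF S(4)]]
    by (simp add: kpc_dom_def kpc_mid_def kp1_def)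
  show "c \<cdot> kpc_mid d c = c \<cdot> kpc_cod d c"
    unfolding mid using S pb Cmp_eq_extend[OF pullback_square[OF S(5)]]
    by (simp add: kpc_cod_def kp2_def)
qed

lemma kpc_Obj: "(d, c) \<in> spans \<C> \<Longrightarrow> kpc d c \<in> Obj \<C>"
  unfolding kpc_def by (rule PB_Obj[OF has_pullback_kpc])

lemma triple_props:
  assumes sp: "(d, c) \<in> spans \<C>"
    and x: "x \<in> hom Z (Dom \<C> d)" and y: "y \<in> hom Z (Dom \<C> d)" and z: "z \<in> hom Z (Dom \<C> d)"
    and eq: "d \<cdot> x = d \<cdot> y" "c \<cdot> y = c \<cdot> z"
  shows "triple d c x y z \<in> Arr \<C>" "Dom \<C> (triple d c x y z) = Z" "Cod \<C> (triple d c x y z) = kpc d c"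
    and "kpc_dom d c \<cdot> triple d c x y z = x" and "kpc_mid d c \<cdot> triple d c x y z = y"
    and "kpc_cod d c \<cdot> triple d c x y z = z"
proof -
  note S = spansD[OF sp] and pb = has_pullback_kpc[OF sp]
  have P: "pair d d x y \<in> Arr \<C>" "Dom \<C> (pair d d x y) = Z" "Cod \<C> (pair d d x y) = PB d d"
    "\<pi>\<^sub>1 d d \<cdot> pair d d x y = x" "\<pi>\<^sub>2 d d \<cdot> pair d d x y = y"
    using pair_props[OF S(4), of x y] x y eq by auto
  have Q: "pair c c y z \<in> Arr \<C>" "Dom \<C> (pair c c y z) = Z" "Cod \<C> (pair c c y z) = PB c c"
    "\<pi>\<^sub>1 c c \<cdot> pair c c y z = y" "\<pi>\<^sub>2 c c \<cdot> pair c c y z = z"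
    using pair_props[OF S(5), of y z] z y eq S by auto
  have R: "triple d c x y z \<in> Arr \<C>" "Dom \<C> (triple d c x y z) = Z"
    "Cod \<C> (triple d c x y z) = PB (\<pi>\<^sub>2 d d) (\<pi>\<^sub>1 c c)"
    "kp\<^sub>1 d c \<cdot> triple d c x y z = pair d d x y" "kp\<^sub>2 d c \<cdot> triple d c x y z = pair c c y z"
    using pair_props[OF pb, of "pair d d x y" "pair c c y z"] P Q S
    unfolding triple_def kp1_def kp2_def by auto
  have K: "kp\<^sub>1 d c \<in> Arr \<C>" "Dom \<C> (kp\<^sub>1 d c) = PB (\<pi>\<^sub>2 d d) (\<pi>\<^sub>1 c c)" "Cod \<C> (kp\<^sub>1 d c) = PB d d"
    "kp\<^sub>2 d c \<in> Arr \<C>" "Dom \<C> (kp\<^sub>2 d c) = PB (\<pi>\<^sub>2 d d) (\<pi>\<^sub>1 c c)" "Cod \<C> (kp\<^sub>2 d c) = PB c c"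
    using pb S by (auto simp: kp1_def kp2_def)
  show "triple d c x y z \<in> Arr \<C>" "Dom \<C> (triple d c x y z) = Z" "Cod \<C> (triple d c x y z) = kpc d c"
    "kpc_dom d c \<cdot> triple d c x y z = x" "kpc_mid d c \<cdot> triple d c x y z = y"
    "kpc_cod d c \<cdot> triple d c x y z = z"
    using P Q R K S by (simp_all add: kpc_def kpc_dom_def kpc_mid_def kpc_cod_def)
qed

text \<open>Triples are determined by their components: the two pairs that make up a triple share the
  middle one. This gives \<open>D(d,c)\<close> its universal property in terms of elements.\<close>
lemma kpc_ext:
  assumes sp: "(d, c) \<in> spans \<C>" and u: "u \<in> hom Z (kpc d c)" and v: "v \<in> hom Z (kpc d c)"
    and eq: "kpc_dom d c \<cdot> u = kpc_dom d c \<cdot> v" "kpc_mid d c \<cdot> u = kpc_mid d c \<cdot> v"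
      "kpc_cod d c \<cdot> u = kpc_cod d c \<cdot> v"
  shows "u = v"
proof -
  note S = spansD[OF sp] and pb = has_pullback_kpc[OF sp]
  have K: "kp\<^sub>1 d c \<in> Arr \<C>" "Dom \<C> (kp\<^sub>1 d c) = PB (\<pi>\<^sub>2 d d) (\<pi>\<^sub>1 c c)" "Cod \<C> (kp\<^sub>1 d c) = PB d d"
    "kp\<^sub>2 d c \<in> Arr \<C>" "Dom \<C> (kp\<^sub>2 d c) = PB (\<pi>\<^sub>2 d d) (\<pi>\<^sub>1 c c)" "Cod \<C> (kp\<^sub>2 d c) = PB c c"
    using pb S by (auto simp: kp1_def kp2_def)
  have "kp\<^sub>1 d c \<cdot> u = kp\<^sub>1 d c \<cdot> v"
    by (rule PB_ext[OF S(4), of _ Z])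
      (use K S u v eq(1,2) in \<open>simp_all add: kpc_def kpc_dom_def kpc_mid_def\<close>)
  moreover have "kp\<^sub>2 d c \<cdot> u = kp\<^sub>2 d c \<cdot> v"
    by (rule PB_ext[OF S(5), of _ Z])
      (use K S u v eq(2,3) in \<open>simp_all add: kpc_def kpc_cod_def kpc_mid_alt[OF sp]\<close>)
  ultimately show ?thesis
    using PB_ext[OF pb, of u Z v] u v by (simp add: kpc_def kp1_def kp2_def)
qed

lemma triple_Cmp:
  assumes sp: "(d, c) \<in> spans \<C>"
    and x: "x \<in> hom Z (Dom \<C> d)" and y: "y \<in> hom Z (Dom \<C> d)" and z: "z \<in> hom Z (Dom \<C> d)"
    and eq: "d \<cdot> x = d \<cdot> y" "c \<cdot> y = c \<cdot> z" and h: "h \<in> hom W Z"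
  shows "triple d c x y z \<cdot> h = triple d c (x \<cdot> h) (y \<cdot> h) (z \<cdot> h)"
proof -
  note S = spansD[OF sp] and T = triple_props[OF sp x y z eq] and K = kpc_components[OF sp]
  have "d \<cdot> (x \<cdot> h) = d \<cdot> (y \<cdot> h)" "c \<cdot> (y \<cdot> h) = c \<cdot> (z \<cdot> h)"
    using Cmp_eq_extend[OF eq(1)] Cmp_eq_extend[OF eq(2)] x y z h S by auto
  note U = triple_props[OF sp _ _ _ this, of W]
  show ?thesis
    by (rule kpc_ext[OF sp, of _ W])
      (use T U K x y z h Cmp_eq_extend[OF T(4)] Cmp_eq_extend[OF T(5)] Cmp_eq_extend[OF T(6)] in auto)
qed

lemma triple_components:
  assumes sp: "(d, c) \<in> spans \<C>" and u: "u \<in> hom Z (kpc d c)"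
  shows "triple d c (kpc_dom d c \<cdot> u) (kpc_mid d c \<cdot> u) (kpc_cod d c \<cdot> u) = u"
proof -
  note S = spansD[OF sp] and K = kpc_components[OF sp]
  have "d \<cdot> (kpc_dom d c \<cdot> u) = d \<cdot> (kpc_mid d c \<cdot> u)" "c \<cdot> (kpc_mid d c \<cdot> u) = c \<cdot> (kpc_cod d c \<cdot> u)"
    using Cmp_eq_extend[OF K(4)] Cmp_eq_extend[OF K(5)] K u S by auto
  note U = triple_props[OF sp _ _ _ this, of Z]
  show ?thesis
    by (rule kpc_ext[OF sp, of _ Z]) (use U K u in auto)
qed

section \<open>Split pullbacks and morphisms of spans\<close>

lemma is_pullback_sym:
  assumes "is_pullback \<C> f g p q" shows "is_pullback \<C> g f q p"
proof -
  have Dq: "Dom \<C> q = Dom \<C> p" using assms by (simp add: is_pullback_def)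
  have "\<exists>!u. u \<in> hom Z (Dom \<C> q) \<and> q \<cdot> u = x \<and> p \<cdot> u = y"
    if "x \<in> hom Z (Dom \<C> g) \<and> y \<in> hom Z (Dom \<C> f) \<and> g \<cdot> x = f \<cdot> y" for Z x y
  proof -
    have "y \<in> hom Z (Dom \<C> f) \<and> x \<in> hom Z (Dom \<C> g) \<and> f \<cdot> y = g \<cdot> x" using that by simp
    then have "\<exists>!u. u \<in> hom Z (Dom \<C> p) \<and> p \<cdot> u = y \<and> q \<cdot> u = x"
      using assms unfolding is_pullback_def by blast
    then show ?thesis unfolding Dq by (metis (no_types, lifting))
  qed
  then show ?thesis using assms Dq unfolding is_pullback_def by simp
qed

lemma split_sections:
  assumes f: "f \<in> hom A B" and r: "r \<in> hom B A" and fr: "f \<cdot> r = \<one> B"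
    and g: "g \<in> hom C B" and s: "s \<in> hom B C" and gs: "g \<cdot> s = \<one> B"
  shows "pair f g (\<one> A) (s \<cdot> f) \<in> hom A (PB f g)" "pair f g (r \<cdot> g) (\<one> C) \<in> hom C (PB f g)"
    "\<pi>\<^sub>1 f g \<cdot> pair f g (\<one> A) (s \<cdot> f) = \<one> A" "\<pi>\<^sub>2 f g \<cdot> pair f g (\<one> A) (s \<cdot> f) = s \<cdot> f"
    "\<pi>\<^sub>1 f g \<cdot> pair f g (r \<cdot> g) (\<one> C) = r \<cdot> g" "\<pi>\<^sub>2 f g \<cdot> pair f g (r \<cdot> g) (\<one> C) = \<one> C"
proof -
  note pb = has_pullback_split[OF f r fr g s gs]
  have obj: "A \<in> Obj \<C>" "B \<in> Obj \<C>" "C \<in> Obj \<C>" using f g by auto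
  have "f \<cdot> \<one> A = g \<cdot> (s \<cdot> f)" "f \<cdot> (r \<cdot> g) = g \<cdot> \<one> C"
    using Cmp_eq_extend[OF gs, of f] Cmp_eq_extend[OF fr, of g] f g r s by auto
  with pair_props[OF pb, of "\<one> A" "s \<cdot> f"] pair_props[OF pb, of "r \<cdot> g" "\<one> C"]
  show "pair f g (\<one> A) (s \<cdot> f) \<in> hom A (PB f g)" "pair f g (r \<cdot> g) (\<one> C) \<in> hom C (PB f g)"
    "\<pi>\<^sub>1 f g \<cdot> pair f g (\<one> A) (s \<cdot> f) = \<one> A" "\<pi>\<^sub>2 f g \<cdot> pair f g (\<one> A) (s \<cdot> f) = s \<cdot> f"
    "\<pi>\<^sub>1 f g \<cdot> pair f g (r \<cdot> g) (\<one> C) = r \<cdot> g" "\<pi>\<^sub>2 f g \<cdot> pair f g (r \<cdot> g) (\<one> C) = \<one> C"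
    using f g r s obj by auto
qed

text \<open>The notion of local product is symmetric in its two factors. Hence both \<open>(\<pi>\<^sub>1, \<pi>\<^sub>2)\<close> and
  \<open>(\<pi>\<^sub>2, \<pi>\<^sub>1)\<close> lie in a class that contains the local products, although the class need not be
  closed under exchanging the legs of a span.\<close>
lemma local_product_split:
  assumes f: "f \<in> hom A B" and r: "r \<in> hom B A" and fr: "f \<cdot> r = \<one> B"
    and g: "g \<in> hom C B" and s: "s \<in> hom B C" and gs: "g \<cdot> s = \<one> B"
  shows "local_product \<C> (\<pi>\<^sub>1 f g) (pair f g (\<one> A) (s \<cdot> f)) (\<pi>\<^sub>2 f g) (pair f g (r \<cdot> g) (\<one> C))"
    "local_product \<C> (\<pi>\<^sub>2 f g) (pair f g (r \<cdot> g) (\<one> C)) (\<pi>\<^sub>1 f g) (pair f g (\<one> A) (s \<cdot> f))"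
proof -
  note pb = has_pullback_split[OF f r fr g s gs]
  note S = split_sections[OF f r fr g s gs]
  note P = is_pullback_chosen[OF pb]
  show "local_product \<C> (\<pi>\<^sub>1 f g) (pair f g (\<one> A) (s \<cdot> f)) (\<pi>\<^sub>2 f g) (pair f g (r \<cdot> g) (\<one> C))"
    unfolding local_product_def
    by (rule exI[of _ A], rule exI[of _ B], rule exI[of _ C], rule exI[of _ "PB f g"],
        rule exI[of _ f], rule exI[of _ r], rule exI[of _ g], rule exI[of _ s])
      (use f r fr g s gs pb S P in simp)
  show "local_product \<C> (\<pi>\<^sub>2 f g) (pair f g (r \<cdot> g) (\<one> C)) (\<pi>\<^sub>1 f g) (pair f g (\<one> A) (s \<cdot> f))"
    unfolding local_product_def
    by (rule exI[of _ C], rule exI[of _ B], rule exI[of _ A], rule exI[of _ "PB f g"],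
        rule exI[of _ g], rule exI[of _ s], rule exI[of _ f], rule exI[of _ r])
      (use f r fr g s gs pb S is_pullback_sym[OF P] in simp)
qed

text \<open>The equations \<open>d' f = f\<^sub>0 d\<close> and \<open>c' f = f\<^sub>1 c\<close> make \<open>f\<close> respect the kernel pairs of both legs, which
  is why it acts on triples componentwise.\<close>
lemma kpc_map_props:
  assumes sp: "(d, c) \<in> spans \<C>" and sp': "(d', c') \<in> spans \<C>"
    and f: "f \<in> hom (Dom \<C> d) (Dom \<C> d')"
    and f0: "f\<^sub>0 \<in> hom (Cod \<C> d) (Cod \<C> d')" and f1: "f\<^sub>1 \<in> hom (Cod \<C> c) (Cod \<C> c')"
    and eq: "d' \<cdot> f = f\<^sub>0 \<cdot> d" "c' \<cdot> f = f\<^sub>1 \<cdot> c"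
  shows kpc_map_hom: "kpc_map d c d' c' f \<in> hom (kpc d c) (kpc d' c')"
    and kpc_map_components: "kpc_dom d' c' \<cdot> kpc_map d c d' c' f = f \<cdot> kpc_dom d c"
      "kpc_mid d' c' \<cdot> kpc_map d c d' c' f = f \<cdot> kpc_mid d c"
      "kpc_cod d' c' \<cdot> kpc_map d c d' c' f = f \<cdot> kpc_cod d c"
    and kpc_map_triple: "\<And>Z x y z. x \<in> hom Z (Dom \<C> d) \<Longrightarrow> y \<in> hom Z (Dom \<C> d) \<Longrightarrow>
      z \<in> hom Z (Dom \<C> d) \<Longrightarrow> d \<cdot> x = d \<cdot> y \<Longrightarrow> c \<cdot> y = c \<cdot> z \<Longrightarrow>
      kpc_map d c d' c' f \<cdot> triple d c x y z = triple d' c' (f \<cdot> x) (f \<cdot> y) (f \<cdot> z)"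
    and span_morphism_eqs: "\<And>Z x y. x \<in> hom Z (Dom \<C> d) \<Longrightarrow> y \<in> hom Z (Dom \<C> d) \<Longrightarrow>
      d \<cdot> x = d \<cdot> y \<Longrightarrow> d' \<cdot> (f \<cdot> x) = d' \<cdot> (f \<cdot> y)"
      "\<And>Z x y. x \<in> hom Z (Dom \<C> d) \<Longrightarrow> y \<in> hom Z (Dom \<C> d) \<Longrightarrow>
      c \<cdot> x = c \<cdot> y \<Longrightarrow> c' \<cdot> (f \<cdot> x) = c' \<cdot> (f \<cdot> y)"
proof -
  note S = spansD[OF sp] and S' = spansD[OF sp'] and K = kpc_components[OF sp]
  show E1: "d' \<cdot> (f \<cdot> x) = d' \<cdot> (f \<cdot> y)"
    if "x \<in> hom Z (Dom \<C> d)" "y \<in> hom Z (Dom \<C> d)" "d \<cdot> x = d \<cdot> y" for Z x y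
    using that Cmp_eq_extend[OF eq(1)] f f0 S S' by auto
  show E2: "c' \<cdot> (f \<cdot> x) = c' \<cdot> (f \<cdot> y)"
    if "x \<in> hom Z (Dom \<C> d)" "y \<in> hom Z (Dom \<C> d)" "c \<cdot> x = c \<cdot> y" for Z x y
    using that Cmp_eq_extend[OF eq(2)] f f1 S S' by auto
  have k: "f \<cdot> kpc_dom d c \<in> hom (kpc d c) (Dom \<C> d')" "f \<cdot> kpc_mid d c \<in> hom (kpc d c) (Dom \<C> d')"
    "f \<cdot> kpc_cod d c \<in> hom (kpc d c) (Dom \<C> d')"
    "d' \<cdot> (f \<cdot> kpc_dom d c) = d' \<cdot> (f \<cdot> kpc_mid d c)"
    "c' \<cdot> (f \<cdot> kpc_mid d c) = c' \<cdot> (f \<cdot> kpc_cod d c)"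
    using E1[OF K(1) K(2) K(4)] E2[OF K(2) K(3) K(5)] K f by auto
  have def: "kpc_map d c d' c' f =
      triple d' c' (f \<cdot> kpc_dom d c) (f \<cdot> kpc_mid d c) (f \<cdot> kpc_cod d c)"
    by (simp add: kpc_map_def kpc_mid_def)
  show "kpc_map d c d' c' f \<in> hom (kpc d c) (kpc d' c')"
    "kpc_dom d' c' \<cdot> kpc_map d c d' c' f = f \<cdot> kpc_dom d c"
    "kpc_mid d' c' \<cdot> kpc_map d c d' c' f = f \<cdot> kpc_mid d c"
    "kpc_cod d' c' \<cdot> kpc_map d c d' c' f = f \<cdot> kpc_cod d c"
    unfolding def using triple_props[OF sp' k] by simp_all
  show "kpc_map d c d' c' f \<cdot> triple d c x y z = triple d' c' (f \<cdot> x) (f \<cdot> y) (f \<cdot> z)"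
    if "x \<in> hom Z (Dom \<C> d)" "y \<in> hom Z (Dom \<C> d)" "z \<in> hom Z (Dom \<C> d)"
      "d \<cdot> x = d \<cdot> y" "c \<cdot> y = c \<cdot> z" for Z x y z
  proof -
    note T = triple_props[OF sp that]
    show ?thesis
      unfolding def using triple_Cmp[OF sp' k, of "triple d c x y z" Z] T K f by simp
  qed
qed

lemma kpc_operationD:
  assumes op: "is_kpc_operation \<C> d c p"
  shows "p \<in> Arr \<C>" "Dom \<C> p = kpc d c" "Cod \<C> p = Dom \<C> d"
  using op by (auto simp: is_kpc_operation_def)

lemma kpc_operation_laws:
  assumes op: "is_kpc_operation \<C> d c p" and sp: "(d, c) \<in> spans \<C>"
    and x: "x \<in> hom Z (Dom \<C> d)" and y: "y \<in> hom Z (Dom \<C> d)" and z: "z \<in> hom Z (Dom \<C> d)"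
    and eq: "d \<cdot> x = d \<cdot> y" "c \<cdot> y = c \<cdot> z"
  shows "p \<cdot> triple d c x y z \<in> hom Z (Dom \<C> d)"
    "d \<cdot> (p \<cdot> triple d c x y z) = d \<cdot> z" "c \<cdot> (p \<cdot> triple d c x y z) = c \<cdot> x"
proof -
  show "p \<cdot> triple d c x y z \<in> hom Z (Dom \<C> d)"
    using triple_props[OF sp x y z eq] kpc_operationD[OF op] by simp
  show "d \<cdot> (p \<cdot> triple d c x y z) = d \<cdot> z" "c \<cdot> (p \<cdot> triple d c x y z) = c \<cdot> x"
    using op x y z eq unfolding is_kpc_operation_def by blast+
qed

lemma kpc_operation_units:
  assumes op: "is_kpc_operation \<C> d c p"
    and x: "x \<in> hom Z (Dom \<C> d)" and y: "y \<in> hom Z (Dom \<C> d)"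
  shows "d \<cdot> x = d \<cdot> y \<Longrightarrow> p \<cdot> triple d c x y y = x" "c \<cdot> x = c \<cdot> y \<Longrightarrow> p \<cdot> triple d c x x y = y"
  using op x y unfolding is_kpc_operation_def by blast+

end

section \<open>Natural operations solve the extension problem on split pullbacks\<close>

locale span_class = pullback_category \<C> for \<C> :: "('o, 'm, 'z) pcat_scheme" (structure) +
  fixes \<M> :: "('m \<times> 'm) set"
  assumes spans: "\<M> \<subseteq> spans \<C>"
    and kpc_closed: "closed_under_kpc \<C> \<M>"
    and local_products: "contains_local_products \<C> \<M>"
begin

lemma M_span: "(d, c) \<in> \<M> \<Longrightarrow> (d, c) \<in> spans \<C>"
  using spans by blast

text \<open>The existence part of \<open>kpc_operations_condition\<close>, which implies the rest of it; this is what
  each of the other conditions is compared with.\<close>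
definition natural_operations :: "('m \<Rightarrow> 'm \<Rightarrow> 'm) \<Rightarrow> bool"
  where "natural_operations p \<longleftrightarrow>
    (\<forall>d c. (d, c) \<in> \<M> \<longrightarrow> is_kpc_operation \<C> d c (p d c)) \<and>
    (\<forall>d c d' c' f f\<^sub>0 f\<^sub>1. (d, c) \<in> \<M> \<and> (d', c') \<in> \<M> \<and>
      f \<in> hom (Dom \<C> d) (Dom \<C> d') \<and>
      f\<^sub>0 \<in> hom (Cod \<C> d) (Cod \<C> d') \<and> f\<^sub>1 \<in> hom (Cod \<C> c) (Cod \<C> c') \<and>
      d' \<cdot> f = f\<^sub>0 \<cdot> d \<and> c' \<cdot> f = f\<^sub>1 \<cdot> c \<longrightarrow>
      f \<cdot> p d c = p d' c' \<cdot> kpc_map d c d' c' f)"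

lemma natural_operations_op:
  "natural_operations p \<Longrightarrow> (d, c) \<in> \<M> \<Longrightarrow> is_kpc_operation \<C> d c (p d c)"
  unfolding natural_operations_def by blast

lemma natural_operations_triple:
  assumes nat: "natural_operations p" and dc: "(d, c) \<in> \<M>" and dc': "(d', c') \<in> \<M>"
    and f: "f \<in> hom (Dom \<C> d) (Dom \<C> d')"
    and f0: "f\<^sub>0 \<in> hom (Cod \<C> d) (Cod \<C> d')" and f1: "f\<^sub>1 \<in> hom (Cod \<C> c) (Cod \<C> c')"
    and eq: "d' \<cdot> f = f\<^sub>0 \<cdot> d" "c' \<cdot> f = f\<^sub>1 \<cdot> c"
    and xyz: "x \<in> hom Z (Dom \<C> d)" "y \<in> hom Z (Dom \<C> d)" "z \<in> hom Z (Dom \<C> d)"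
      "d \<cdot> x = d \<cdot> y" "c \<cdot> y = c \<cdot> z"
  shows "f \<cdot> (p d c \<cdot> triple d c x y z) = p d' c' \<cdot> triple d' c' (f \<cdot> x) (f \<cdot> y) (f \<cdot> z)"
proof -
  have 1: "f \<cdot> p d c = p d' c' \<cdot> kpc_map d c d' c' f"
    using nat dc dc' f f0 f1 eq unfolding natural_operations_def by blast
  note P = kpc_operationD[OF natural_operations_op[OF nat dc]]
  note P' = kpc_operationD[OF natural_operations_op[OF nat dc']]
  note T = triple_props[OF M_span[OF dc] xyz]
  note M = kpc_map_props[OF M_span[OF dc] M_span[OF dc'] f f0 f1 eq]
  show ?thesis
    using Cmp_eq_extend[OF 1, of "triple d c x y z"] M(1) M(5)[OF xyz] P P' T f by simp
qed

text \<open>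
  Write the elements of the pullback as \<open>(a,b)\<close> with \<open>f a = g b\<close>. The extension is
  \<open>m(a,b) = p(\<alpha> a, \<beta> f a, \<gamma> b)\<close>; the unit laws of \<open>p\<close> give its restrictions along both sections.
  For an arbitrary solution \<open>m\<close>, the equations for \<open>d m\<close> and \<open>c m\<close> make it a morphism of spans from
  \<open>(\<pi>\<^sub>2, \<pi>\<^sub>1)\<close> to \<open>(d, c)\<close>, so it preserves the operations. In \<open>A \<times>\<^sub>B C\<close> itself the operation must
  satisfy \<open>p((a, s f a), (r f a, s f a), (r g b, b)) = (a, b)\<close>, because its value has second component
  that of the last argument and first component that of the first one. Applying \<open>m\<close> yields the
  formula.
\<close>
lemma split_pullback_condition_if_natural_operations:
  assumes nat: "natural_operations p"
  shows "split_pullback_condition \<C> \<M>"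
  unfolding split_pullback_condition_def
proof (intro allI impI, elim conjE)
  fix A B C D D\<^sub>0 D\<^sub>1 f r g s \<alpha> \<beta> \<gamma> d c
  assume f: "f \<in> hom A B" and r: "r \<in> hom B A" and g: "g \<in> hom C B" and s: "s \<in> hom B C"
    and \<alpha>: "\<alpha> \<in> hom A D" and \<beta>: "\<beta> \<in> hom B D" and \<gamma>: "\<gamma> \<in> hom C D"
    and d: "d \<in> hom D D\<^sub>0" and c: "c \<in> hom D D\<^sub>1"
    and fr: "f \<cdot> r = \<one> B" and gs: "g \<cdot> s = \<one> B" and \<alpha>r: "\<alpha> \<cdot> r = \<beta>" and \<gamma>s: "\<gamma> \<cdot> s = \<beta>"
    and d\<alpha>: "d \<cdot> \<alpha> = d \<cdot> \<beta> \<cdot> f" and c\<gamma>: "c \<cdot> \<beta> \<cdot> g = c \<cdot> \<gamma>" and dc: "(d, c) \<in> \<M>"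
  note sp = M_span[OF dc] and op = natural_operations_op[OF nat dc]
  note pb = has_pullback_split[OF f r fr g s gs]
  note e = split_sections[OF f r fr g s gs]
  let ?e1 = "pair f g (\<one> A) (s \<cdot> f)" and ?e2 = "pair f g (r \<cdot> g) (\<one> C)"
  let ?x = "\<alpha> \<cdot> \<pi>\<^sub>1 f g" and ?y = "\<beta> \<cdot> (f \<cdot> \<pi>\<^sub>1 f g)" and ?z = "\<gamma> \<cdot> \<pi>\<^sub>2 f g"
  have sq: "f \<cdot> \<pi>\<^sub>1 f g = g \<cdot> \<pi>\<^sub>2 f g" by (rule pullback_square[OF pb])
  have obj: "A \<in> Obj \<C>" "B \<in> Obj \<C>" "C \<in> Obj \<C>" using f g by auto
  have xyz: "?x \<in> hom (PB f g) (Dom \<C> d)" "?y \<in> hom (PB f g) (Dom \<C> d)" "?z \<in> hom (PB f g) (Dom \<C> d)"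
    using \<alpha> \<beta> \<gamma> f g d pb by auto
  have dx: "d \<cdot> ?x = d \<cdot> ?y"
    using Cmp_eq_extend[OF d\<alpha>, of "\<pi>\<^sub>1 f g"] \<alpha> \<beta> f d pb by auto
  have "c \<cdot> (\<beta> \<cdot> (g \<cdot> \<pi>\<^sub>2 f g)) = c \<cdot> ?z"
    using Cmp_eq_extend[OF c\<gamma>, of "\<pi>\<^sub>2 f g"] \<beta> \<gamma> g c pb by auto
  then have cy: "c \<cdot> ?y = c \<cdot> ?z" by (simp add: sq)
  note T = triple_props[OF sp xyz dx cy] and L = kpc_operation_laws[OF op sp xyz dx cy]
  note P = kpc_operationD[OF op]
  let ?m = "p d c \<cdot> triple d c ?x ?y ?z"
  have xe: "?x \<cdot> ?e1 = \<alpha>" "?y \<cdot> ?e1 = \<beta> \<cdot> f" "?z \<cdot> ?e1 = \<beta> \<cdot> f"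
    using \<alpha> \<beta> \<gamma> f g s e pb obj Cmp_eq_extend[OF \<gamma>s] by auto
  have "f \<cdot> (\<pi>\<^sub>1 f g \<cdot> ?e2) = g"
    using e Cmp_eq_extend[OF fr, of g] f r g by simp
  then have ye: "?x \<cdot> ?e2 = \<beta> \<cdot> g" "?y \<cdot> ?e2 = \<beta> \<cdot> g" "?z \<cdot> ?e2 = \<gamma>"
    using \<alpha> \<beta> \<gamma> f g r e(2,5,6) pb obj Cmp_eq_extend[OF \<alpha>r] by auto
  have d\<alpha>': "d \<cdot> \<alpha> = d \<cdot> (\<beta> \<cdot> f)" and c\<gamma>': "c \<cdot> (\<beta> \<cdot> g) = c \<cdot> \<gamma>"
    using d\<alpha> c\<gamma> \<beta> f g d c by auto
  have m1: "?m \<cdot> ?e1 = \<alpha>"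
    using triple_Cmp[OF sp xyz dx cy e(1)] kpc_operation_units(1)[OF op _ _ d\<alpha>', of A]
      T P e(1) xe \<alpha> \<beta> f d by simp
  have m2: "?m \<cdot> ?e2 = \<gamma>"
    using triple_Cmp[OF sp xyz dx cy e(2)] kpc_operation_units(2)[OF op _ _ c\<gamma>', of C]
      T P e(2) ye \<gamma> \<beta> g d by simp
  show "\<exists>!m. m \<in> hom (PB f g) D \<and> m \<cdot> ?e1 = \<alpha> \<and> m \<cdot> ?e2 = \<gamma> \<and>
      d \<cdot> m = d \<cdot> \<gamma> \<cdot> \<pi>\<^sub>2 f g \<and> c \<cdot> m = c \<cdot> \<alpha> \<cdot> \<pi>\<^sub>1 f g"
  proof (rule ex1I[of _ ?m])
    show "?m \<in> hom (PB f g) D \<and> ?m \<cdot> ?e1 = \<alpha> \<and> ?m \<cdot> ?e2 = \<gamma> \<and>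
      d \<cdot> ?m = d \<cdot> \<gamma> \<cdot> \<pi>\<^sub>2 f g \<and> c \<cdot> ?m = c \<cdot> \<alpha> \<cdot> \<pi>\<^sub>1 f g"
      using m1 m2 L d c \<alpha> \<gamma> f g pb by simp
  next
    fix m assume m: "m \<in> hom (PB f g) D \<and> m \<cdot> ?e1 = \<alpha> \<and> m \<cdot> ?e2 = \<gamma> \<and>
      d \<cdot> m = d \<cdot> \<gamma> \<cdot> \<pi>\<^sub>2 f g \<and> c \<cdot> m = c \<cdot> \<alpha> \<cdot> \<pi>\<^sub>1 f g"
    \<comment> \<open>The legs are exchanged because \<open>d m\<close> factors through \<open>\<pi>\<^sub>2\<close> and \<open>c m\<close> through \<open>\<pi>\<^sub>1\<close>.\<close>
    have M: "(\<pi>\<^sub>2 f g, \<pi>\<^sub>1 f g) \<in> \<M>"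
      using local_products local_product_split(2)[OF f r fr g s gs]
      unfolding contains_local_products_def by blast
    let ?u = "?e1 \<cdot> \<pi>\<^sub>1 f g" and ?v = "?e1 \<cdot> (r \<cdot> (f \<cdot> \<pi>\<^sub>1 f g))" and ?w = "?e2 \<cdot> \<pi>\<^sub>2 f g"
    have uvw: "?u \<in> hom (PB f g) (Dom \<C> (\<pi>\<^sub>2 f g))" "?v \<in> hom (PB f g) (Dom \<C> (\<pi>\<^sub>2 f g))"
      "?w \<in> hom (PB f g) (Dom \<C> (\<pi>\<^sub>2 f g))"
      using e pb f r g by auto
    have uv: "\<pi>\<^sub>2 f g \<cdot> ?u = \<pi>\<^sub>2 f g \<cdot> ?v"
      using Cmp_eq_extend[OF e(4)] Cmp_eq_extend[OF fr] e(1) f r s pb by simp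
    have vw: "\<pi>\<^sub>1 f g \<cdot> ?v = \<pi>\<^sub>1 f g \<cdot> ?w"
      using Cmp_eq_extend[OF e(3)] Cmp_eq_extend[OF e(5)] sq e(1,2) f r g pb obj by simp
    note op' = natural_operations_op[OF nat M]
    note L' = kpc_operation_laws[OF op' M_span[OF M] uvw uv vw]
    have one: "p (\<pi>\<^sub>2 f g) (\<pi>\<^sub>1 f g) \<cdot> triple (\<pi>\<^sub>2 f g) (\<pi>\<^sub>1 f g) ?u ?v ?w = \<one> (PB f g)"
      by (rule PB_ext[OF pb, of _ "PB f g"])
        (use L' pb Cmp_eq_extend[OF e(3)] Cmp_eq_extend[OF e(6)] e(1,2) f g in simp_all)
    have "m \<cdot> (p (\<pi>\<^sub>2 f g) (\<pi>\<^sub>1 f g) \<cdot> triple (\<pi>\<^sub>2 f g) (\<pi>\<^sub>1 f g) ?u ?v ?w) =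
        p d c \<cdot> triple d c (m \<cdot> ?u) (m \<cdot> ?v) (m \<cdot> ?w)"
      by (rule natural_operations_triple[OF nat M dc, of m "d \<cdot> \<gamma>" "c \<cdot> \<alpha>", OF _ _ _ _ _ uvw uv vw])
        (use m d c \<alpha> \<gamma> f g pb spansD[OF sp] in auto)
    moreover have "m \<cdot> ?u = ?x" "m \<cdot> ?v = ?y" "m \<cdot> ?w = ?z"
      using m e f g r pb Cmp_eq_extend[of m ?e1 \<alpha>] Cmp_eq_extend[of m ?e2 \<gamma>] Cmp_eq_extend[OF \<alpha>r] \<alpha> by auto
    ultimately show "m = ?m"
      using one m by simp
  qed
qed

section \<open>The operations determined by the condition on split pullbacks\<close>

text \<open>The uniqueness part as a proof principle for equations. The compatibility of \<open>\<alpha>\<close> and \<open>\<gamma>\<close> with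
  \<open>d\<close> and \<open>c\<close> is automatic, since both are restrictions of \<open>m\<close>; the middle morphism \<open>\<beta>\<close> is the common
  restriction of \<open>\<alpha>\<close> and \<open>\<gamma>\<close> to \<open>B\<close>.\<close>
lemma split_pullback_unique:
  assumes split: "split_pullback_condition \<C> \<M>" and dc: "(d, c) \<in> \<M>"
    and f: "f \<in> hom A B" and r: "r \<in> hom B A" and fr: "f \<cdot> r = \<one> B"
    and g: "g \<in> hom C B" and s: "s \<in> hom B C" and gs: "g \<cdot> s = \<one> B"
    and m: "m \<in> hom (PB f g) (Dom \<C> d)" and n: "n \<in> hom (PB f g) (Dom \<C> d)"
    and e1: "m \<cdot> pair f g (\<one> A) (s \<cdot> f) = \<alpha>" "n \<cdot> pair f g (\<one> A) (s \<cdot> f) = \<alpha>"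
    and e2: "m \<cdot> pair f g (r \<cdot> g) (\<one> C) = \<gamma>" "n \<cdot> pair f g (r \<cdot> g) (\<one> C) = \<gamma>"
    and dm: "d \<cdot> m = d \<cdot> (\<gamma> \<cdot> \<pi>\<^sub>2 f g)" "d \<cdot> n = d \<cdot> (\<gamma> \<cdot> \<pi>\<^sub>2 f g)"
    and cm: "c \<cdot> m = c \<cdot> (\<alpha> \<cdot> \<pi>\<^sub>1 f g)" "c \<cdot> n = c \<cdot> (\<alpha> \<cdot> \<pi>\<^sub>1 f g)"
  shows "m = n"
proof -
  note pb = has_pullback_split[OF f r fr g s gs]
  note e = split_sections[OF f r fr g s gs]
  note S = spansD[OF M_span[OF dc]]
  let ?e1 = "pair f g (\<one> A) (s \<cdot> f)" and ?e2 = "pair f g (r \<cdot> g) (\<one> C)"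
  have obj: "A \<in> Obj \<C>" "B \<in> Obj \<C>" "C \<in> Obj \<C>" using f g by auto
  have \<alpha>: "\<alpha> \<in> hom A (Dom \<C> d)" and \<gamma>: "\<gamma> \<in> hom C (Dom \<C> d)" using e1(1) e2(1) m e by auto
  have "?e1 \<cdot> r = ?e2 \<cdot> s"
    by (rule PB_ext[OF pb, of _ B])
      (use e(1,2) pb f g r s fr gs obj Cmp_eq_extend[OF e(3)] Cmp_eq_extend[OF e(4)]
        Cmp_eq_extend[OF e(5)] Cmp_eq_extend[OF e(6)] in simp_all)
  then have \<beta>: "\<gamma> \<cdot> s = \<alpha> \<cdot> r"
    unfolding e1(1)[symmetric] e2(1)[symmetric] using m e(1,2) r s by simp
  have d\<alpha>: "d \<cdot> \<alpha> = d \<cdot> (\<alpha> \<cdot> r) \<cdot> f"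
  proof -
    have "d \<cdot> \<alpha> = (d \<cdot> m) \<cdot> ?e1" using e1(1) m e(1) S by simp
    also have "\<dots> = d \<cdot> (\<gamma> \<cdot> s) \<cdot> f"
      unfolding dm(1) using e(1,4) pb f g s S \<gamma> by simp
    finally show ?thesis by (simp add: \<beta>)
  qed
  have c\<gamma>: "c \<cdot> (\<alpha> \<cdot> r) \<cdot> g = c \<cdot> \<gamma>"
  proof -
    have "c \<cdot> \<gamma> = (c \<cdot> m) \<cdot> ?e2" using e2(1) m e(2) S by simp
    also have "\<dots> = c \<cdot> (\<alpha> \<cdot> r) \<cdot> g"
      unfolding cm(1) using e(2,5) pb f g r S \<alpha> by simp
    finally show ?thesis by simp
  qed
  have "\<exists>!m. m \<in> hom (PB f g) (Dom \<C> d) \<and> m \<cdot> ?e1 = \<alpha> \<and> m \<cdot> ?e2 = \<gamma> \<and>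
      d \<cdot> m = d \<cdot> \<gamma> \<cdot> \<pi>\<^sub>2 f g \<and> c \<cdot> m = c \<cdot> \<alpha> \<cdot> \<pi>\<^sub>1 f g"
    by (rule split[unfolded split_pullback_condition_def, rule_format,
          of f A B r g C s \<alpha> "Dom \<C> d" "\<alpha> \<cdot> r" \<gamma> d "Cod \<C> d" c "Cod \<C> c"])
      (use f r fr g s gs \<alpha> \<beta> \<gamma> d\<alpha> c\<gamma> dc S in simp)
  moreover have "d \<cdot> \<gamma> \<cdot> \<pi>\<^sub>2 f g = d \<cdot> (\<gamma> \<cdot> \<pi>\<^sub>2 f g)" "c \<cdot> \<alpha> \<cdot> \<pi>\<^sub>1 f g = c \<cdot> (\<alpha> \<cdot> \<pi>\<^sub>1 f g)"
    using S \<gamma> \<alpha> pb f g by auto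
  ultimately show ?thesis
    using m n e1 e2 dm cm by metis
qed

text \<open>In \<open>D(d,c)\<close>, viewed as a pullback of split epimorphisms over \<open>D\<close>, the two sections embed the
  kernel pairs as the triples \<open>\<langle>x,y,y\<rangle>\<close> and \<open>\<langle>y,y,z\<rangle>\<close>.\<close>
lemma kpc_split:
  fixes d c
  assumes sp: "(d, c) \<in> spans \<C>"
  defines "f \<equiv> \<pi>\<^sub>2 d d" and "g \<equiv> \<pi>\<^sub>1 c c"
    and "r \<equiv> pair d d (\<one> (Dom \<C> d)) (\<one> (Dom \<C> d))" and "s \<equiv> pair c c (\<one> (Dom \<C> d)) (\<one> (Dom \<C> d))"
  shows "f \<in> hom (PB d d) (Dom \<C> d)" "r \<in> hom (Dom \<C> d) (PB d d)" "f \<cdot> r = \<one> (Dom \<C> d)"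
    "g \<in> hom (PB c c) (Dom \<C> d)" "s \<in> hom (Dom \<C> d) (PB c c)" "g \<cdot> s = \<one> (Dom \<C> d)"
    and "pair f g (\<one> (PB d d)) (s \<cdot> f) = triple d c (\<pi>\<^sub>1 d d) (\<pi>\<^sub>2 d d) (\<pi>\<^sub>2 d d)"
    and "pair f g (r \<cdot> g) (\<one> (PB c c)) = triple d c (\<pi>\<^sub>1 c c) (\<pi>\<^sub>1 c c) (\<pi>\<^sub>2 c c)"
    and "PB f g = kpc d c"
proof -
  note S = spansD[OF sp]
  note D = diagonal_split[OF S(4)] diagonal_split[OF S(5), unfolded S(3)]
  show fg: "f \<in> hom (PB d d) (Dom \<C> d)" "r \<in> hom (Dom \<C> d) (PB d d)" "f \<cdot> r = \<one> (Dom \<C> d)"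
    "g \<in> hom (PB c c) (Dom \<C> d)" "s \<in> hom (Dom \<C> d) (PB c c)" "g \<cdot> s = \<one> (Dom \<C> d)"
    using S D unfolding f_def g_def r_def s_def by auto
  note rs = pair_Cmp[OF S(4), of "\<one> (Dom \<C> d)" "\<one> (Dom \<C> d)" "\<pi>\<^sub>1 c c"]
    pair_Cmp[OF S(5), of "\<one> (Dom \<C> d)" "\<one> (Dom \<C> d)" "\<pi>\<^sub>2 d d"]
  have rg: "r \<cdot> g = pair d d (\<pi>\<^sub>1 c c) (\<pi>\<^sub>1 c c)" and sf: "s \<cdot> f = pair c c (\<pi>\<^sub>2 d d) (\<pi>\<^sub>2 d d)"
    using rs S unfolding f_def g_def r_def s_def by simp_all
  have one: "pair h h (\<pi>\<^sub>1 h h) (\<pi>\<^sub>2 h h) = \<one> (PB h h)" if pb: "has_pullback \<C> h h" for h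
    by (rule PB_ext[OF pb, of _ "PB h h"])
      (use pb pair_props[OF pb, of "\<pi>\<^sub>1 h h" "\<pi>\<^sub>2 h h"] pullback_square[OF pb] in auto)
  show "pair f g (\<one> (PB d d)) (s \<cdot> f) = triple d c (\<pi>\<^sub>1 d d) (\<pi>\<^sub>2 d d) (\<pi>\<^sub>2 d d)"
    "pair f g (r \<cdot> g) (\<one> (PB c c)) = triple d c (\<pi>\<^sub>1 c c) (\<pi>\<^sub>1 c c) (\<pi>\<^sub>2 c c)"
    unfolding rg sf by (simp_all add: triple_def one[OF S(4)] one[OF S(5)] f_def g_def)
  show "PB f g = kpc d c" by (simp add: kpc_def f_def g_def)
qed

text \<open>The previous principle on \<open>D(a,b)\<close>, for morphisms that behave as the composite of \<open>h\<close> with an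
  operation on \<open>(a,b)\<close> would. The span \<open>(a,b)\<close> is arbitrary and only the target has to lie in \<open>\<M>\<close>;
  this permits spans with exchanged legs below.\<close>
lemma kpc_morphism_unique:
  assumes split: "split_pullback_condition \<C> \<M>" and dc: "(d, c) \<in> \<M>" and sp: "(a, b) \<in> spans \<C>"
    and m: "m \<in> hom (kpc a b) (Dom \<C> d)" and n: "n \<in> hom (kpc a b) (Dom \<C> d)"
    and xyy: "\<And>Z x y. x \<in> hom Z (Dom \<C> a) \<Longrightarrow> y \<in> hom Z (Dom \<C> a) \<Longrightarrow> a \<cdot> x = a \<cdot> y \<Longrightarrow>
      m \<cdot> triple a b x y y = h \<cdot> x \<and> n \<cdot> triple a b x y y = h \<cdot> x"
    and xxy: "\<And>Z x y. x \<in> hom Z (Dom \<C> a) \<Longrightarrow> y \<in> hom Z (Dom \<C> a) \<Longrightarrow> b \<cdot> x = b \<cdot> y \<Longrightarrow>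
      m \<cdot> triple a b x x y = h \<cdot> y \<and> n \<cdot> triple a b x x y = h \<cdot> y"
    and h: "h \<in> hom (Dom \<C> a) (Dom \<C> d)"
    and dm: "d \<cdot> m = d \<cdot> (h \<cdot> kpc_cod a b)" "d \<cdot> n = d \<cdot> (h \<cdot> kpc_cod a b)"
    and cm: "c \<cdot> m = c \<cdot> (h \<cdot> kpc_dom a b)" "c \<cdot> n = c \<cdot> (h \<cdot> kpc_dom a b)"
  shows "m = n"
proof -
  note S = spansD[OF sp] and pb = has_pullback_kpc[OF sp]
  note K = kpc_split[OF sp]
  have sq: "a \<cdot> \<pi>\<^sub>1 a a = a \<cdot> \<pi>\<^sub>2 a a" "b \<cdot> \<pi>\<^sub>1 b b = b \<cdot> \<pi>\<^sub>2 b b"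
    using pullback_square S by auto
  show ?thesis
  proof (rule split_pullback_unique[OF split dc K(1-6), of m n "h \<cdot> \<pi>\<^sub>1 a a" "h \<cdot> \<pi>\<^sub>2 b b"],
      unfold K(7-9))
    show "d \<cdot> m = d \<cdot> (h \<cdot> \<pi>\<^sub>2 b b \<cdot> \<pi>\<^sub>2 (\<pi>\<^sub>2 a a) (\<pi>\<^sub>1 b b))"
      "d \<cdot> n = d \<cdot> (h \<cdot> \<pi>\<^sub>2 b b \<cdot> \<pi>\<^sub>2 (\<pi>\<^sub>2 a a) (\<pi>\<^sub>1 b b))"
      "c \<cdot> m = c \<cdot> (h \<cdot> \<pi>\<^sub>1 a a \<cdot> \<pi>\<^sub>1 (\<pi>\<^sub>2 a a) (\<pi>\<^sub>1 b b))"
      "c \<cdot> n = c \<cdot> (h \<cdot> \<pi>\<^sub>1 a a \<cdot> \<pi>\<^sub>1 (\<pi>\<^sub>2 a a) (\<pi>\<^sub>1 b b))"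
      using dm cm pb S h by (auto simp: kpc_cod_def kpc_dom_def kp1_def kp2_def)
  qed (use m n S h xyy[of "\<pi>\<^sub>1 a a" "PB a a" "\<pi>\<^sub>2 a a"] xxy[of "\<pi>\<^sub>1 b b" "PB b b" "\<pi>\<^sub>2 b b"] sq in auto)
qed

lemma kpc_operation_components:
  assumes op: "is_kpc_operation \<C> d c p" and sp: "(d, c) \<in> spans \<C>"
  shows "d \<cdot> p = d \<cdot> kpc_cod d c" "c \<cdot> p = c \<cdot> kpc_dom d c"
proof -
  note K = kpc_components[OF sp] and S = spansD[OF sp]
  have "triple d c (kpc_dom d c) (kpc_mid d c) (kpc_cod d c) = \<one> (kpc d c)"
    using triple_components[OF sp, of "\<one> (kpc d c)"] K kpc_Obj[OF sp] by simp
  with kpc_operation_laws[OF op sp K(1-5)] show "d \<cdot> p = d \<cdot> kpc_cod d c" "c \<cdot> p = c \<cdot> kpc_dom d c"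
    using kpc_operationD[OF op] by auto
qed

lemma kpc_operation_unique:
  assumes split: "split_pullback_condition \<C> \<M>" and dc: "(d, c) \<in> \<M>"
    and p: "is_kpc_operation \<C> d c p" and q: "is_kpc_operation \<C> d c q"
  shows "p = q"
proof -
  note sp = M_span[OF dc]
  note K = kpc_components[OF sp] and S = spansD[OF sp]
  have o: "Dom \<C> d \<in> Obj \<C>" using S by auto
  show ?thesis
    by (rule kpc_morphism_unique[OF split dc sp, of p q "\<one> (Dom \<C> d)"])
      (use kpc_operationD[OF p] kpc_operationD[OF q] kpc_operation_units[OF p]
        kpc_operation_units[OF q] kpc_operation_components[OF p sp]
        kpc_operation_components[OF q sp] K S o in simp_all)
qed

text \<open>The extension problem over \<open>D(d)\<close> and \<open>D(c)\<close> with \<open>\<alpha>(x,y) = x\<close>, \<open>\<beta> = 1\<close> and \<open>\<gamma>(y,z) = z\<close> asks for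
  exactly the laws of an operation.\<close>
lemma kpc_operation_exists:
  assumes split: "split_pullback_condition \<C> \<M>" and dc: "(d, c) \<in> \<M>"
  shows "\<exists>p. is_kpc_operation \<C> d c p"
proof -
  note sp = M_span[OF dc]
  note S = spansD[OF sp] and K = kpc_split[OF sp] and pb = has_pullback_kpc[OF sp]
  note kc = kpc_components[OF sp]
  have o: "Dom \<C> d \<in> Obj \<C>" using S by auto
  have sq: "d \<cdot> \<pi>\<^sub>1 d d = d \<cdot> \<pi>\<^sub>2 d d" "c \<cdot> \<pi>\<^sub>1 c c = c \<cdot> \<pi>\<^sub>2 c c"
    using pullback_square S by auto
  let ?f = "\<pi>\<^sub>2 d d" and ?g = "\<pi>\<^sub>1 c c"
  let ?r = "pair d d (\<one> (Dom \<C> d)) (\<one> (Dom \<C> d))" and ?s = "pair c c (\<one> (Dom \<C> d)) (\<one> (Dom \<C> d))"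
  note D = diagonal_split[OF S(4)] diagonal_split[OF S(5), unfolded S(3)]
  have "\<exists>!m. m \<in> hom (PB ?f ?g) (Dom \<C> d) \<and> m \<cdot> pair ?f ?g (\<one> (PB d d)) (?s \<cdot> ?f) = \<pi>\<^sub>1 d d \<and>
      m \<cdot> pair ?f ?g (?r \<cdot> ?g) (\<one> (PB c c)) = \<pi>\<^sub>2 c c \<and>
      d \<cdot> m = d \<cdot> \<pi>\<^sub>2 c c \<cdot> \<pi>\<^sub>2 ?f ?g \<and> c \<cdot> m = c \<cdot> \<pi>\<^sub>1 d d \<cdot> \<pi>\<^sub>1 ?f ?g"
    by (rule split[unfolded split_pullback_condition_def, rule_format,
          of ?f "PB d d" "Dom \<C> d" ?r ?g "PB c c" ?s "\<pi>\<^sub>1 d d" "Dom \<C> d" "\<one> (Dom \<C> d)" "\<pi>\<^sub>2 c c"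
            d "Cod \<C> d" c "Cod \<C> c"])
      (use K(1-6) D S o dc sq in simp)
  then obtain m where "m \<in> hom (kpc d c) (Dom \<C> d)"
    and xyy: "m \<cdot> triple d c (\<pi>\<^sub>1 d d) (\<pi>\<^sub>2 d d) (\<pi>\<^sub>2 d d) = \<pi>\<^sub>1 d d"
    and xxy: "m \<cdot> triple d c (\<pi>\<^sub>1 c c) (\<pi>\<^sub>1 c c) (\<pi>\<^sub>2 c c) = \<pi>\<^sub>2 c c"
    and "d \<cdot> m = d \<cdot> \<pi>\<^sub>2 c c \<cdot> \<pi>\<^sub>2 ?f ?g" "c \<cdot> m = c \<cdot> \<pi>\<^sub>1 d d \<cdot> \<pi>\<^sub>1 ?f ?g"
    unfolding K(7-9) by blast
  then have m: "m \<in> hom (kpc d c) (Dom \<C> d)" and dm: "d \<cdot> m = d \<cdot> kpc_cod d c"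
    and cm: "c \<cdot> m = c \<cdot> kpc_dom d c"
    using S pb by (auto simp: kpc_cod_def kpc_dom_def kp1_def kp2_def)
  have "is_kpc_operation \<C> d c m"
    unfolding is_kpc_operation_def
  proof (intro conjI ballI allI impI)
    show "m \<in> hom (kpc d c) (Dom \<C> d)" by (rule m)
    fix Z x y z
    assume x: "x \<in> hom Z (Dom \<C> d)" and y: "y \<in> hom Z (Dom \<C> d)" and z: "z \<in> hom Z (Dom \<C> d)"
      and eq: "d \<cdot> x = d \<cdot> y \<and> c \<cdot> y = c \<cdot> z"
    note T = triple_props[OF sp x y z conjunct1[OF eq] conjunct2[OF eq]]
    show "d \<cdot> (m \<cdot> triple d c x y z) = d \<cdot> z" "c \<cdot> (m \<cdot> triple d c x y z) = c \<cdot> x"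
      using Cmp_eq_extend[OF dm] Cmp_eq_extend[OF cm] T m S kc by simp_all
    have u: "pair d d x y \<in> hom Z (PB d d)" "\<pi>\<^sub>1 d d \<cdot> pair d d x y = x" "\<pi>\<^sub>2 d d \<cdot> pair d d x y = y"
      using pair_props[OF S(4), of x y] x y eq by auto
    have v: "pair c c y z \<in> hom Z (PB c c)" "\<pi>\<^sub>1 c c \<cdot> pair c c y z = y" "\<pi>\<^sub>2 c c \<cdot> pair c c y z = z"
      using pair_props[OF S(5), of y z] y z eq S by auto
    have t1: "triple d c (\<pi>\<^sub>1 d d) (\<pi>\<^sub>2 d d) (\<pi>\<^sub>2 d d) \<in> hom (PB d d) (kpc d c)"
      "triple d c (\<pi>\<^sub>1 d d) (\<pi>\<^sub>2 d d) (\<pi>\<^sub>2 d d) \<cdot> pair d d x y = triple d c x y y"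
      using triple_props[OF sp, of "\<pi>\<^sub>1 d d" "PB d d" "\<pi>\<^sub>2 d d" "\<pi>\<^sub>2 d d"]
        triple_Cmp[OF sp, of "\<pi>\<^sub>1 d d" "PB d d" "\<pi>\<^sub>2 d d" "\<pi>\<^sub>2 d d" "pair d d x y" Z] u S sq by auto
    have t2: "triple d c (\<pi>\<^sub>1 c c) (\<pi>\<^sub>1 c c) (\<pi>\<^sub>2 c c) \<in> hom (PB c c) (kpc d c)"
      "triple d c (\<pi>\<^sub>1 c c) (\<pi>\<^sub>1 c c) (\<pi>\<^sub>2 c c) \<cdot> pair c c y z = triple d c y y z"
      using triple_props[OF sp, of "\<pi>\<^sub>1 c c" "PB c c" "\<pi>\<^sub>1 c c" "\<pi>\<^sub>2 c c"]
        triple_Cmp[OF sp, of "\<pi>\<^sub>1 c c" "PB c c" "\<pi>\<^sub>1 c c" "\<pi>\<^sub>2 c c" "pair c c y z" Z] v S sq by auto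
    show "m \<cdot> triple d c x y y = x"
      using Cmp_eq_extend[OF xyy, of "pair d d x y"] t1 u m by simp
    show "m \<cdot> triple d c y y z = z"
      using Cmp_eq_extend[OF xxy, of "pair c c y z"] t2 v m by simp
  qed
  then show ?thesis by blast
qed

text \<open>Both sides send \<open>\<langle>x,y,y\<rangle>\<close> to \<open>f x\<close> and \<open>\<langle>y,y,z\<rangle>\<close> to \<open>f z\<close>.\<close>
lemma kpc_operation_natural:
  assumes split: "split_pullback_condition \<C> \<M>" and dc: "(d, c) \<in> \<M>" and dc': "(d', c') \<in> \<M>"
    and p: "is_kpc_operation \<C> d c p" and q: "is_kpc_operation \<C> d' c' q"
    and f: "f \<in> hom (Dom \<C> d) (Dom \<C> d')"
    and f0: "f\<^sub>0 \<in> hom (Cod \<C> d) (Cod \<C> d')" and f1: "f\<^sub>1 \<in> hom (Cod \<C> c) (Cod \<C> c')"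
    and eq: "d' \<cdot> f = f\<^sub>0 \<cdot> d" "c' \<cdot> f = f\<^sub>1 \<cdot> c"
  shows "f \<cdot> p = q \<cdot> kpc_map d c d' c' f"
proof -
  note sp = M_span[OF dc] and sp' = M_span[OF dc']
  note S = spansD[OF sp] and S' = spansD[OF sp'] and K = kpc_components[OF sp]
  note K' = kpc_components[OF sp']
  note P = kpc_operationD[OF p] and Q = kpc_operationD[OF q]
  note M = kpc_map_props[OF sp sp' f f0 f1 eq]
  note Pc = kpc_operation_components[OF p sp] and Qc = kpc_operation_components[OF q sp']
  show ?thesis
  proof (rule kpc_morphism_unique[OF split dc' sp, of _ _ f])
    show "f \<cdot> p \<in> hom (kpc d c) (Dom \<C> d')" "q \<cdot> kpc_map d c d' c' f \<in> hom (kpc d c) (Dom \<C> d')"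
      using P Q M(1) f by auto
    show "f \<in> hom (Dom \<C> d) (Dom \<C> d')" by (rule f)
    show "d' \<cdot> (f \<cdot> p) = d' \<cdot> (f \<cdot> kpc_cod d c)" "c' \<cdot> (f \<cdot> p) = c' \<cdot> (f \<cdot> kpc_dom d c)"
      using M(6)[of p "kpc d c" "kpc_cod d c"] M(7)[of p "kpc d c" "kpc_dom d c"] P K Pc by auto
    show "d' \<cdot> (q \<cdot> kpc_map d c d' c' f) = d' \<cdot> (f \<cdot> kpc_cod d c)"
      "c' \<cdot> (q \<cdot> kpc_map d c d' c' f) = c' \<cdot> (f \<cdot> kpc_dom d c)"
      using Cmp_eq_extend[OF Qc(1)] Cmp_eq_extend[OF Qc(2)] M(1-4) Q S' K' by auto
    fix Z x y assume x: "x \<in> hom Z (Dom \<C> d)" and y: "y \<in> hom Z (Dom \<C> d)"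
    show "f \<cdot> p \<cdot> triple d c x y y = f \<cdot> x \<and> q \<cdot> kpc_map d c d' c' f \<cdot> triple d c x y y = f \<cdot> x"
      if e: "d \<cdot> x = d \<cdot> y"
      using kpc_operation_units(1)[OF p x y e] kpc_operation_units(1)[OF q, of "f \<cdot> x" Z "f \<cdot> y"]
        M(1) M(5)[OF x y y e] M(6)[OF x y e] triple_props[OF sp x y y e] x y f P Q by simp
    show "f \<cdot> p \<cdot> triple d c x x y = f \<cdot> y \<and> q \<cdot> kpc_map d c d' c' f \<cdot> triple d c x x y = f \<cdot> y"
      if e: "c \<cdot> x = c \<cdot> y"
      using kpc_operation_units(2)[OF p x y e] kpc_operation_units(2)[OF q, of "f \<cdot> x" Z "f \<cdot> y"]
        M(1) M(5)[OF x x y _ e] M(7)[OF x y e] triple_props[OF sp x x y _ e] x y f P Q by simp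
  qed
qed

lemma natural_operations_exist:
  assumes split: "split_pullback_condition \<C> \<M>"
  obtains p where "natural_operations p"
proof
  let ?p = "\<lambda>d c. SOME p. is_kpc_operation \<C> d c p"
  have "is_kpc_operation \<C> d c (?p d c)" if "(d, c) \<in> \<M>" for d c
    using kpc_operation_exists[OF split that] by (rule someI_ex)
  then show "natural_operations ?p"
    unfolding natural_operations_def using kpc_operation_natural[OF split] by blast
qed

text \<open>
  The five-tuples \<open>(u,v,x,y,z)\<close> form the pullback of \<open>cod\<close> and \<open>dom\<close> from \<open>D(d,c)\<close> to \<open>D\<close>, both split by
  the diagonal \<open>x \<mapsto> \<langle>x,x,x\<rangle>\<close>. On \<open>(u,v,x,x,x)\<close> both bracketings reduce to \<open>p(u,v,x)\<close>, on
  \<open>(x,x,x,y,z)\<close> to \<open>p(x,y,z)\<close>, and they have the same composites with \<open>d\<close> and \<open>c\<close>.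
\<close>
lemma kpc_operation_assoc:
  assumes split: "split_pullback_condition \<C> \<M>" and dc: "(d, c) \<in> \<M>"
    and op: "is_kpc_operation \<C> d c p"
    and uv: "u \<in> hom Z (Dom \<C> d)" "v \<in> hom Z (Dom \<C> d)"
    and xyz: "x \<in> hom Z (Dom \<C> d)" "y \<in> hom Z (Dom \<C> d)" "z \<in> hom Z (Dom \<C> d)"
    and eq: "d \<cdot> u = d \<cdot> v" "c \<cdot> v = c \<cdot> x" "d \<cdot> x = d \<cdot> y" "c \<cdot> y = c \<cdot> z"
  shows "p \<cdot> triple d c u v (p \<cdot> triple d c x y z) = p \<cdot> triple d c (p \<cdot> triple d c u v x) y z"
proof -
  note sp = M_span[OF dc]
  note S = spansD[OF sp] and K = kpc_components[OF sp] and P = kpc_operationD[OF op]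
  note Pc = kpc_operation_components[OF op sp]
  have o: "Dom \<C> d \<in> Obj \<C>" "kpc d c \<in> Obj \<C>" using S kpc_Obj[OF sp] by auto
  let ?f = "kpc_cod d c" and ?g = "kpc_dom d c"
  let ?s = "triple d c (\<one> (Dom \<C> d)) (\<one> (Dom \<C> d)) (\<one> (Dom \<C> d))"
  let ?k = "kpc_mid d c"
  have s: "?s \<in> hom (Dom \<C> d) (kpc d c)" "?f \<cdot> ?s = \<one> (Dom \<C> d)" "?g \<cdot> ?s = \<one> (Dom \<C> d)"
    "?k \<cdot> ?s = \<one> (Dom \<C> d)" "p \<cdot> ?s = \<one> (Dom \<C> d)"
    using triple_props[OF sp, of "\<one> (Dom \<C> d)" "Dom \<C> d" "\<one> (Dom \<C> d)" "\<one> (Dom \<C> d)"]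
      kpc_operation_units[OF op, of "\<one> (Dom \<C> d)" "Dom \<C> d" "\<one> (Dom \<C> d)"] o by auto
  note fs = K(3) s(1,2) K(1) s(1,3)
  note pb = has_pullback_split[OF fs]
  note e = split_sections[OF fs]
  let ?e1 = "pair ?f ?g (\<one> (kpc d c)) (?s \<cdot> ?f)" and ?e2 = "pair ?f ?g (?s \<cdot> ?g) (\<one> (kpc d c))"
  let ?l = "\<pi>\<^sub>1 ?f ?g" and ?r = "\<pi>\<^sub>2 ?f ?g"
  let ?T = "triple d c"
  have pr: "?l \<in> hom (PB ?f ?g) (kpc d c)" "?r \<in> hom (PB ?f ?g) (kpc d c)"
    using pb K by auto
  have sq: "?f \<cdot> ?l = ?g \<cdot> ?r" by (rule pullback_square[OF pb])
  have lr: "d \<cdot> (?g \<cdot> ?l) = d \<cdot> (?k \<cdot> ?l)" "c \<cdot> (?k \<cdot> ?l) = c \<cdot> (?g \<cdot> ?r)"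
      "d \<cdot> (?g \<cdot> ?r) = d \<cdot> (?k \<cdot> ?r)" "c \<cdot> (?k \<cdot> ?r) = c \<cdot> (?f \<cdot> ?r)"
      "d \<cdot> (p \<cdot> ?l) = d \<cdot> (?g \<cdot> ?r)" "c \<cdot> (p \<cdot> ?l) = c \<cdot> (?g \<cdot> ?l)"
      "d \<cdot> (p \<cdot> ?r) = d \<cdot> (?f \<cdot> ?r)" "c \<cdot> (p \<cdot> ?r) = c \<cdot> (?g \<cdot> ?r)"
    using Cmp_eq_extend[OF K(4), of ?l] Cmp_eq_extend[OF K(5), of ?l] Cmp_eq_extend[OF K(4), of ?r]
      Cmp_eq_extend[OF K(5), of ?r] Cmp_eq_extend[OF Pc(1), of ?l] Cmp_eq_extend[OF Pc(2), of ?l]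
      Cmp_eq_extend[OF Pc(1), of ?r] Cmp_eq_extend[OF Pc(2), of ?r] pr K P S sq by simp_all
  have h: "?g \<cdot> ?l \<in> hom (PB ?f ?g) (Dom \<C> d)" "?k \<cdot> ?l \<in> hom (PB ?f ?g) (Dom \<C> d)"
    "p \<cdot> ?l \<in> hom (PB ?f ?g) (Dom \<C> d)" "?f \<cdot> ?r \<in> hom (PB ?f ?g) (Dom \<C> d)"
    "?k \<cdot> ?r \<in> hom (PB ?f ?g) (Dom \<C> d)" "p \<cdot> ?r \<in> hom (PB ?f ?g) (Dom \<C> d)"
    using pr K P by auto
  have meq: "c \<cdot> (?k \<cdot> ?l) = c \<cdot> (p \<cdot> ?r)" and neq: "d \<cdot> (p \<cdot> ?l) = d \<cdot> (?k \<cdot> ?r)"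
    using lr by simp_all
  \<comment> \<open>The generic five-tuple, bracketed to the right and to the left.\<close>
  let ?mt = "?T (?g \<cdot> ?l) (?k \<cdot> ?l) (p \<cdot> ?r)" and ?nt = "?T (p \<cdot> ?l) (?k \<cdot> ?r) (?f \<cdot> ?r)"
  note mt = triple_props[OF sp h(1,2,6) lr(1) meq] kpc_operation_laws[OF op sp h(1,2,6) lr(1) meq]
  note nt = triple_props[OF sp h(3,5,4) neq lr(4)] kpc_operation_laws[OF op sp h(3,5,4) neq lr(4)]
  have one: "?T ?g ?k ?f = \<one> (kpc d c)"
    using triple_components[OF sp, of "\<one> (kpc d c)"] K o by simp
  have pf: "p \<cdot> (?s \<cdot> ?f) = ?f" "p \<cdot> (?s \<cdot> ?g) = ?g" "?f \<cdot> (?s \<cdot> ?f) = ?f" "?g \<cdot> (?s \<cdot> ?g) = ?g"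
    "?k \<cdot> (?s \<cdot> ?f) = ?f" "?k \<cdot> (?s \<cdot> ?g) = ?g"
    using Cmp_eq_extend[OF s(5)] Cmp_eq_extend[OF s(2)] Cmp_eq_extend[OF s(3)]
      Cmp_eq_extend[OF s(4)] s(1) K P by simp_all
  have m1: "p \<cdot> ?mt \<cdot> ?e1 = p"
    using triple_Cmp[OF sp h(1,2,6) lr(1) meq e(1)] e(1,3,4) pr K P mt pf one o by simp
  have n1: "p \<cdot> ?nt \<cdot> ?e1 = p"
    using triple_Cmp[OF sp h(3,5,4) neq lr(4) e(1)] e(1,3,4) pr K P nt pf o
      kpc_operation_units(1)[OF op, of p "kpc d c" ?f] Pc by simp
  have m2: "p \<cdot> ?mt \<cdot> ?e2 = p"
    using triple_Cmp[OF sp h(1,2,6) lr(1) meq e(2)] e(2,5,6) pr K P mt pf o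
      kpc_operation_units(2)[OF op, of ?g "kpc d c" p] Pc by simp
  have n2: "p \<cdot> ?nt \<cdot> ?e2 = p"
    using triple_Cmp[OF sp h(3,5,4) neq lr(4) e(2)] e(2,5,6) pr K P nt pf one o by simp
  have main: "p \<cdot> ?mt = p \<cdot> ?nt"
    by (rule split_pullback_unique[OF split dc fs _ _ m1 n1 m2 n2])
      (use mt nt lr in auto)
  note t = triple_props[OF sp uv xyz(1) eq(1,2)] and t' = triple_props[OF sp xyz eq(3,4)]
  have w: "pair ?f ?g (?T u v x) (?T x y z) \<in> hom Z (PB ?f ?g)"
    "?l \<cdot> pair ?f ?g (?T u v x) (?T x y z) = ?T u v x" "?r \<cdot> pair ?f ?g (?T u v x) (?T x y z) = ?T x y z"
    using pair_props[OF pb, of "?T u v x" "?T x y z"] t t' K by auto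
  have "?mt \<cdot> pair ?f ?g (?T u v x) (?T x y z) = ?T u v (p \<cdot> ?T x y z)"
    "?nt \<cdot> pair ?f ?g (?T u v x) (?T x y z) = ?T (p \<cdot> ?T u v x) y z"
    using triple_Cmp[OF sp h(1,2,6) lr(1) meq w(1)] triple_Cmp[OF sp h(3,5,4) neq lr(4) w(1)]
      w t t' pr K P by simp_all
  moreover have "(p \<cdot> ?mt) \<cdot> pair ?f ?g (?T u v x) (?T x y z) = (p \<cdot> ?nt) \<cdot> pair ?f ?g (?T u v x) (?T x y z)"
    by (simp only: main)
  ultimately show ?thesis
    using w(1) mt nt P by simp
qed

lemma kpc_operations_iff_split_pullback:
  "kpc_operations_condition \<C> \<M> \<longleftrightarrow> split_pullback_condition \<C> \<M>"
proof
  assume "kpc_operations_condition \<C> \<M>"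
  then have "\<exists>p. natural_operations p"
    unfolding kpc_operations_condition_def natural_operations_def
    by (elim ex_forward conjE) (intro conjI, blast, assumption)
  then obtain p where "natural_operations p" ..
  then show "split_pullback_condition \<C> \<M>"
    by (rule split_pullback_condition_if_natural_operations)
next
  assume split: "split_pullback_condition \<C> \<M>"
  then obtain p where p: "natural_operations p" by (rule natural_operations_exist)
  note op = natural_operations_op[OF p]
  show "kpc_operations_condition \<C> \<M>"
    unfolding kpc_operations_condition_def
  proof (intro exI[of _ p] conjI)
    show "\<forall>d c. (d, c) \<in> \<M> \<longrightarrow>
      is_kpc_operation \<C> d c (p d c) \<and> (\<forall>q. is_kpc_operation \<C> d c q \<longrightarrow> q = p d c)"
      using op kpc_operation_unique[OF split] by blast
    show "\<forall>d c d' c' f f\<^sub>0 f\<^sub>1. (d, c) \<in> \<M> \<and> (d', c') \<in> \<M> \<and>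
      f \<in> hom (Dom \<C> d) (Dom \<C> d') \<and>
      f\<^sub>0 \<in> hom (Cod \<C> d) (Cod \<C> d') \<and> f\<^sub>1 \<in> hom (Cod \<C> c) (Cod \<C> c') \<and>
      d' \<cdot> f = f\<^sub>0 \<cdot> d \<and> c' \<cdot> f = f\<^sub>1 \<cdot> c \<longrightarrow>
      f \<cdot> p d c = p d' c' \<cdot> kpc_map d c d' c' f"
      using p unfolding natural_operations_def by blast
  qed (use kpc_operation_assoc[OF split _ op] in blast)
qed

section \<open>Jointly monic spans\<close>

text \<open>
  The product of the commuting idempotents \<open>e\<^sub>1 p\<^sub>1\<close> and \<open>e\<^sub>2 p\<^sub>2\<close> of \<open>E\<close> need not split, so there may
  be no \<open>B\<close> with \<open>E = A \<times>\<^sub>B C\<close> and the hypothesis does not apply to \<open>E\<close> directly. Existence of \<open>m\<close>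
  survives because \<open>p\<close> only needs elements: \<open>m = p(\<alpha> p\<^sub>1, \<alpha> p\<^sub>1 e\<^sub>2 p\<^sub>2, \<gamma> p\<^sub>2)\<close>.

  For uniqueness one would like a solution \<open>m\<close> to preserve operations, but it is a morphism of spans
  from \<open>(p\<^sub>2, p\<^sub>1)\<close>, and only \<open>(p\<^sub>1, p\<^sub>2)\<close> is known to lie in \<open>\<M>\<close>. Reversing the arguments of the
  operation \<open>p\<^sub>E\<close> of \<open>(p\<^sub>1, p\<^sub>2)\<close> repairs this: \<open>q(x,y,z) = p\<^sub>E(z,y,x)\<close> is an operation for
  \<open>(p\<^sub>2, p\<^sub>1)\<close>, and \<open>m q(x,y,z) = p(m x, m y, m z)\<close> by uniqueness on the kernel pair construction of
  \<open>(p\<^sub>2, p\<^sub>1)\<close>. As \<open>p\<^sub>1\<close> and \<open>p\<^sub>2\<close> are jointly monic,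
  \<open>q(e\<^sub>1 p\<^sub>1, e\<^sub>1 p\<^sub>1 e\<^sub>2 p\<^sub>2, e\<^sub>2 p\<^sub>2) = 1\<close>, which expresses \<open>m\<close> through \<open>\<alpha>\<close> and \<open>\<gamma>\<close>.
\<close>
lemma joint_mono_if_split_pullback:
  assumes split: "split_pullback_condition \<C> \<M>"
  shows "joint_mono_condition \<C> \<M>"
  unfolding joint_mono_condition_def
proof (intro allI impI, elim conjE)
  fix A C D D\<^sub>0 D\<^sub>1 E p\<^sub>1 e\<^sub>1 p\<^sub>2 e\<^sub>2 \<alpha> \<gamma> d c
  assume p1: "p\<^sub>1 \<in> hom E A" and e1: "e\<^sub>1 \<in> hom A E" and p2: "p\<^sub>2 \<in> hom E C" and e2: "e\<^sub>2 \<in> hom C E"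
    and \<alpha>: "\<alpha> \<in> hom A D" and \<gamma>: "\<gamma> \<in> hom C D" and d: "d \<in> hom D D\<^sub>0" and c: "c \<in> hom D D\<^sub>1"
    and mono: "jointly_monic \<C> p\<^sub>1 p\<^sub>2" and dc: "(d, c) \<in> \<M>" and pp: "(p\<^sub>1, p\<^sub>2) \<in> \<M>"
    and pe1: "p\<^sub>1 \<cdot> e\<^sub>1 = \<one> A" and pe2: "p\<^sub>2 \<cdot> e\<^sub>2 = \<one> C"
    and comm: "(e\<^sub>1 \<cdot> p\<^sub>1) \<cdot> (e\<^sub>2 \<cdot> p\<^sub>2) = (e\<^sub>2 \<cdot> p\<^sub>2) \<cdot> (e\<^sub>1 \<cdot> p\<^sub>1)"
    and \<alpha>\<gamma>: "\<alpha> \<cdot> p\<^sub>1 \<cdot> (e\<^sub>2 \<cdot> p\<^sub>2) = \<gamma> \<cdot> p\<^sub>2 \<cdot> (e\<^sub>1 \<cdot> p\<^sub>1)"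
    and d\<alpha>: "d \<cdot> \<alpha> \<cdot> p\<^sub>1 = d \<cdot> \<alpha> \<cdot> p\<^sub>1 \<cdot> (e\<^sub>2 \<cdot> p\<^sub>2)"
    and c\<gamma>: "c \<cdot> \<gamma> \<cdot> p\<^sub>2 = c \<cdot> \<gamma> \<cdot> p\<^sub>2 \<cdot> (e\<^sub>1 \<cdot> p\<^sub>1)"
  note H = p1 e1 p2 e2 \<alpha> \<gamma> d c
  have obj: "A \<in> Obj \<C>" "C \<in> Obj \<C>" "E \<in> Obj \<C>" "D \<in> Obj \<C>" using H by auto
  obtain p where nat: "natural_operations p" using natural_operations_exist[OF split] .
  note op = natural_operations_op[OF nat dc] and sp = M_span[OF dc]
  note P = kpc_operationD[OF op]
  have comm': "e\<^sub>2 \<cdot> (p\<^sub>2 \<cdot> (e\<^sub>1 \<cdot> p\<^sub>1)) = e\<^sub>1 \<cdot> (p\<^sub>1 \<cdot> (e\<^sub>2 \<cdot> p\<^sub>2))" using comm H by simp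
  have \<alpha>\<gamma>': "\<gamma> \<cdot> (p\<^sub>2 \<cdot> (e\<^sub>1 \<cdot> p\<^sub>1)) = \<alpha> \<cdot> (p\<^sub>1 \<cdot> (e\<^sub>2 \<cdot> p\<^sub>2))" using \<alpha>\<gamma> H by simp
  let ?x = "\<alpha> \<cdot> p\<^sub>1" and ?y = "\<alpha> \<cdot> (p\<^sub>1 \<cdot> (e\<^sub>2 \<cdot> p\<^sub>2))" and ?z = "\<gamma> \<cdot> p\<^sub>2"
  have xyz: "?x \<in> hom E (Dom \<C> d)" "?y \<in> hom E (Dom \<C> d)" "?z \<in> hom E (Dom \<C> d)"
    using H by auto
  have dx: "d \<cdot> ?x = d \<cdot> ?y" using d\<alpha> H by simp
  have cy: "c \<cdot> ?y = c \<cdot> ?z" unfolding \<alpha>\<gamma>'[symmetric] using c\<gamma> H by simp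
  note T = triple_props[OF sp xyz dx cy] and L = kpc_operation_laws[OF op sp xyz dx cy]
  let ?m = "p d c \<cdot> triple d c ?x ?y ?z"
  have xe: "?x \<cdot> e\<^sub>1 = \<alpha>" "?z \<cdot> e\<^sub>1 = ?y \<cdot> e\<^sub>1"
    unfolding \<alpha>\<gamma>'[symmetric] using H pe1 by simp_all
  have ze: "?z \<cdot> e\<^sub>2 = \<gamma>" "?y \<cdot> e\<^sub>2 = ?x \<cdot> e\<^sub>2"
    using H pe2 by simp_all
  have ye: "?y \<cdot> e\<^sub>1 \<in> hom A (Dom \<C> d)" "?x \<cdot> e\<^sub>2 \<in> hom C (Dom \<C> d)" using H by auto
  have "(d \<cdot> ?x) \<cdot> e\<^sub>1 = (d \<cdot> ?y) \<cdot> e\<^sub>1" "(c \<cdot> ?y) \<cdot> e\<^sub>2 = (c \<cdot> ?z) \<cdot> e\<^sub>2"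
    using dx cy by simp_all
  then have "d \<cdot> (?x \<cdot> e\<^sub>1) = d \<cdot> (?y \<cdot> e\<^sub>1)" "c \<cdot> (?y \<cdot> e\<^sub>2) = c \<cdot> (?z \<cdot> e\<^sub>2)"
    using H by simp_all
  then have dce: "d \<cdot> \<alpha> = d \<cdot> (?y \<cdot> e\<^sub>1)" "c \<cdot> (?x \<cdot> e\<^sub>2) = c \<cdot> \<gamma>"
    using xe ze by metis+
  have "triple d c ?x ?y ?z \<cdot> e\<^sub>1 = triple d c \<alpha> (?y \<cdot> e\<^sub>1) (?y \<cdot> e\<^sub>1)"
    "triple d c ?x ?y ?z \<cdot> e\<^sub>2 = triple d c (?x \<cdot> e\<^sub>2) (?x \<cdot> e\<^sub>2) \<gamma>"
    using triple_Cmp[OF sp xyz dx cy e1] triple_Cmp[OF sp xyz dx cy e2] xe ze by metis+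
  then have m1: "?m \<cdot> e\<^sub>1 = \<alpha>" and m2: "?m \<cdot> e\<^sub>2 = \<gamma>"
    using kpc_operation_units(1)[OF op _ ye(1) dce(1)] kpc_operation_units(2)[OF op ye(2) _ dce(2)] T P H
    by simp_all
  show "\<exists>!m. m \<in> hom E D \<and> m \<cdot> e\<^sub>1 = \<alpha> \<and> m \<cdot> e\<^sub>2 = \<gamma> \<and> d \<cdot> m = d \<cdot> \<gamma> \<cdot> p\<^sub>2 \<and> c \<cdot> m = c \<cdot> \<alpha> \<cdot> p\<^sub>1"
  proof (rule ex1I[of _ ?m])
    show "?m \<in> hom E D \<and> ?m \<cdot> e\<^sub>1 = \<alpha> \<and> ?m \<cdot> e\<^sub>2 = \<gamma> \<and> d \<cdot> ?m = d \<cdot> \<gamma> \<cdot> p\<^sub>2 \<and> c \<cdot> ?m = c \<cdot> \<alpha> \<cdot> p\<^sub>1"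
      using m1 m2 L H by simp
  next
    fix m
    assume "m \<in> hom E D \<and> m \<cdot> e\<^sub>1 = \<alpha> \<and> m \<cdot> e\<^sub>2 = \<gamma> \<and> d \<cdot> m = d \<cdot> \<gamma> \<cdot> p\<^sub>2 \<and> c \<cdot> m = c \<cdot> \<alpha> \<cdot> p\<^sub>1"
    then have m: "m \<in> hom E D" and me: "m \<cdot> e\<^sub>1 = \<alpha>" "m \<cdot> e\<^sub>2 = \<gamma>"
      and dm: "d \<cdot> m = d \<cdot> (\<gamma> \<cdot> p\<^sub>2)" and cm: "c \<cdot> m = c \<cdot> (\<alpha> \<cdot> p\<^sub>1)" using H by auto
    note op' = natural_operations_op[OF nat pp] and sp' = M_span[OF pp]
    note P' = kpc_operationD[OF op']
    let ?q = "p p\<^sub>1 p\<^sub>2"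
    have sw: "(p\<^sub>2, p\<^sub>1) \<in> spans \<C>" using sp' by (auto simp: spans_def)
    note K = kpc_components[OF sw] and Ko = kpc_Obj[OF sw]
    let ?F = "kpc p\<^sub>2 p\<^sub>1"
    let ?X = "kpc_dom p\<^sub>2 p\<^sub>1" and ?Y = "kpc_mid p\<^sub>2 p\<^sub>1" and ?Z = "kpc_cod p\<^sub>2 p\<^sub>1"
    have K': "?X \<in> hom ?F (Dom \<C> p\<^sub>1)" "?Y \<in> hom ?F (Dom \<C> p\<^sub>1)" "?Z \<in> hom ?F (Dom \<C> p\<^sub>1)"
      "p\<^sub>1 \<cdot> ?Z = p\<^sub>1 \<cdot> ?Y" "p\<^sub>2 \<cdot> ?Y = p\<^sub>2 \<cdot> ?X"
      using K p1 p2 by auto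
    note T' = triple_props[OF sp' K'(3,2,1,4,5)] and L' = kpc_operation_laws[OF op' sp' K'(3,2,1,4,5)]
    \<comment> \<open>\<open>\<langle>x,y,z\<rangle> \<mapsto> \<langle>z,y,x\<rangle>\<close>, so that \<open>?q \<cdot> ?rev\<close> is the operation for the exchanged legs.\<close>
    let ?rev = "triple p\<^sub>1 p\<^sub>2 ?Z ?Y ?X"
    have dm': "d \<cdot> (m \<cdot> x) = d \<cdot> (\<gamma> \<cdot> (p\<^sub>2 \<cdot> x))" "c \<cdot> (m \<cdot> x) = c \<cdot> (\<alpha> \<cdot> (p\<^sub>1 \<cdot> x))"
      if "x \<in> hom W E" for x W
      using Cmp_eq_extend[OF dm, of x] Cmp_eq_extend[OF cm, of x] that H m by simp_all
    have mK: "m \<cdot> ?X \<in> hom ?F (Dom \<C> d)" "m \<cdot> ?Y \<in> hom ?F (Dom \<C> d)" "m \<cdot> ?Z \<in> hom ?F (Dom \<C> d)"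
      using m K p2 d by auto
    have dX: "d \<cdot> (m \<cdot> ?X) = d \<cdot> (m \<cdot> ?Y)" "c \<cdot> (m \<cdot> ?Y) = c \<cdot> (m \<cdot> ?Z)"
      using dm'[of ?X ?F] dm'[of ?Y ?F] dm'[of ?Z ?F] K' p1 by simp_all
    note T'' = triple_props[OF sp mK dX] and L'' = kpc_operation_laws[OF op sp mK dX]
    have "m \<cdot> (?q \<cdot> ?rev) = p d c \<cdot> triple d c (m \<cdot> ?X) (m \<cdot> ?Y) (m \<cdot> ?Z)"
    proof (rule kpc_morphism_unique[OF split dc sw, of _ _ m])
      show "m \<cdot> (?q \<cdot> ?rev) \<in> hom ?F (Dom \<C> d)" using m L' p1 d by simp
      show "p d c \<cdot> triple d c (m \<cdot> ?X) (m \<cdot> ?Y) (m \<cdot> ?Z) \<in> hom ?F (Dom \<C> d)" using L'' by simp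
      show "m \<in> hom (Dom \<C> p\<^sub>2) (Dom \<C> d)" using m p2 d by simp
      show "d \<cdot> (m \<cdot> (?q \<cdot> ?rev)) = d \<cdot> (m \<cdot> ?Z)" "c \<cdot> (m \<cdot> (?q \<cdot> ?rev)) = c \<cdot> (m \<cdot> ?X)"
        using dm'[of "?q \<cdot> ?rev" ?F] dm'[of ?X ?F] dm'[of ?Z ?F] L' K' p1 by simp_all
      show "d \<cdot> (p d c \<cdot> triple d c (m \<cdot> ?X) (m \<cdot> ?Y) (m \<cdot> ?Z)) = d \<cdot> (m \<cdot> ?Z)"
        "c \<cdot> (p d c \<cdot> triple d c (m \<cdot> ?X) (m \<cdot> ?Y) (m \<cdot> ?Z)) = c \<cdot> (m \<cdot> ?X)"
        using L'' by simp_all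
      fix W x y assume x: "x \<in> hom W (Dom \<C> p\<^sub>2)" and y: "y \<in> hom W (Dom \<C> p\<^sub>2)"
      have x': "x \<in> hom W E" "y \<in> hom W E" "x \<in> hom W (Dom \<C> p\<^sub>1)" "y \<in> hom W (Dom \<C> p\<^sub>1)"
        "m \<cdot> x \<in> hom W (Dom \<C> d)" "m \<cdot> y \<in> hom W (Dom \<C> d)"
        using x y p1 p2 m d by auto
      show "m \<cdot> (?q \<cdot> ?rev) \<cdot> triple p\<^sub>2 p\<^sub>1 x y y = m \<cdot> x \<and>
          p d c \<cdot> triple d c (m \<cdot> ?X) (m \<cdot> ?Y) (m \<cdot> ?Z) \<cdot> triple p\<^sub>2 p\<^sub>1 x y y = m \<cdot> x"
        if e: "p\<^sub>2 \<cdot> x = p\<^sub>2 \<cdot> y"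
      proof -
        note t = triple_props[OF sw x y y e refl]
        have 1: "?rev \<cdot> triple p\<^sub>2 p\<^sub>1 x y y = triple p\<^sub>1 p\<^sub>2 y y x"
          using triple_Cmp[OF sp' K'(3,2,1,4,5), of "triple p\<^sub>2 p\<^sub>1 x y y" W] t by simp
        have 2: "triple d c (m \<cdot> ?X) (m \<cdot> ?Y) (m \<cdot> ?Z) \<cdot> triple p\<^sub>2 p\<^sub>1 x y y
            = triple d c (m \<cdot> x) (m \<cdot> y) (m \<cdot> y)"
          using triple_Cmp[OF sp mK dX, of "triple p\<^sub>2 p\<^sub>1 x y y" W] t m K p2 by simp
        have 3: "d \<cdot> (m \<cdot> x) = d \<cdot> (m \<cdot> y)" using dm' x' e by simp
        show ?thesis
          using 1 2 kpc_operation_units(2)[OF op' x'(4,3) e[symmetric]] T'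
            kpc_operation_units(1)[OF op x'(5,6) 3] t m P P' T'' L' p1 by simp
      qed
      show "m \<cdot> (?q \<cdot> ?rev) \<cdot> triple p\<^sub>2 p\<^sub>1 x x y = m \<cdot> y \<and>
          p d c \<cdot> triple d c (m \<cdot> ?X) (m \<cdot> ?Y) (m \<cdot> ?Z) \<cdot> triple p\<^sub>2 p\<^sub>1 x x y = m \<cdot> y"
        if e: "p\<^sub>1 \<cdot> x = p\<^sub>1 \<cdot> y"
      proof -
        note t = triple_props[OF sw x x y refl e]
        have 1: "?rev \<cdot> triple p\<^sub>2 p\<^sub>1 x x y = triple p\<^sub>1 p\<^sub>2 y x x"
          using triple_Cmp[OF sp' K'(3,2,1,4,5), of "triple p\<^sub>2 p\<^sub>1 x x y" W] t by simp
        have 2: "triple d c (m \<cdot> ?X) (m \<cdot> ?Y) (m \<cdot> ?Z) \<cdot> triple p\<^sub>2 p\<^sub>1 x x y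
            = triple d c (m \<cdot> x) (m \<cdot> x) (m \<cdot> y)"
          using triple_Cmp[OF sp mK dX, of "triple p\<^sub>2 p\<^sub>1 x x y" W] t m K p2 by simp
        have 3: "c \<cdot> (m \<cdot> x) = c \<cdot> (m \<cdot> y)" using dm' x' e by simp
        show ?thesis
          using 1 2 kpc_operation_units(1)[OF op' x'(4,3) e[symmetric]] T'
            kpc_operation_units(2)[OF op x'(5,6) 3] t m P P' T'' L' p1 by simp
      qed
    qed
    note key = this
    let ?u = "e\<^sub>1 \<cdot> p\<^sub>1" and ?v = "e\<^sub>1 \<cdot> (p\<^sub>1 \<cdot> (e\<^sub>2 \<cdot> p\<^sub>2))" and ?w = "e\<^sub>2 \<cdot> p\<^sub>2"
    have uvw: "?u \<in> hom E (Dom \<C> p\<^sub>2)" "?v \<in> hom E (Dom \<C> p\<^sub>2)" "?w \<in> hom E (Dom \<C> p\<^sub>2)"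
      "?u \<in> hom E (Dom \<C> p\<^sub>1)" "?v \<in> hom E (Dom \<C> p\<^sub>1)" "?w \<in> hom E (Dom \<C> p\<^sub>1)"
      using H by auto
    have uv: "p\<^sub>2 \<cdot> ?u = p\<^sub>2 \<cdot> ?v"
      unfolding comm'[symmetric] using Cmp_eq_extend[OF pe2] H by simp
    have vw: "p\<^sub>1 \<cdot> ?v = p\<^sub>1 \<cdot> ?w"
      using Cmp_eq_extend[OF pe1] H by simp
    let ?t = "triple p\<^sub>2 p\<^sub>1 ?u ?v ?w"
    note t = triple_props[OF sw uvw(1-3) uv vw]
    have rev: "?rev \<cdot> ?t = triple p\<^sub>1 p\<^sub>2 ?w ?v ?u"
      using triple_Cmp[OF sp' K'(3,2,1,4,5), of ?t E] t by simp
    note l = kpc_operation_laws[OF op' sp' uvw(6,5,4) vw[symmetric] uv[symmetric]]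
    have "?q \<cdot> triple p\<^sub>1 p\<^sub>2 ?w ?v ?u = \<one> E"
      by (rule mono[unfolded jointly_monic_def, rule_format, of _ E])
        (use l H obj Cmp_eq_extend[OF pe1] Cmp_eq_extend[OF pe2] in auto)
    then have "m = m \<cdot> (?q \<cdot> ?rev) \<cdot> ?t"
      using rev t T' P' m p1 by simp
    also have "\<dots> = p d c \<cdot> (triple d c (m \<cdot> ?X) (m \<cdot> ?Y) (m \<cdot> ?Z) \<cdot> ?t)"
      unfolding key using T'' P t by simp
    also have "triple d c (m \<cdot> ?X) (m \<cdot> ?Y) (m \<cdot> ?Z) \<cdot> ?t = triple d c ?x ?y ?z"
      using triple_Cmp[OF sp mK dX, of ?t E] t m K H Cmp_eq_extend[OF me(1)] Cmp_eq_extend[OF me(2)]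
      by simp
    finally show "m = ?m" .
  qed
qed

lemma split_pullback_if_joint_mono:
  assumes jm: "joint_mono_condition \<C> \<M>"
  shows "split_pullback_condition \<C> \<M>"
  unfolding split_pullback_condition_def
proof (intro allI impI, elim conjE)
  fix A B C D D\<^sub>0 D\<^sub>1 f r g s \<alpha> \<beta> \<gamma> d c
  assume f: "f \<in> hom A B" and r: "r \<in> hom B A" and g: "g \<in> hom C B" and s: "s \<in> hom B C"
    and \<alpha>: "\<alpha> \<in> hom A D" and \<beta>: "\<beta> \<in> hom B D" and \<gamma>: "\<gamma> \<in> hom C D"
    and d: "d \<in> hom D D\<^sub>0" and c: "c \<in> hom D D\<^sub>1"
    and fr: "f \<cdot> r = \<one> B" and gs: "g \<cdot> s = \<one> B" and \<alpha>r: "\<alpha> \<cdot> r = \<beta>" and \<gamma>s: "\<gamma> \<cdot> s = \<beta>"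
    and d\<alpha>: "d \<cdot> \<alpha> = d \<cdot> \<beta> \<cdot> f" and c\<gamma>: "c \<cdot> \<beta> \<cdot> g = c \<cdot> \<gamma>" and dc: "(d, c) \<in> \<M>"
  note pb = has_pullback_split[OF f r fr g s gs]
  note e = split_sections[OF f r fr g s gs]
  let ?e1 = "pair f g (\<one> A) (s \<cdot> f)" and ?e2 = "pair f g (r \<cdot> g) (\<one> C)"
  let ?p = "\<pi>\<^sub>1 f g" and ?q = "\<pi>\<^sub>2 f g"
  have p: "?p \<in> hom (PB f g) A" and q: "?q \<in> hom (PB f g) C" using pb f g by auto
  have sq: "f \<cdot> ?p = g \<cdot> ?q" by (rule pullback_square[OF pb])
  note H = f r g s \<alpha> \<beta> \<gamma> d c p q
  have M: "(?p, ?q) \<in> \<M>"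
    using local_products local_product_split(1)[OF f r fr g s gs]
    unfolding contains_local_products_def by blast
  have mono: "jointly_monic \<C> ?p ?q"
    unfolding jointly_monic_def using PB_ext[OF pb] p by simp
  have pe2: "?p \<cdot> (?e2 \<cdot> ?q) = r \<cdot> (f \<cdot> ?p)"
    using Cmp_eq_extend[OF e(5)] e(2) H sq by simp
  have qe1: "?q \<cdot> (?e1 \<cdot> ?p) = s \<cdot> (f \<cdot> ?p)"
    using Cmp_eq_extend[OF e(4)] e(1) H by simp
  have comm: "(?e1 \<cdot> ?p) \<cdot> (?e2 \<cdot> ?q) = (?e2 \<cdot> ?q) \<cdot> (?e1 \<cdot> ?p)"
    by (rule PB_ext[OF pb, of _ "PB f g"])
      (use e(1,2) H pe2 qe1 Cmp_eq_extend[OF e(3)] Cmp_eq_extend[OF e(4)] Cmp_eq_extend[OF e(5)]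
        Cmp_eq_extend[OF e(6)] Cmp_eq_extend[OF fr] Cmp_eq_extend[OF gs] in simp_all)
  have d\<alpha>': "d \<cdot> (\<alpha> \<cdot> ?p) = d \<cdot> (\<beta> \<cdot> (f \<cdot> ?p))" and c\<gamma>': "c \<cdot> (\<beta> \<cdot> (g \<cdot> ?q)) = c \<cdot> (\<gamma> \<cdot> ?q)"
    using Cmp_eq_extend[OF d\<alpha>, of ?p] Cmp_eq_extend[OF c\<gamma>, of ?q] H by simp_all
  show "\<exists>!m. m \<in> hom (PB f g) D \<and> m \<cdot> ?e1 = \<alpha> \<and> m \<cdot> ?e2 = \<gamma> \<and>
      d \<cdot> m = d \<cdot> \<gamma> \<cdot> ?q \<and> c \<cdot> m = c \<cdot> \<alpha> \<cdot> ?p"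
    by (rule jm[unfolded joint_mono_condition_def, rule_format,
          of ?p "PB f g" A ?e1 ?q C ?e2 \<alpha> D \<gamma> d D\<^sub>0 c D\<^sub>1])
      (use H e M mono comm dc pe2 qe1 d\<alpha>' c\<gamma>' sq Cmp_eq_extend[OF \<alpha>r] Cmp_eq_extend[OF \<gamma>s]
        Cmp_eq_extend[OF e(3)] Cmp_eq_extend[OF e(6)] in simp)
qed

section \<open>Natural operations from functorial category structures\<close>

lemma reflexive_graphD:
  assumes "reflexive_graph \<C> G"
  shows "gd G \<in> hom (C1 G) (C0 G)" "gc G \<in> hom (C1 G) (C0 G)" "ge G \<in> hom (C0 G) (C1 G)"
    "gd G \<cdot> ge G = \<one> (C0 G)" "gc G \<cdot> ge G = \<one> (C0 G)" "C1 G \<in> Obj \<C>" "C0 G \<in> Obj \<C>"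
    "has_pullback \<C> (gd G) (gc G)"
proof -
  show G: "gd G \<in> hom (C1 G) (C0 G)" "gc G \<in> hom (C1 G) (C0 G)" "ge G \<in> hom (C0 G) (C1 G)"
    "gd G \<cdot> ge G = \<one> (C0 G)" "gc G \<cdot> ge G = \<one> (C0 G)"
    using assms by (auto simp: reflexive_graph_def)
  show "C1 G \<in> Obj \<C>" "C0 G \<in> Obj \<C>"
    using G(1) Dom_Obj[of "gd G"] Cod_Obj[of "gd G"] by auto
  show "has_pullback \<C> (gd G) (gc G)" by (rule has_pullback_split[OF G(1,3,4) G(2,3,5)])
qed

lemma graph_unit_eqs:
  assumes G: "reflexive_graph \<C> G" and x: "x \<in> hom Z (C1 G)"
  shows "ge G \<cdot> (gd G \<cdot> x) \<in> hom Z (C1 G)" "ge G \<cdot> (gc G \<cdot> x) \<in> hom Z (C1 G)"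
    "gd G \<cdot> (ge G \<cdot> (gd G \<cdot> x)) = gd G \<cdot> x" "gc G \<cdot> (ge G \<cdot> (gd G \<cdot> x)) = gd G \<cdot> x"
    "gd G \<cdot> (ge G \<cdot> (gc G \<cdot> x)) = gc G \<cdot> x" "gc G \<cdot> (ge G \<cdot> (gc G \<cdot> x)) = gc G \<cdot> x"
proof -
  note R = reflexive_graphD[OF G]
  show "ge G \<cdot> (gd G \<cdot> x) \<in> hom Z (C1 G)" "ge G \<cdot> (gc G \<cdot> x) \<in> hom Z (C1 G)"
    "gd G \<cdot> (ge G \<cdot> (gd G \<cdot> x)) = gd G \<cdot> x" "gc G \<cdot> (ge G \<cdot> (gd G \<cdot> x)) = gd G \<cdot> x"
    "gd G \<cdot> (ge G \<cdot> (gc G \<cdot> x)) = gc G \<cdot> x" "gc G \<cdot> (ge G \<cdot> (gc G \<cdot> x)) = gc G \<cdot> x"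
    using R(1-3,6,7) x Cmp_eq_extend[OF R(4)] Cmp_eq_extend[OF R(5)] by simp_all
qed

lemma internal_categoryD:
  assumes "internal_category \<C> G"
  shows "reflexive_graph \<C> G" "gm G \<in> hom (PB (gd G) (gc G)) (C1 G)"
    "gd G \<cdot> gm G = gd G \<cdot> \<pi>\<^sub>2 (gd G) (gc G)" "gc G \<cdot> gm G = gc G \<cdot> \<pi>\<^sub>1 (gd G) (gc G)"
    "gm G \<cdot> pair (gd G) (gc G) (\<one> (C1 G)) (ge G \<cdot> gd G) = \<one> (C1 G)"
    "gm G \<cdot> pair (gd G) (gc G) (ge G \<cdot> gc G) (\<one> (C1 G)) = \<one> (C1 G)"
    "\<And>Z x y z. x \<in> hom Z (C1 G) \<Longrightarrow> y \<in> hom Z (C1 G) \<Longrightarrow> z \<in> hom Z (C1 G) \<Longrightarrow>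
      gd G \<cdot> x = gc G \<cdot> y \<Longrightarrow> gd G \<cdot> y = gc G \<cdot> z \<Longrightarrow>
      gm G \<cdot> pair (gd G) (gc G) (gm G \<cdot> pair (gd G) (gc G) x y) z =
      gm G \<cdot> pair (gd G) (gc G) x (gm G \<cdot> pair (gd G) (gc G) y z)"
proof -
  note A = assms[unfolded internal_category_def Let_def]
  note B = A[THEN conjunct2, THEN conjunct2, THEN conjunct2, THEN conjunct2]
  show "reflexive_graph \<C> G" by (rule A[THEN conjunct1])
  show "gm G \<in> hom (PB (gd G) (gc G)) (C1 G)" by (rule A[THEN conjunct2, THEN conjunct1])
  show "gd G \<cdot> gm G = gd G \<cdot> \<pi>\<^sub>2 (gd G) (gc G)"
    by (rule A[THEN conjunct2, THEN conjunct2, THEN conjunct1])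
  show "gc G \<cdot> gm G = gc G \<cdot> \<pi>\<^sub>1 (gd G) (gc G)"
    by (rule A[THEN conjunct2, THEN conjunct2, THEN conjunct2, THEN conjunct1])
  show "gm G \<cdot> pair (gd G) (gc G) (\<one> (C1 G)) (ge G \<cdot> gd G) = \<one> (C1 G)"
    by (rule B[THEN conjunct1])
  show "gm G \<cdot> pair (gd G) (gc G) (ge G \<cdot> gc G) (\<one> (C1 G)) = \<one> (C1 G)"
    by (rule B[THEN conjunct2, THEN conjunct1])
  show "gm G \<cdot> pair (gd G) (gc G) (gm G \<cdot> pair (gd G) (gc G) x y) z =
      gm G \<cdot> pair (gd G) (gc G) x (gm G \<cdot> pair (gd G) (gc G) y z)"
    if "x \<in> hom Z (C1 G)" "y \<in> hom Z (C1 G)" "z \<in> hom Z (C1 G)"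
      "gd G \<cdot> x = gc G \<cdot> y" "gd G \<cdot> y = gc G \<cdot> z" for Z x y z
    using B[THEN conjunct2, THEN conjunct2] that by blast
qed

lemma internal_category_elements:
  assumes "internal_category \<C> G"
  shows internal_category_comp: "\<And>Z x y. x \<in> hom Z (C1 G) \<Longrightarrow> y \<in> hom Z (C1 G) \<Longrightarrow>
      gd G \<cdot> x = gc G \<cdot> y \<Longrightarrow> gm G \<cdot> pair (gd G) (gc G) x y \<in> hom Z (C1 G) \<and>
        gd G \<cdot> (gm G \<cdot> pair (gd G) (gc G) x y) = gd G \<cdot> y \<and>
        gc G \<cdot> (gm G \<cdot> pair (gd G) (gc G) x y) = gc G \<cdot> x"
    and internal_category_unit_right: "\<And>Z x. x \<in> hom Z (C1 G) \<Longrightarrow>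
      gm G \<cdot> pair (gd G) (gc G) x (ge G \<cdot> (gd G \<cdot> x)) = x"
    and internal_category_unit_left: "\<And>Z x. x \<in> hom Z (C1 G) \<Longrightarrow>
      gm G \<cdot> pair (gd G) (gc G) (ge G \<cdot> (gc G \<cdot> x)) x = x"
proof -
  note M = internal_categoryD[OF assms]
  note G = reflexive_graphD[OF M(1)]
  note e = split_sections[OF G(1,3,4) G(2,3,5)]
  fix Z x assume x: "x \<in> hom Z (C1 G)"
  {
    fix y assume y: "y \<in> hom Z (C1 G)" and eq: "gd G \<cdot> x = gc G \<cdot> y"
    have P: "pair (gd G) (gc G) x y \<in> hom Z (PB (gd G) (gc G))"
      "\<pi>\<^sub>1 (gd G) (gc G) \<cdot> pair (gd G) (gc G) x y = x" "\<pi>\<^sub>2 (gd G) (gc G) \<cdot> pair (gd G) (gc G) x y = y"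
      using pair_props[OF G(8), of x y] x y eq G by auto
    then show "gm G \<cdot> pair (gd G) (gc G) x y \<in> hom Z (C1 G) \<and>
        gd G \<cdot> (gm G \<cdot> pair (gd G) (gc G) x y) = gd G \<cdot> y \<and>
        gc G \<cdot> (gm G \<cdot> pair (gd G) (gc G) x y) = gc G \<cdot> x"
      using Cmp_eq_extend[OF M(3)] Cmp_eq_extend[OF M(4)] M(2) G by simp
  }
  have u1: "gd G \<cdot> \<one> (C1 G) = gc G \<cdot> (ge G \<cdot> gd G)" and u2: "gd G \<cdot> (ge G \<cdot> gc G) = gc G \<cdot> \<one> (C1 G)"
    using G Cmp_eq_extend[OF G(4)] Cmp_eq_extend[OF G(5)] by simp_all
  have "pair (gd G) (gc G) (\<one> (C1 G)) (ge G \<cdot> gd G) \<cdot> x = pair (gd G) (gc G) x (ge G \<cdot> (gd G \<cdot> x))"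
    by (subst pair_Cmp[OF G(8) _ _ _ _ _ u1]) (use G x in simp_all)
  moreover have "pair (gd G) (gc G) (ge G \<cdot> gc G) (\<one> (C1 G)) \<cdot> x = pair (gd G) (gc G) (ge G \<cdot> (gc G \<cdot> x)) x"
    by (subst pair_Cmp[OF G(8) _ _ _ _ _ u2]) (use G x in simp_all)
  ultimately show "gm G \<cdot> pair (gd G) (gc G) x (ge G \<cdot> (gd G \<cdot> x)) = x"
    "gm G \<cdot> pair (gd G) (gc G) (ge G \<cdot> (gc G \<cdot> x)) x = x"
    using Cmp_eq_extend[OF M(5), of x] Cmp_eq_extend[OF M(6), of x] e(1,2) M(2) x G by simp_all
qed

text \<open>A triple \<open>\<langle>x,y,z\<rangle>\<close> is an arrow from \<open>x\<close> to \<open>z\<close>; the identities are the constant triples.\<close>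
definition kpc_graph :: "'m \<Rightarrow> 'm \<Rightarrow> ('o, 'm) rgraph"
  where "kpc_graph d c = \<lparr>C1 = kpc d c, C0 = Dom \<C> d, gd = kpc_dom d c,
    ge = triple d c (\<one> (Dom \<C> d)) (\<one> (Dom \<C> d)) (\<one> (Dom \<C> d)), gc = kpc_cod d c\<rparr>"

lemma kpc_graph_in_RG:
  assumes dc: "(d, c) \<in> \<M>"
  shows "kpc_graph d c \<in> Obj (RG \<C> \<M>)"
proof -
  note sp = M_span[OF dc]
  note S = spansD[OF sp] and K = kpc_components[OF sp]
  have o: "Dom \<C> d \<in> Obj \<C>" using S by auto
  have "reflexive_graph \<C> (kpc_graph d c)"
    using triple_props[OF sp, of "\<one> (Dom \<C> d)" "Dom \<C> d" "\<one> (Dom \<C> d)" "\<one> (Dom \<C> d)"] K o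
    by (simp add: reflexive_graph_def kpc_graph_def)
  moreover have "(kpc_dom d c, kpc_cod d c) \<in> \<M>"
    using kpc_closed dc by (simp add: closed_under_kpc_def)
  ultimately show ?thesis by (simp add: RG_def graph_cat_def kpc_graph_def)
qed

lemma forget_obj_sel [simp]:
  "C1 (forget_obj G) = C1 G" "C0 (forget_obj G) = C0 G" "gd (forget_obj G) = gd G"
  "ge (forget_obj G) = ge G" "gc (forget_obj G) = gc G"
  by (simp_all add: forget_obj_def rgraph.truncate_def)

text \<open>\<open>gm\<close> takes the arrow applied last as its first argument, so this is the middle component of
  \<open>z \<rightarrow> y \<rightarrow> x\<close>, the composite of \<open>\<langle>z,z,y\<rangle>\<close> and \<open>\<langle>y,x,x\<rangle>\<close>, at the generic triple \<open>\<langle>x,y,z\<rangle>\<close>.\<close>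
definition mid_comp :: "('o, 'm) icat \<Rightarrow> 'm \<Rightarrow> 'm \<Rightarrow> 'm"
  where "mid_comp G d c = kpc_mid d c \<cdot> (gm G \<cdot> pair (kpc_dom d c) (kpc_cod d c)
    (triple d c (kpc_mid d c) (kpc_dom d c) (kpc_dom d c))
    (triple d c (kpc_cod d c) (kpc_cod d c) (kpc_mid d c)))"

text \<open>The composite is a triple \<open>\<langle>z,q,x\<rangle>\<close>, whence \<open>d q = d z\<close> and \<open>c q = c x\<close>. For \<open>y = z\<close> the first
  factor is an identity and \<open>\<langle>y,x,x\<rangle>\<close> remains; for \<open>x = y\<close> the second factor is one and \<open>\<langle>z,z,y\<rangle>\<close>
  remains. So the unit laws of the category become those of the operation.\<close>
lemma mid_comp_props:
  assumes dc: "(d, c) \<in> \<M>" and G: "internal_category \<C> G" and Gdc: "forget_obj G = kpc_graph d c"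
  shows "mid_comp G d c \<in> hom (kpc d c) (Dom \<C> d)"
    and "\<And>Z x y z. x \<in> hom Z (Dom \<C> d) \<Longrightarrow> y \<in> hom Z (Dom \<C> d) \<Longrightarrow> z \<in> hom Z (Dom \<C> d) \<Longrightarrow>
      d \<cdot> x = d \<cdot> y \<Longrightarrow> c \<cdot> y = c \<cdot> z \<Longrightarrow> mid_comp G d c \<cdot> triple d c x y z =
        kpc_mid d c \<cdot> (gm G \<cdot> pair (kpc_dom d c) (kpc_cod d c) (triple d c y x x) (triple d c z z y))"
    and "is_kpc_operation \<C> d c (mid_comp G d c)"
proof -
  note sp = M_span[OF dc]
  note S = spansD[OF sp] and K = kpc_components[OF sp]
  have o: "Dom \<C> d \<in> Obj \<C>" using S by auto
  have sel: "C1 G = kpc d c" "C0 G = Dom \<C> d" "gd G = kpc_dom d c" "gc G = kpc_cod d c"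
    "ge G = triple d c (\<one> (Dom \<C> d)) (\<one> (Dom \<C> d)) (\<one> (Dom \<C> d))"
    using arg_cong[OF Gdc, of C1] arg_cong[OF Gdc, of C0] arg_cong[OF Gdc, of gd]
      arg_cong[OF Gdc, of gc] arg_cong[OF Gdc, of ge] by (simp_all add: kpc_graph_def)
  note M = internal_categoryD[OF G, unfolded sel] and E = internal_category_elements[OF G, unfolded sel]
  note R = reflexive_graphD[OF M(1), unfolded sel]
  let ?g = "kpc_dom d c" and ?f = "kpc_cod d c" and ?T = "triple d c"
  have tri: "?T y x x \<in> hom Z (kpc d c)" "?T z z y \<in> hom Z (kpc d c)"
      "?g \<cdot> ?T y x x = ?f \<cdot> ?T z z y" "?f \<cdot> ?T y x x = x" "?g \<cdot> ?T z z y = z"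
      "kpc_mid d c \<cdot> ?T y x x = x" "kpc_mid d c \<cdot> ?T z z y = z"
    if "x \<in> hom Z (Dom \<C> d)" "y \<in> hom Z (Dom \<C> d)" "z \<in> hom Z (Dom \<C> d)"
      "d \<cdot> x = d \<cdot> y" "c \<cdot> y = c \<cdot> z" for Z x y z
    using triple_props[OF sp that(2,1,1) that(4)[symmetric] refl]
      triple_props[OF sp that(3,3,2) refl that(5)[symmetric]] by auto
  note tk = tri[OF K(1-5)]
  have P: "pair ?g ?f (?T (kpc_mid d c) ?g ?g) (?T ?f ?f (kpc_mid d c)) \<in> hom (kpc d c) (PB ?g ?f)"
    using pair_props[OF R(8) _ _ _ _ _ tk(3)] tk(1,2) K(1,3) by simp
  show hom: "mid_comp G d c \<in> hom (kpc d c) (Dom \<C> d)"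
    unfolding mid_comp_def using P M(2) K by simp
  show el: "mid_comp G d c \<cdot> ?T x y z = kpc_mid d c \<cdot> (gm G \<cdot> pair ?g ?f (?T y x x) (?T z z y))"
    if xyz: "x \<in> hom Z (Dom \<C> d)" "y \<in> hom Z (Dom \<C> d)" "z \<in> hom Z (Dom \<C> d)"
      "d \<cdot> x = d \<cdot> y" "c \<cdot> y = c \<cdot> z" for Z x y z
  proof -
    note t = triple_props[OF sp xyz] and t' = tri[OF xyz]
    have "?T (kpc_mid d c) ?g ?g \<cdot> ?T x y z = ?T y x x" "?T ?f ?f (kpc_mid d c) \<cdot> ?T x y z = ?T z z y"
      using triple_Cmp[OF sp K(2,1,1) K(4)[symmetric] refl, of "?T x y z" Z]
        triple_Cmp[OF sp K(3,3,2) refl K(5)[symmetric], of "?T x y z" Z] t by simp_all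
    then have "pair ?g ?f (?T (kpc_mid d c) ?g ?g) (?T ?f ?f (kpc_mid d c)) \<cdot> ?T x y z =
        pair ?g ?f (?T y x x) (?T z z y)"
      by (subst pair_Cmp[OF R(8) _ _ _ _ _ tk(3)]) (use tk(1,2) t K(1,3) in simp_all)
    then show ?thesis unfolding mid_comp_def using P M(2) K t by simp
  qed
  show "is_kpc_operation \<C> d c (mid_comp G d c)"
    unfolding is_kpc_operation_def
  proof (intro conjI ballI allI impI)
    show "mid_comp G d c \<in> hom (kpc d c) (Dom \<C> d)" by (rule hom)
    fix Z x y z
    assume x: "x \<in> hom Z (Dom \<C> d)" and y: "y \<in> hom Z (Dom \<C> d)" and z: "z \<in> hom Z (Dom \<C> d)"
      and eq: "d \<cdot> x = d \<cdot> y \<and> c \<cdot> y = c \<cdot> z"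
    then have e1: "d \<cdot> x = d \<cdot> y" and e2: "c \<cdot> y = c \<cdot> z" by auto
    have unit: "?T (\<one> (Dom \<C> d)) (\<one> (Dom \<C> d)) (\<one> (Dom \<C> d)) \<cdot> w = ?T w w w"
      if "w \<in> hom Z (Dom \<C> d)" for w
      using triple_Cmp[OF sp _ _ _ refl refl that] that o by simp
    note t = tri[OF x y z e1 e2]
    have C: "gm G \<cdot> pair ?g ?f (?T y x x) (?T z z y) \<in> hom Z (kpc d c)"
      "?g \<cdot> (gm G \<cdot> pair ?g ?f (?T y x x) (?T z z y)) = z"
      "?f \<cdot> (gm G \<cdot> pair ?g ?f (?T y x x) (?T z z y)) = x"
      using E(1)[OF t(1,2,3)] t by simp_all
    have mid: "d \<cdot> (kpc_mid d c \<cdot> u) = d \<cdot> (?g \<cdot> u)" "c \<cdot> (kpc_mid d c \<cdot> u) = c \<cdot> (?f \<cdot> u)"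
      if "u \<in> hom Z (kpc d c)" for u
      using Cmp_eq_extend[OF K(4), of u] Cmp_eq_extend[OF K(5), of u] that K S by auto
    show "d \<cdot> (mid_comp G d c \<cdot> ?T x y z) = d \<cdot> z" "c \<cdot> (mid_comp G d c \<cdot> ?T x y z) = c \<cdot> x"
      unfolding el[OF x y z e1 e2] using mid[OF C(1)] C by simp_all
    note t1 = triple_props[OF sp y x x e1[symmetric] refl]
    have "gm G \<cdot> pair ?g ?f (?T y x x) (?T y y y) = ?T y x x"
      using E(2)[of "?T y x x" Z] t1 unit[OF y] by simp
    then show "mid_comp G d c \<cdot> ?T x y y = x"
      unfolding el[OF x y y e1 refl] using t1 by simp
    note t2 = triple_props[OF sp z z y refl e2[symmetric]]
    have "gm G \<cdot> pair ?g ?f (?T y y y) (?T z z y) = ?T z z y"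
      using E(3)[of "?T z z y" Z] t2 unit[OF y] by simp
    then show "mid_comp G d c \<cdot> ?T y y z = z"
      unfolding el[OF y y z refl e2] using t2 by simp
  qed
qed

lemma kpc_map_graph_morphism:
  assumes dc: "(d, c) \<in> \<M>" and dc': "(d', c') \<in> \<M>"
    and f: "f \<in> hom (Dom \<C> d) (Dom \<C> d')"
    and f0: "f\<^sub>0 \<in> hom (Cod \<C> d) (Cod \<C> d')" and f1: "f\<^sub>1 \<in> hom (Cod \<C> c) (Cod \<C> c')"
    and eq: "d' \<cdot> f = f\<^sub>0 \<cdot> d" "c' \<cdot> f = f\<^sub>1 \<cdot> c"
  shows "rgraph_morphism \<C> (kpc_graph d c) (kpc_graph d' c') (kpc_map d c d' c' f) f"
proof -
  note sp = M_span[OF dc] and sp' = M_span[OF dc']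
  note M = kpc_map_props[OF sp sp' f f0 f1 eq] and S = spansD[OF sp] and S' = spansD[OF sp']
  have o: "Dom \<C> d \<in> Obj \<C>" "Dom \<C> d' \<in> Obj \<C>" using S S' by auto
  show ?thesis
    unfolding rgraph_morphism_def kpc_graph_def
    using M(1-4) M(5)[of "\<one> (Dom \<C> d)" "Dom \<C> d" "\<one> (Dom \<C> d)" "\<one> (Dom \<C> d)"]
      triple_Cmp[OF sp' _ _ _ refl refl f, of "\<one> (Dom \<C> d')"]
      o f by simp
qed

lemma mid_comp_natural:
  assumes dc: "(d, c) \<in> \<M>" and G: "internal_category \<C> G" and Gdc: "forget_obj G = kpc_graph d c"
    and dc': "(d', c') \<in> \<M>" and G': "internal_category \<C> G'" and Gdc': "forget_obj G' = kpc_graph d' c'"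
    and f: "f \<in> hom (Dom \<C> d) (Dom \<C> d')"
    and f0: "f\<^sub>0 \<in> hom (Cod \<C> d) (Cod \<C> d')" and f1: "f\<^sub>1 \<in> hom (Cod \<C> c) (Cod \<C> c')"
    and eq: "d' \<cdot> f = f\<^sub>0 \<cdot> d" "c' \<cdot> f = f\<^sub>1 \<cdot> c"
    and F: "internal_functor \<C> G G' (kpc_map d c d' c' f) f"
  shows "f \<cdot> mid_comp G d c = mid_comp G' d' c' \<cdot> kpc_map d c d' c' f"
proof -
  note sp = M_span[OF dc] and sp' = M_span[OF dc']
  note S = spansD[OF sp] and K = kpc_components[OF sp] and S' = spansD[OF sp'] and K' = kpc_components[OF sp']
  note M = kpc_map_props[OF sp sp' f f0 f1 eq]
  have sel: "C1 G = kpc d c" "C0 G = Dom \<C> d" "gd G = kpc_dom d c" "gc G = kpc_cod d c"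
    "C1 G' = kpc d' c'" "C0 G' = Dom \<C> d'" "gd G' = kpc_dom d' c'" "gc G' = kpc_cod d' c'"
    using arg_cong[OF Gdc, of C1] arg_cong[OF Gdc, of C0] arg_cong[OF Gdc, of gd]
      arg_cong[OF Gdc, of gc] arg_cong[OF Gdc', of C1] arg_cong[OF Gdc', of C0]
      arg_cong[OF Gdc', of gd] arg_cong[OF Gdc', of gc] by (simp_all add: kpc_graph_def)
  note MG = internal_categoryD[OF G, unfolded sel] and MG' = internal_categoryD[OF G', unfolded sel]
  note R = reflexive_graphD[OF MG(1), unfolded sel] and R' = reflexive_graphD[OF MG'(1), unfolded sel]
  let ?g = "kpc_dom d c" and ?f = "kpc_cod d c" and ?k = "kpc_mid d c"
  let ?F = "kpc_map d c d' c' f" and ?T = "triple d c" and ?T' = "triple d' c'"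
  let ?a = "?T ?k ?g ?g" and ?b = "?T ?f ?f ?k"
  note a = triple_props[OF sp K(2,1,1) K(4)[symmetric] refl]
    and b = triple_props[OF sp K(3,3,2) refl K(5)[symmetric]]
  have ab: "?g \<cdot> ?a = ?f \<cdot> ?b" using a b by simp
  have P: "pair ?g ?f ?a ?b \<in> hom (kpc d c) (PB ?g ?f)" "\<pi>\<^sub>1 ?g ?f \<cdot> pair ?g ?f ?a ?b = ?a"
    "\<pi>\<^sub>2 ?g ?f \<cdot> pair ?g ?f ?a ?b = ?b"
    using pair_props[OF R(8) _ _ _ _ _ ab] a b K by simp_all
  have fun_comp: "?F \<cdot> gm G = gm G' \<cdot> pair (kpc_dom d' c') (kpc_cod d' c') (?F \<cdot> \<pi>\<^sub>1 ?g ?f) (?F \<cdot> \<pi>\<^sub>2 ?g ?f)"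
    using F unfolding internal_functor_def sel by blast
  have sq: "?g \<cdot> \<pi>\<^sub>1 ?g ?f = ?f \<cdot> \<pi>\<^sub>2 ?g ?f" by (rule pullback_square[OF R(8)])
  have Fsq: "kpc_dom d' c' \<cdot> (?F \<cdot> \<pi>\<^sub>1 ?g ?f) = kpc_cod d' c' \<cdot> (?F \<cdot> \<pi>\<^sub>2 ?g ?f)"
    using Cmp_eq_extend[OF M(2), of "\<pi>\<^sub>1 ?g ?f"] Cmp_eq_extend[OF M(4), of "\<pi>\<^sub>2 ?g ?f"] sq M(1) K K' R(8) f
    by simp
  have k: "f \<cdot> ?g \<in> hom (kpc d c) (Dom \<C> d')" "f \<cdot> ?k \<in> hom (kpc d c) (Dom \<C> d')"
    "f \<cdot> ?f \<in> hom (kpc d c) (Dom \<C> d')" "d' \<cdot> (f \<cdot> ?g) = d' \<cdot> (f \<cdot> ?k)" "c' \<cdot> (f \<cdot> ?k) = c' \<cdot> (f \<cdot> ?f)"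
    using M(6)[OF K(1,2,4)] M(7)[OF K(2,3,5)] K f by auto
  have Fab: "?F \<cdot> ?a = ?T' (f \<cdot> ?k) (f \<cdot> ?g) (f \<cdot> ?g)" "?F \<cdot> ?b = ?T' (f \<cdot> ?f) (f \<cdot> ?f) (f \<cdot> ?k)"
    using M(5)[OF K(2,1,1) K(4)[symmetric] refl] M(5)[OF K(3,3,2) refl K(5)[symmetric]] by simp_all
  have Fmap: "?F = ?T' (f \<cdot> ?g) (f \<cdot> ?k) (f \<cdot> ?f)" by (simp add: kpc_map_def kpc_mid_def)
  have pP: "pair (kpc_dom d' c') (kpc_cod d' c') (?F \<cdot> \<pi>\<^sub>1 ?g ?f) (?F \<cdot> \<pi>\<^sub>2 ?g ?f) \<in> hom (PB ?g ?f) (PB (kpc_dom d' c') (kpc_cod d' c'))"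
    "pair (kpc_dom d' c') (kpc_cod d' c') (?F \<cdot> \<pi>\<^sub>1 ?g ?f) (?F \<cdot> \<pi>\<^sub>2 ?g ?f) \<cdot> pair ?g ?f ?a ?b =
      pair (kpc_dom d' c') (kpc_cod d' c') (?F \<cdot> ?a) (?F \<cdot> ?b)"
    using pair_props[OF R'(8) _ _ _ _ _ Fsq] pair_Cmp[OF R'(8) _ _ _ _ _ Fsq, of "pair ?g ?f ?a ?b"]
      M(1) R(8) K K' P by simp_all
  have "f \<cdot> mid_comp G d c = kpc_mid d' c' \<cdot> (?F \<cdot> (gm G \<cdot> pair ?g ?f ?a ?b))"
    unfolding mid_comp_def using Cmp_eq_extend[OF M(3), of "gm G \<cdot> pair ?g ?f ?a ?b"] M(1) MG(2) P K K' f by simp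
  also have "?F \<cdot> (gm G \<cdot> pair ?g ?f ?a ?b) =
      gm G' \<cdot> pair (kpc_dom d' c') (kpc_cod d' c') (?F \<cdot> ?a) (?F \<cdot> ?b)"
    using Cmp_eq_extend[OF fun_comp, of "pair ?g ?f ?a ?b"] P MG(2) MG'(2) M(1) pP by simp
  also have "kpc_mid d' c' \<cdot> \<dots> = mid_comp G' d' c' \<cdot> ?F"
    unfolding Fab unfolding Fmap using mid_comp_props(2)[OF dc' G' Gdc' k] by simp
  finally show ?thesis .
qed

text \<open>Functoriality of the section says that the graph morphism induced by a morphism of spans preserves
  composition, which is naturality of the operation read off from it.\<close>
lemma natural_operations_if_Cat_section:
  assumes "has_section (Cat \<C> \<M>) (RG \<C> \<M>) forget_obj forget_mor"
  obtains p where "natural_operations p"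
proof -
  obtain SO SA where S: "is_functor (RG \<C> \<M>) (Cat \<C> \<M>) SO SA"
    and SO: "\<And>Y. Y \<in> Obj (RG \<C> \<M>) \<Longrightarrow> forget_obj (SO Y) = Y"
    and SA: "\<And>g. g \<in> Arr (RG \<C> \<M>) \<Longrightarrow> forget_mor (SA g) = g"
    using assms unfolding has_section_def by blast
  let ?p = "\<lambda>d c. mid_comp (SO (kpc_graph d c)) d c"
  have cat: "internal_category \<C> (SO (kpc_graph d c))" "forget_obj (SO (kpc_graph d c)) = kpc_graph d c"
    if dc: "(d, c) \<in> \<M>" for d c
  proof -
    have "SO (kpc_graph d c) \<in> Obj (Cat \<C> \<M>)"
      using S kpc_graph_in_RG[OF dc] unfolding is_functor_def by blast
    then show "internal_category \<C> (SO (kpc_graph d c))" by (simp add: Cat_def graph_cat_def)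
    show "forget_obj (SO (kpc_graph d c)) = kpc_graph d c" by (rule SO[OF kpc_graph_in_RG[OF dc]])
  qed
  have "f \<cdot> ?p d c = ?p d' c' \<cdot> kpc_map d c d' c' f"
    if dc: "(d, c) \<in> \<M>" and dc': "(d', c') \<in> \<M>" and f: "f \<in> hom (Dom \<C> d) (Dom \<C> d')"
      and f0: "f\<^sub>0 \<in> hom (Cod \<C> d) (Cod \<C> d')" and f1: "f\<^sub>1 \<in> hom (Cod \<C> c) (Cod \<C> c')"
      and eq: "d' \<cdot> f = f\<^sub>0 \<cdot> d" "c' \<cdot> f = f\<^sub>1 \<cdot> c"
    for d c d' c' f f\<^sub>0 f\<^sub>1
  proof -
    let ?\<phi> = "\<lparr>src = kpc_graph d c, tgt = kpc_graph d' c', mor1 = kpc_map d c d' c' f, mor0 = f\<rparr>"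
    have \<phi>: "?\<phi> \<in> Arr (RG \<C> \<M>)"
      using kpc_graph_in_RG[OF dc] kpc_graph_in_RG[OF dc'] kpc_map_graph_morphism[OF dc dc' f f0 f1 eq]
      by (simp add: RG_def graph_cat_def)
    have "SA ?\<phi> \<in> hom\<^bsub>Cat \<C> \<M>\<^esub> (SO (Dom (RG \<C> \<M>) ?\<phi>)) (SO (Cod (RG \<C> \<M>) ?\<phi>))"
      using S \<phi> unfolding is_functor_def by blast
    then have "SA ?\<phi> \<in> hom\<^bsub>Cat \<C> \<M>\<^esub> (SO (kpc_graph d c)) (SO (kpc_graph d' c'))"
      by (simp add: RG_def graph_cat_def)
    moreover have "mor1 (SA ?\<phi>) = kpc_map d c d' c' f" "mor0 (SA ?\<phi>) = f"
      using SA[OF \<phi>] by (simp_all add: forget_mor_def)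
    ultimately have "internal_functor \<C> (SO (kpc_graph d c)) (SO (kpc_graph d' c')) (kpc_map d c d' c' f) f"
      by (auto simp: Cat_def graph_cat_def hom_def)
    then show ?thesis
      using mid_comp_natural[OF dc cat[OF dc] dc' cat[OF dc'] f f0 f1 eq] by blast
  qed
  then have "natural_operations ?p"
    unfolding natural_operations_def using mid_comp_props(3) cat by blast
  then show ?thesis by (rule that)
qed

section \<open>Groupoid structures from natural operations\<close>

definition graph_groupoid :: "('m \<Rightarrow> 'm \<Rightarrow> 'm) \<Rightarrow> ('o, 'm) rgraph \<Rightarrow> ('o, 'm) igrpd"
  where "graph_groupoid p G = (let d = gd G; e = ge G; c = gc G in
    \<lparr>C1 = C1 G, C0 = C0 G, gd = d, ge = e, gc = c,
     gm = p d c \<cdot> triple d c (\<pi>\<^sub>1 d c) (e \<cdot> (d \<cdot> \<pi>\<^sub>1 d c)) (\<pi>\<^sub>2 d c),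
     gi = p d c \<cdot> triple d c (e \<cdot> d) (\<one> (C1 G)) (e \<cdot> c)\<rparr>)"

lemma graph_groupoid_sel [simp]:
  "C1 (graph_groupoid p G) = C1 G" "C0 (graph_groupoid p G) = C0 G" "gd (graph_groupoid p G) = gd G"
  "ge (graph_groupoid p G) = ge G" "gc (graph_groupoid p G) = gc G"
  by (simp_all add: graph_groupoid_def Let_def)

lemma forget_graph_groupoid: "forget_obj (graph_groupoid p G) = G"
  by (simp add: forget_obj_def rgraph.truncate_def)

context
  fixes p :: "'m \<Rightarrow> 'm \<Rightarrow> 'm" and G :: "('o, 'm) rgraph"
  assumes split: "split_pullback_condition \<C> \<M>" and nat: "natural_operations p"
    and refl_graph: "reflexive_graph \<C> G" and dc: "(gd G, gc G) \<in> \<M>"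
begin

lemma graph_op: "is_kpc_operation \<C> (gd G) (gc G) (p (gd G) (gc G))"
  by (rule natural_operations_op[OF nat dc])

lemma graph_comp_hom: "gm (graph_groupoid p G) \<in> hom (PB (gd G) (gc G)) (C1 G)"
  and graph_comp: "\<And>Z x y. x \<in> hom Z (C1 G) \<Longrightarrow> y \<in> hom Z (C1 G) \<Longrightarrow> gd G \<cdot> x = gc G \<cdot> y \<Longrightarrow>
    gm (graph_groupoid p G) \<cdot> pair (gd G) (gc G) x y =
    p (gd G) (gc G) \<cdot> triple (gd G) (gc G) x (ge G \<cdot> (gd G \<cdot> x)) y"
proof -
  note R = reflexive_graphD[OF refl_graph] and sp = M_span[OF dc]
  note P = kpc_operationD[OF graph_op]
  let ?l = "\<pi>\<^sub>1 (gd G) (gc G)" and ?r = "\<pi>\<^sub>2 (gd G) (gc G)"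
  have D: "Dom \<C> (gd G) = C1 G" using R(1) by simp
  have l: "?l \<in> hom (PB (gd G) (gc G)) (C1 G)" and r: "?r \<in> hom (PB (gd G) (gc G)) (C1 G)"
    using R(1,2,8) by auto
  note u = graph_unit_eqs[OF refl_graph l]
  have cy: "gc G \<cdot> (ge G \<cdot> (gd G \<cdot> ?l)) = gc G \<cdot> ?r"
    using u(4) pullback_square[OF R(8)] by simp
  note args = l[folded D] u(1)[folded D] r[folded D] u(3)[symmetric] cy
  note T = triple_props[OF sp args]
  have m: "gm (graph_groupoid p G) = p (gd G) (gc G) \<cdot> triple (gd G) (gc G) ?l (ge G \<cdot> (gd G \<cdot> ?l)) ?r"
    by (simp add: graph_groupoid_def Let_def)
  show "gm (graph_groupoid p G) \<in> hom (PB (gd G) (gc G)) (C1 G)"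
    unfolding m using T P D by simp
  fix Z x y assume x: "x \<in> hom Z (C1 G)" and y: "y \<in> hom Z (C1 G)" and eq: "gd G \<cdot> x = gc G \<cdot> y"
  have w: "pair (gd G) (gc G) x y \<in> hom Z (PB (gd G) (gc G))"
    "?l \<cdot> pair (gd G) (gc G) x y = x" "?r \<cdot> pair (gd G) (gc G) x y = y"
    using pair_props[OF R(8) _ _ _ _ _ eq] x y R(1,2) by simp_all
  have "triple (gd G) (gc G) ?l (ge G \<cdot> (gd G \<cdot> ?l)) ?r \<cdot> pair (gd G) (gc G) x y =
      triple (gd G) (gc G) x (ge G \<cdot> (gd G \<cdot> x)) y"
    unfolding triple_Cmp[OF sp args w(1)] using w l R(1-3) by simp
  then show "gm (graph_groupoid p G) \<cdot> pair (gd G) (gc G) x y =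
    p (gd G) (gc G) \<cdot> triple (gd G) (gc G) x (ge G \<cdot> (gd G \<cdot> x)) y"
    unfolding m using w(1) T P by simp
qed

lemma graph_comp_props:
  assumes x: "x \<in> hom Z (C1 G)" and y: "y \<in> hom Z (C1 G)" and eq: "gd G \<cdot> x = gc G \<cdot> y"
  shows "p (gd G) (gc G) \<cdot> triple (gd G) (gc G) x (ge G \<cdot> (gd G \<cdot> x)) y \<in> hom Z (C1 G)"
    "gd G \<cdot> (p (gd G) (gc G) \<cdot> triple (gd G) (gc G) x (ge G \<cdot> (gd G \<cdot> x)) y) = gd G \<cdot> y"
    "gc G \<cdot> (p (gd G) (gc G) \<cdot> triple (gd G) (gc G) x (ge G \<cdot> (gd G \<cdot> x)) y) = gc G \<cdot> x"
proof -
  have D: "Dom \<C> (gd G) = C1 G" using reflexive_graphD[OF refl_graph] by simp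
  note u = graph_unit_eqs[OF refl_graph x]
  have cy: "gc G \<cdot> (ge G \<cdot> (gd G \<cdot> x)) = gc G \<cdot> y" using u(4) eq by simp
  from kpc_operation_laws[OF graph_op M_span[OF dc], unfolded D, OF x u(1) y u(3)[symmetric] cy]
  show "p (gd G) (gc G) \<cdot> triple (gd G) (gc G) x (ge G \<cdot> (gd G \<cdot> x)) y \<in> hom Z (C1 G)"
    "gd G \<cdot> (p (gd G) (gc G) \<cdot> triple (gd G) (gc G) x (ge G \<cdot> (gd G \<cdot> x)) y) = gd G \<cdot> y"
    "gc G \<cdot> (p (gd G) (gc G) \<cdot> triple (gd G) (gc G) x (ge G \<cdot> (gd G \<cdot> x)) y) = gc G \<cdot> x" .
qed

text \<open>Associativity of the composition is that of \<open>p\<close> at \<open>(x, e d x, y, e d y, z)\<close>.\<close>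
lemma graph_category: "internal_category \<C> (graph_groupoid p G)"
proof -
  note R = reflexive_graphD[OF refl_graph]
  let ?d = "gd G" and ?c = "gc G" and ?e = "ge G" and ?p = "p (gd G) (gc G)"
  let ?m = "gm (graph_groupoid p G)"
  let ?l = "\<pi>\<^sub>1 ?d ?c" and ?r = "\<pi>\<^sub>2 ?d ?c"
  have D: "Dom \<C> ?d = C1 G" using R(1) by simp
  have one: "\<one> (C1 G) \<in> hom (C1 G) (C1 G)" using R(6) by simp
  have l: "?l \<in> hom (PB ?d ?c) (C1 G)" and r: "?r \<in> hom (PB ?d ?c) (C1 G)"
    using R(1,2,8) by auto
  have m: "?m = ?p \<cdot> triple ?d ?c ?l (?e \<cdot> (?d \<cdot> ?l)) ?r"
    by (simp add: graph_groupoid_def Let_def)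
  note lr = graph_comp_props[OF l r pullback_square[OF R(8)]]
  have ed: "?e \<cdot> ?d \<in> hom (C1 G) (C1 G)" "?e \<cdot> ?c \<in> hom (C1 G) (C1 G)"
    "?d \<cdot> \<one> (C1 G) = ?d" "?c \<cdot> \<one> (C1 G) = ?c"
    using R(1,2,3) by simp_all
  note u = graph_unit_eqs[OF refl_graph one, unfolded ed(3,4)]
  have "reflexive_graph \<C> (graph_groupoid p G)"
    using refl_graph by (simp add: reflexive_graph_def)
  moreover have "?m \<cdot> pair ?d ?c (\<one> (C1 G)) (?e \<cdot> ?d) = \<one> (C1 G)"
  proof -
    have "?d \<cdot> \<one> (C1 G) = ?c \<cdot> (?e \<cdot> ?d)" using u(4) ed(3) by simp
    note graph_comp[OF one ed(1) this, unfolded ed(3)]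
    also have "?p \<cdot> triple ?d ?c (\<one> (C1 G)) (?e \<cdot> ?d) (?e \<cdot> ?d) = \<one> (C1 G)"
      by (rule kpc_operation_units(1)[OF graph_op, of _ "C1 G"])
        (use one ed(1) D u(3) ed(3) in simp_all)
    finally show ?thesis .
  qed
  moreover have "?m \<cdot> pair ?d ?c (?e \<cdot> ?c) (\<one> (C1 G)) = \<one> (C1 G)"
  proof -
    have eq: "?d \<cdot> (?e \<cdot> ?c) = ?c \<cdot> \<one> (C1 G)" using u(5) ed(4) by simp
    note graph_comp[OF ed(2) one eq, unfolded eq ed(4)]
    also have "?p \<cdot> triple ?d ?c (?e \<cdot> ?c) (?e \<cdot> ?c) (\<one> (C1 G)) = \<one> (C1 G)"
      by (rule kpc_operation_units(2)[OF graph_op, of _ "C1 G"])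
        (use one ed(2) D u(6) ed(4) in simp_all)
    finally show ?thesis .
  qed
  moreover have "?m \<cdot> pair ?d ?c (?m \<cdot> pair ?d ?c x y) z = ?m \<cdot> pair ?d ?c x (?m \<cdot> pair ?d ?c y z)"
    if x: "x \<in> hom Z (C1 G)" and y: "y \<in> hom Z (C1 G)" and z: "z \<in> hom Z (C1 G)"
      and xy: "?d \<cdot> x = ?c \<cdot> y" and yz: "?d \<cdot> y = ?c \<cdot> z" for Z x y z
  proof -
    note a = graph_comp_props[OF x y xy] and b = graph_comp_props[OF y z yz]
    note ux = graph_unit_eqs[OF refl_graph x] and uy = graph_unit_eqs[OF refl_graph y]
    have 1: "?d \<cdot> (?p \<cdot> triple ?d ?c x (?e \<cdot> (?d \<cdot> x)) y) = ?c \<cdot> z" using a(2) yz by simp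
    have 2: "?d \<cdot> x = ?c \<cdot> (?p \<cdot> triple ?d ?c y (?e \<cdot> (?d \<cdot> y)) z)" using b(3) xy by simp
    have 3: "?c \<cdot> (?e \<cdot> (?d \<cdot> x)) = ?c \<cdot> y" using ux(4) xy by simp
    have 4: "?c \<cdot> (?e \<cdot> (?d \<cdot> y)) = ?c \<cdot> z" using uy(4) yz by simp
    show ?thesis
      unfolding graph_comp[OF x y xy] graph_comp[OF y z yz] graph_comp[OF a(1) z 1] graph_comp[OF x b(1) 2] a(2)
      by (rule kpc_operation_assoc[OF split dc graph_op, unfolded D, OF x ux(1) y uy(1) z
            ux(3)[symmetric] 3 uy(3)[symmetric] 4, symmetric])
  qed
  ultimately show ?thesis
    unfolding internal_category_def Let_def graph_groupoid_sel
    using graph_comp_hom lr(2,3)[folded m] by blast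
qed

text \<open>Both inverse laws come from one application of associativity and the two unit laws of \<open>p\<close>:
  \<open>p(x, e d x, p(e d x, x, e c x)) = p(p(x, e d x, e d x), x, e c x) = p(x, x, e c x) = e c x\<close>, and
  symmetrically on the other side.\<close>
lemma graph_groupoid: "internal_groupoid \<C> (graph_groupoid p G)"
proof -
  note R = reflexive_graphD[OF refl_graph] and sp = M_span[OF dc]
  let ?d = "gd G" and ?c = "gc G" and ?e = "ge G" and ?p = "p (gd G) (gc G)"
  let ?m = "gm (graph_groupoid p G)" and ?i = "gi (graph_groupoid p G)"
  have D: "Dom \<C> ?d = C1 G" using R(1) by simp
  have one: "\<one> (C1 G) \<in> hom (C1 G) (C1 G)" using R(6) by simp
  have ed: "?e \<cdot> ?d \<in> hom (C1 G) (C1 G)" "?e \<cdot> ?c \<in> hom (C1 G) (C1 G)"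
    "?d \<cdot> \<one> (C1 G) = ?d" "?c \<cdot> \<one> (C1 G) = ?c"
    using R(1,2,3) by simp_all
  note u = graph_unit_eqs[OF refl_graph one, unfolded ed(3,4)]
  have i: "?i = ?p \<cdot> triple ?d ?c (?e \<cdot> ?d) (\<one> (C1 G)) (?e \<cdot> ?c)"
    by (simp add: graph_groupoid_def Let_def)
  have eqs: "?d \<cdot> (?e \<cdot> ?d) = ?d \<cdot> \<one> (C1 G)" "?c \<cdot> \<one> (C1 G) = ?c \<cdot> (?e \<cdot> ?c)"
    unfolding ed(3,4) u(3,6) by simp_all
  note laws = kpc_operation_laws[OF graph_op sp, unfolded D, OF ed(1) one ed(2) eqs, folded i, unfolded u]
  have "?m \<cdot> pair ?d ?c (\<one> (C1 G)) ?i = ?e \<cdot> ?c"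
  proof -
    have eq: "?d \<cdot> \<one> (C1 G) = ?c \<cdot> ?i" using laws(3) ed(3) by simp
    have "?m \<cdot> pair ?d ?c (\<one> (C1 G)) ?i =
        ?p \<cdot> triple ?d ?c (\<one> (C1 G)) (?e \<cdot> ?d) (?p \<cdot> triple ?d ?c (?e \<cdot> ?d) (\<one> (C1 G)) (?e \<cdot> ?c))"
      using graph_comp[OF one laws(1) eq, unfolded ed(3)] unfolding i .
    also have "\<dots> = ?p \<cdot> triple ?d ?c (?p \<cdot> triple ?d ?c (\<one> (C1 G)) (?e \<cdot> ?d) (?e \<cdot> ?d)) (\<one> (C1 G)) (?e \<cdot> ?c)"
      by (rule kpc_operation_assoc[OF split dc graph_op, unfolded D, OF one ed(1) ed(1) one ed(2)
            eqs(1)[symmetric] refl eqs])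
    also have "?p \<cdot> triple ?d ?c (\<one> (C1 G)) (?e \<cdot> ?d) (?e \<cdot> ?d) = \<one> (C1 G)"
      by (rule kpc_operation_units(1)[OF graph_op, unfolded D, OF one ed(1) eqs(1)[symmetric]])
    also have "?p \<cdot> triple ?d ?c (\<one> (C1 G)) (\<one> (C1 G)) (?e \<cdot> ?c) = ?e \<cdot> ?c"
      by (rule kpc_operation_units(2)[OF graph_op, unfolded D, OF one ed(2) eqs(2)])
    finally show ?thesis .
  qed
  moreover have "?m \<cdot> pair ?d ?c ?i (\<one> (C1 G)) = ?e \<cdot> ?d"
  proof -
    have eq: "?d \<cdot> ?i = ?c \<cdot> \<one> (C1 G)" using laws(2) ed(4) by simp
    have "?m \<cdot> pair ?d ?c ?i (\<one> (C1 G)) =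
        ?p \<cdot> triple ?d ?c (?p \<cdot> triple ?d ?c (?e \<cdot> ?d) (\<one> (C1 G)) (?e \<cdot> ?c)) (?e \<cdot> ?c) (\<one> (C1 G))"
      using graph_comp[OF laws(1) one eq, unfolded laws(2)] unfolding i .
    also have "\<dots> = ?p \<cdot> triple ?d ?c (?e \<cdot> ?d) (\<one> (C1 G)) (?p \<cdot> triple ?d ?c (?e \<cdot> ?c) (?e \<cdot> ?c) (\<one> (C1 G)))"
      by (rule kpc_operation_assoc[OF split dc graph_op, unfolded D, OF ed(1) one ed(2) ed(2) one
            eqs refl eqs(2)[symmetric], symmetric])
    also have "?p \<cdot> triple ?d ?c (?e \<cdot> ?c) (?e \<cdot> ?c) (\<one> (C1 G)) = \<one> (C1 G)"
      by (rule kpc_operation_units(2)[OF graph_op, unfolded D, OF ed(2) one eqs(2)[symmetric]])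
    also have "?p \<cdot> triple ?d ?c (?e \<cdot> ?d) (\<one> (C1 G)) (\<one> (C1 G)) = ?e \<cdot> ?d"
      by (rule kpc_operation_units(1)[OF graph_op, unfolded D, OF ed(1) one eqs(1)])
    finally show ?thesis .
  qed
  ultimately show ?thesis
    unfolding internal_groupoid_def Let_def graph_groupoid_sel
    using graph_category laws by blast
qed

end

text \<open>The object of composable pairs is a pullback of the split epimorphisms \<open>d\<close> and \<open>c\<close>, and the unit laws
  fix a composition on both sections.\<close>
lemma internal_comp_unique:
  assumes split: "split_pullback_condition \<C> \<M>"
    and X: "internal_category \<C> X" and Y: "internal_category \<C> Y"
    and eq: "forget_obj X = forget_obj Y" and dc: "(gd X, gc X) \<in> \<M>"
  shows "gm X = gm Y"
proof -
  have sel: "C1 Y = C1 X" "C0 Y = C0 X" "gd Y = gd X" "ge Y = ge X" "gc Y = gc X"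
    using arg_cong[OF eq, of C1] arg_cong[OF eq, of C0] arg_cong[OF eq, of gd]
      arg_cong[OF eq, of ge] arg_cong[OF eq, of gc] by simp_all
  note MX = internal_categoryD[OF X] and MY = internal_categoryD[OF Y, unfolded sel]
  note R = reflexive_graphD[OF MX(1)]
  have D: "Dom \<C> (gd X) = C1 X" using R(1) by simp
  have l: "\<one> (C1 X) \<cdot> \<pi>\<^sub>1 (gd X) (gc X) = \<pi>\<^sub>1 (gd X) (gc X)"
    "\<one> (C1 X) \<cdot> \<pi>\<^sub>2 (gd X) (gc X) = \<pi>\<^sub>2 (gd X) (gc X)"
    using R(1,2,8) by simp_all
  show ?thesis
    by (rule split_pullback_unique[OF split dc R(1,3,4) R(2,3,5), unfolded D,
          OF MX(2) MY(2) MX(5) MY(5) MX(6) MY(6), unfolded l, OF MX(3) MY(3) MX(4) MY(4)])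
qed

lemma internal_inverse_unique:
  assumes X: "internal_groupoid \<C> X" and Y: "internal_groupoid \<C> Y"
    and eq: "forget_obj X = forget_obj Y" and m: "gm X = gm Y"
  shows "gi X = gi Y"
proof -
  have sel: "C1 Y = C1 X" "C0 Y = C0 X" "gd Y = gd X" "ge Y = ge X" "gc Y = gc X" "gm Y = gm X"
    using arg_cong[OF eq, of C1] arg_cong[OF eq, of C0] arg_cong[OF eq, of gd]
      arg_cong[OF eq, of ge] arg_cong[OF eq, of gc] m by simp_all
  let ?d = "gd X" and ?e = "ge X" and ?c = "gc X" and ?i = "gi X" and ?j = "gi Y" and ?m = "gm X"
  have cat: "internal_category \<C> X" using X by (simp add: internal_groupoid_def)
  have i: "?i \<in> hom (C1 X) (C1 X)" "?d \<cdot> ?i = ?c" "?c \<cdot> ?i = ?d"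
    "?m \<cdot> pair ?d ?c (\<one> (C1 X)) ?i = ?e \<cdot> ?c"
    using X unfolding internal_groupoid_def Let_def by blast+
  have j: "?j \<in> hom (C1 X) (C1 X)" "?d \<cdot> ?j = ?c" "?c \<cdot> ?j = ?d"
    "?m \<cdot> pair ?d ?c ?j (\<one> (C1 X)) = ?e \<cdot> ?d"
    using Y unfolding internal_groupoid_def Let_def sel by blast+
  note M = internal_categoryD[OF cat] and E = internal_category_elements[OF cat]
  note R = reflexive_graphD[OF M(1)]
  have one: "\<one> (C1 X) \<in> hom (C1 X) (C1 X)" "?d \<cdot> \<one> (C1 X) = ?d" "?c \<cdot> \<one> (C1 X) = ?c"
    using R(1,2,6) by simp_all
  have "?i = ?m \<cdot> pair ?d ?c (?e \<cdot> (?c \<cdot> ?i)) ?i" by (rule E(3)[OF i(1), symmetric])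
  also have "?e \<cdot> (?c \<cdot> ?i) = ?m \<cdot> pair ?d ?c ?j (\<one> (C1 X))" unfolding i(3) j(4) ..
  also have "?m \<cdot> pair ?d ?c (?m \<cdot> pair ?d ?c ?j (\<one> (C1 X))) ?i =
      ?m \<cdot> pair ?d ?c ?j (?m \<cdot> pair ?d ?c (\<one> (C1 X)) ?i)"
    by (rule M(7)[OF j(1) one(1) i(1)]) (use one j i in simp_all)
  also have "?m \<cdot> pair ?d ?c (\<one> (C1 X)) ?i = ?e \<cdot> (?d \<cdot> ?j)" unfolding i(4) j(2) ..
  also have "?m \<cdot> pair ?d ?c ?j (?e \<cdot> (?d \<cdot> ?j)) = ?j" by (rule E(2)[OF j(1)])
  finally show ?thesis .
qed

text \<open>A graph morphism is a morphism between the span parts, and it preserves \<open>e\<close>, \<open>d\<close> and \<open>c\<close>, out of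
  which composition and inversion are built by means of \<open>p\<close>.\<close>
lemma graph_groupoid_morphism:
  assumes split: "split_pullback_condition \<C> \<M>" and nat: "natural_operations p"
    and G: "reflexive_graph \<C> G" "(gd G, gc G) \<in> \<M>" and H: "reflexive_graph \<C> H" "(gd H, gc H) \<in> \<M>"
    and f: "rgraph_morphism \<C> G H f\<^sub>1 f\<^sub>0"
  shows "groupoid_morphism \<C> (graph_groupoid p G) (graph_groupoid p H) f\<^sub>1 f\<^sub>0"
proof -
  note R = reflexive_graphD[OF G(1)] and R' = reflexive_graphD[OF H(1)]
  have F: "f\<^sub>1 \<in> hom (C1 G) (C1 H)" "f\<^sub>0 \<in> hom (C0 G) (C0 H)" "gd H \<cdot> f\<^sub>1 = f\<^sub>0 \<cdot> gd G"
    "gc H \<cdot> f\<^sub>1 = f\<^sub>0 \<cdot> gc G" "f\<^sub>1 \<cdot> ge G = ge H \<cdot> f\<^sub>0"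
    using f unfolding rgraph_morphism_def by blast+
  have D: "Dom \<C> (gd G) = C1 G" "Dom \<C> (gd H) = C1 H" "Cod \<C> (gd G) = C0 G" "Cod \<C> (gd H) = C0 H"
    "Cod \<C> (gc G) = C0 G" "Cod \<C> (gc H) = C0 H"
    using R(1,2) R'(1,2) by simp_all
  note natural = natural_operations_triple[OF nat G(2) H(2), unfolded D, OF F(1,2,2,3,4)]
  let ?l = "\<pi>\<^sub>1 (gd G) (gc G)" and ?r = "\<pi>\<^sub>2 (gd G) (gc G)"
  have one: "\<one> (C1 G) \<in> hom (C1 G) (C1 G)" using R(6) by simp
  have l: "?l \<in> hom (PB (gd G) (gc G)) (C1 G)" and r: "?r \<in> hom (PB (gd G) (gc G)) (C1 G)"
    using R(1,2,8) by auto
  have sq: "gd G \<cdot> ?l = gc G \<cdot> ?r" by (rule pullback_square[OF R(8)])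
  have dcx: "gd H \<cdot> (f\<^sub>1 \<cdot> x) = f\<^sub>0 \<cdot> (gd G \<cdot> x)" "gc H \<cdot> (f\<^sub>1 \<cdot> x) = f\<^sub>0 \<cdot> (gc G \<cdot> x)"
    if "x \<in> hom Z (C1 G)" for x Z
    using that Cmp_eq_extend[OF F(3), of x] Cmp_eq_extend[OF F(4), of x] F(1,2) R(1,2) R'(1,2) by simp_all
  have ex: "f\<^sub>1 \<cdot> (ge G \<cdot> y) = ge H \<cdot> (f\<^sub>0 \<cdot> y)" if "y \<in> hom Z (C0 G)" for y Z
    using that Cmp_eq_extend[OF F(5), of y] F(1,2) R(3) R'(3) by simp
  have fl: "f\<^sub>1 \<cdot> ?l \<in> hom (PB (gd G) (gc G)) (C1 H)" "f\<^sub>1 \<cdot> ?r \<in> hom (PB (gd G) (gc G)) (C1 H)"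
    "gd H \<cdot> (f\<^sub>1 \<cdot> ?l) = gc H \<cdot> (f\<^sub>1 \<cdot> ?r)"
    using l r F(1) dcx(1)[OF l] dcx(2)[OF r] sq by simp_all
  have edl: "f\<^sub>1 \<cdot> (ge G \<cdot> (gd G \<cdot> ?l)) = ge H \<cdot> (gd H \<cdot> (f\<^sub>1 \<cdot> ?l))"
    using ex[of "gd G \<cdot> ?l" "PB (gd G) (gc G)"] dcx(1)[OF l] l R(1) by simp
  note u = graph_unit_eqs[OF G(1) l]
  have "f\<^sub>1 \<cdot> gm (graph_groupoid p G) =
      f\<^sub>1 \<cdot> (p (gd G) (gc G) \<cdot> triple (gd G) (gc G) ?l (ge G \<cdot> (gd G \<cdot> ?l)) ?r)"
    by (simp add: graph_groupoid_def Let_def)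
  also have "\<dots> = p (gd H) (gc H) \<cdot> triple (gd H) (gc H) (f\<^sub>1 \<cdot> ?l) (f\<^sub>1 \<cdot> (ge G \<cdot> (gd G \<cdot> ?l))) (f\<^sub>1 \<cdot> ?r)"
    by (rule natural[OF l u(1) r u(3)[symmetric]]) (rule trans[OF u(4) sq])
  also have "\<dots> = gm (graph_groupoid p H) \<cdot> pair (gd H) (gc H) (f\<^sub>1 \<cdot> ?l) (f\<^sub>1 \<cdot> ?r)"
    unfolding edl by (rule graph_comp[OF split nat H fl, symmetric])
  finally have comp: "f\<^sub>1 \<cdot> gm (graph_groupoid p G) =
      gm (graph_groupoid p H) \<cdot> pair (gd H) (gc H) (f\<^sub>1 \<cdot> ?l) (f\<^sub>1 \<cdot> ?r)" .
  have ed: "ge G \<cdot> gd G \<in> hom (C1 G) (C1 G)" "ge G \<cdot> gc G \<in> hom (C1 G) (C1 G)"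
    "gd G \<cdot> \<one> (C1 G) = gd G" "gc G \<cdot> \<one> (C1 G) = gc G"
    "ge H \<cdot> gd H \<in> hom (C1 H) (C1 H)" "ge H \<cdot> gc H \<in> hom (C1 H) (C1 H)"
    "gd H \<cdot> \<one> (C1 H) = gd H" "gc H \<cdot> \<one> (C1 H) = gc H" "\<one> (C1 H) \<in> hom (C1 H) (C1 H)"
    using R(1,2,3) R'(1,2,3,6) by simp_all
  note v = graph_unit_eqs[OF G(1) one, unfolded ed(3,4)]
  note w = graph_unit_eqs[OF H(1) ed(9), unfolded ed(7,8)]
  have f1: "f\<^sub>1 \<cdot> (ge G \<cdot> gd G) = (ge H \<cdot> gd H) \<cdot> f\<^sub>1" "f\<^sub>1 \<cdot> (ge G \<cdot> gc G) = (ge H \<cdot> gc H) \<cdot> f\<^sub>1"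
    "f\<^sub>1 \<cdot> \<one> (C1 G) = \<one> (C1 H) \<cdot> f\<^sub>1"
    using ex[of "gd G" "C1 G"] ex[of "gc G" "C1 G"] F(1,3,4) R(1,2) R'(1,2,3) by simp_all
  have eqs: "gd H \<cdot> (ge H \<cdot> gd H) = gd H \<cdot> \<one> (C1 H)" "gc H \<cdot> \<one> (C1 H) = gc H \<cdot> (ge H \<cdot> gc H)"
    unfolding w ed(7,8) by simp_all
  note sp' = M_span[OF H(2)]
  note args' = ed(5)[folded D(2)] ed(9)[folded D(2)] ed(6)[folded D(2)]
  have "f\<^sub>1 \<cdot> gi (graph_groupoid p G) =
      f\<^sub>1 \<cdot> (p (gd G) (gc G) \<cdot> triple (gd G) (gc G) (ge G \<cdot> gd G) (\<one> (C1 G)) (ge G \<cdot> gc G))"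
    by (simp add: graph_groupoid_def Let_def)
  also have "\<dots> = p (gd H) (gc H) \<cdot>
      triple (gd H) (gc H) (f\<^sub>1 \<cdot> (ge G \<cdot> gd G)) (f\<^sub>1 \<cdot> \<one> (C1 G)) (f\<^sub>1 \<cdot> (ge G \<cdot> gc G))"
    by (rule natural[OF ed(1) one ed(2)]) (simp_all only: v ed)
  also have "triple (gd H) (gc H) (f\<^sub>1 \<cdot> (ge G \<cdot> gd G)) (f\<^sub>1 \<cdot> \<one> (C1 G)) (f\<^sub>1 \<cdot> (ge G \<cdot> gc G)) =
      triple (gd H) (gc H) (ge H \<cdot> gd H) (\<one> (C1 H)) (ge H \<cdot> gc H) \<cdot> f\<^sub>1"
    unfolding f1 by (rule triple_Cmp[OF sp', unfolded D, OF ed(5,9,6) eqs F(1), symmetric])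
  also have "p (gd H) (gc H) \<cdot> \<dots> = gi (graph_groupoid p H) \<cdot> f\<^sub>1"
    using triple_props[OF sp', unfolded D, OF ed(5,9,6) eqs]
      kpc_operationD[OF natural_operations_op[OF nat H(2)]] F(1)
    by (simp add: graph_groupoid_def Let_def)
  finally have inv: "f\<^sub>1 \<cdot> gi (graph_groupoid p G) = gi (graph_groupoid p H) \<cdot> f\<^sub>1" .
  have "rgraph_morphism \<C> (graph_groupoid p G) (graph_groupoid p H) f\<^sub>1 f\<^sub>0"
    using f by (simp add: rgraph_morphism_def)
  then show ?thesis
    unfolding groupoid_morphism_def internal_functor_def graph_groupoid_sel using comp inv by blast
qed

lemma Lawvere_if_split_pullback:
  assumes split: "split_pullback_condition \<C> \<M>"
  shows "Lawvere_condition \<C> \<M>"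
proof -
  obtain p where nat: "natural_operations p" using natural_operations_exist[OF split] .
  let ?GO = "graph_groupoid p"
  let ?GA = "\<lambda>\<phi>. \<lparr>src = ?GO (src \<phi>), tgt = ?GO (tgt \<phi>), mor1 = mor1 \<phi>, mor0 = mor0 \<phi>\<rparr>"
  have forget_graph: "reflexive_graph \<C> (forget_obj X) \<longleftrightarrow> reflexive_graph \<C> X" for X :: "('o, 'm) igrpd"
    by (simp add: reflexive_graph_def)
  have graph: "reflexive_graph \<C> X" if "internal_groupoid \<C> X" for X :: "('o, 'm) igrpd"
    using that by (simp add: internal_groupoid_def internal_category_def)
  have inv: "?GO (forget_obj X) = X" if X: "internal_groupoid \<C> X" and dc: "(gd X, gc X) \<in> \<M>"
    for X :: "('o, 'm) igrpd"
  proof -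
    have G: "internal_groupoid \<C> (?GO (forget_obj X))"
      using graph_groupoid[OF split nat, of "forget_obj X"] graph[OF X] dc forget_graph by simp
    have 1: "forget_obj (?GO (forget_obj X)) = forget_obj X" by (rule forget_graph_groupoid)
    have dc': "(gd (?GO (forget_obj X)), gc (?GO (forget_obj X))) \<in> \<M>" using dc by simp
    have 2: "gm (?GO (forget_obj X)) = gm X"
      using internal_comp_unique[OF split _ _ 1 dc'] G X by (simp add: internal_groupoid_def)
    have 3: "gi (?GO (forget_obj X)) = gi X"
      by (rule internal_inverse_unique[OF G X 1 2])
    show ?thesis using 2 3 by simp
  qed
  have F: "is_functor (Grpd \<C> \<M>) (RG \<C> \<M>) forget_obj forget_mor"
    unfolding is_functor_def
    by (auto simp: Grpd_def RG_def graph_cat_def hom_def forget_mor_def forget_graph graph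
        groupoid_morphism_def internal_functor_def rgraph_morphism_def)
  have G: "is_functor (RG \<C> \<M>) (Grpd \<C> \<M>) ?GO ?GA"
    unfolding is_functor_def
    using graph_groupoid[OF split nat] graph_groupoid_morphism[OF split nat]
    by (auto simp: Grpd_def RG_def graph_cat_def hom_def)
  have "\<forall>X \<in> Obj (Grpd \<C> \<M>). ?GO (forget_obj X) = X"
    using inv by (simp add: Grpd_def graph_cat_def)
  moreover have "\<forall>\<phi> \<in> Arr (Grpd \<C> \<M>). ?GA (forget_mor \<phi>) = \<phi>"
    using inv by (simp add: Grpd_def graph_cat_def forget_mor_def)
  moreover have "\<forall>Y \<in> Obj (RG \<C> \<M>). forget_obj (?GO Y) = Y"
    by (simp add: forget_graph_groupoid)
  moreover have "\<forall>\<phi> \<in> Arr (RG \<C> \<M>). forget_mor (?GA \<phi>) = \<phi>"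
    by (simp add: forget_mor_def forget_graph_groupoid)
  ultimately show ?thesis
    unfolding Lawvere_condition_def is_iso_of_categories_def using F G by blast
qed

lemma Cat_section_if_Grpd_section:
  assumes "has_section (Grpd \<C> \<M>) (RG \<C> \<M>) forget_obj forget_mor"
  shows "has_section (Cat \<C> \<M>) (RG \<C> \<M>) forget_obj forget_mor"
proof -
  obtain SO SA where S: "is_functor (RG \<C> \<M>) (Grpd \<C> \<M>) SO SA"
    and SO: "\<And>Y. Y \<in> Obj (RG \<C> \<M>) \<Longrightarrow> forget_obj (SO Y) = Y"
    and SA: "\<And>g. g \<in> Arr (RG \<C> \<M>) \<Longrightarrow> forget_mor (SA g) = g"
    using assms unfolding has_section_def by blast
  let ?T = "icat.truncate :: ('o, 'm) igrpd \<Rightarrow> ('o, 'm) icat"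
  let ?U = "\<lambda>\<phi> :: (('o, 'm) igrpd, 'm) gmor.
    \<lparr>src = ?T (src \<phi>), tgt = ?T (tgt \<phi>), mor1 = mor1 \<phi>, mor0 = mor0 \<phi>\<rparr>"
  have sel: "C1 (?T X) = C1 X" "C0 (?T X) = C0 X" "gd (?T X) = gd X" "ge (?T X) = ge X"
    "gc (?T X) = gc X" "gm (?T X) = gm X" for X
    by (simp_all add: icat.truncate_def)
  have forget: "forget_obj (?T X) = forget_obj X" "forget_mor (?U \<phi>) = forget_mor \<phi>" for X \<phi>
    by (simp_all add: forget_obj_def rgraph.truncate_def icat.truncate_def forget_mor_def)
  have cat: "internal_category \<C> (?T X)" if "internal_groupoid \<C> X" for X
  proof -
    have "internal_category \<C> X" using that by (simp add: internal_groupoid_def)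
    then show ?thesis unfolding internal_category_def reflexive_graph_def sel .
  qed
  have morph: "internal_functor \<C> (?T X) (?T Y) f\<^sub>1 f\<^sub>0" if "groupoid_morphism \<C> X Y f\<^sub>1 f\<^sub>0" for X Y f\<^sub>1 f\<^sub>0
  proof -
    have "internal_functor \<C> X Y f\<^sub>1 f\<^sub>0" using that by (simp add: groupoid_morphism_def)
    then show ?thesis unfolding internal_functor_def rgraph_morphism_def sel .
  qed
  have U: "is_functor (Grpd \<C> \<M>) (Cat \<C> \<M>) ?T ?U"
    unfolding is_functor_def using cat morph by (auto simp: Grpd_def Cat_def graph_cat_def hom_def sel)
  have "is_functor (RG \<C> \<M>) (Cat \<C> \<M>) (?T \<circ> SO) (?U \<circ> SA)"
    using S U by (auto simp: is_functor_def hom_def)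
  moreover have "\<forall>Y \<in> Obj (RG \<C> \<M>). forget_obj ((?T \<circ> SO) Y) = Y"
    using SO forget(1) by simp
  moreover have "\<forall>g \<in> Arr (RG \<C> \<M>). forget_mor ((?U \<circ> SA) g) = g"
    using SA forget(2) by simp
  ultimately show ?thesis unfolding has_section_def by blast
qed

lemma Grpd_section_if_Lawvere:
  "Lawvere_condition \<C> \<M> \<Longrightarrow> has_section (Grpd \<C> \<M>) (RG \<C> \<M>) forget_obj forget_mor"
  unfolding Lawvere_condition_def is_iso_of_categories_def has_section_def by blast

end

section \<open>The equivalence\<close>

theorem theorem1:
  fixes \<C> :: "('o, 'm) pcat" and \<M> :: "('m \<times> 'm) set"
  assumes "category \<C>"
    and "has_split_epi_pullbacks \<C>"
    and "pullback_choice \<C>"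
    and "\<M> \<subseteq> spans \<C>"
    and "closed_under_kpc \<C> \<M>"
    and "contains_local_products \<C> \<M>"
  shows "(Lawvere_condition \<C> \<M> \<longleftrightarrow> has_section (Grpd \<C> \<M>) (RG \<C> \<M>) forget_obj forget_mor) \<and>
    (has_section (Grpd \<C> \<M>) (RG \<C> \<M>) forget_obj forget_mor \<longleftrightarrow>
      has_section (Cat \<C> \<M>) (RG \<C> \<M>) forget_obj forget_mor) \<and>
    (has_section (Cat \<C> \<M>) (RG \<C> \<M>) forget_obj forget_mor \<longleftrightarrow> joint_mono_condition \<C> \<M>) \<and>
    (joint_mono_condition \<C> \<M> \<longleftrightarrow> split_pullback_condition \<C> \<M>) \<and>
    (split_pullback_condition \<C> \<M> \<longleftrightarrow> kpc_operations_condition \<C> \<M>)"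
proof -
  interpret span_class \<C> \<M>
    using assms by (simp add: span_class_def pullback_category_def pullback_category_axioms_def
        span_class_axioms_def)
  have "split_pullback_condition \<C> \<M>" if "has_section (Cat \<C> \<M>) (RG \<C> \<M>) forget_obj forget_mor"
    using natural_operations_if_Cat_section[OF that] split_pullback_condition_if_natural_operations
    by blast
  then show ?thesis
    using Lawvere_if_split_pullback Grpd_section_if_Lawvere Cat_section_if_Grpd_section
      joint_mono_if_split_pullback split_pullback_if_joint_mono kpc_operations_iff_split_pullback
    by blast
qed

end
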